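(* Let $X$ be a complex Banach space with the Radon-Nikodým property, let $Y$ be a nontrivial complex Banach space, and let $A(B_X,Y)$ denote either $A_u(B_X,Y)$ or $A_b(B_X,Y)$ (with $A(B_X)=A(B_X,\mathbb{C})$ of the same type). Then: (i) The set of all strong peak functions in $A(B_X,Y)$ is dense in $A(B_X,Y)$. In particular, if $Y$ is smooth, then the set of all smooth points of $B_{A(B_X,Y)}$ is dense in $S_{A(B_X,Y)}$. (ii) $\rho A(B_X)$ is a norming subset for $A(B_X,Y)$, and $\partial A(B_X,Y)=\overline{\rho A(B_X)}$, i.e. the closure of $\rho A(B_X)$ is the smallest closed norming subset for $A(B_X,Y)$. In particular, $\mathrm{ext}_{\mathbb C}(B_X)$ is a norming subset for $A(B_X,Y)$.
   Context: For a Banach space $Z$, $B_Z$ and $S_Z$ are the closed unit ball and unit sphere. $A_b(B_X,Y)$ is the Banach space (norm $\|f\|=\sup_{x\in B_X}\|f(x)\|$) of bounded continuous functions $B_X\to Y$ that are analytic on the interior of $B_X$; $A_u(B_X,Y)$ is its subspace of functions uniformly continuous on $B_X$. A nonzero $f\in A(B_X,Y)$ is a strong peak function if there is exactly one $x\in B_X$ with $\|f(x)\|=\|f\|$ and for every neighborhood $V$ of $x$ there is $\delta>0$ with $\|f(y)\|\le\|f\|-\delta$ for all $y\in B_X\setminus V$; then $x$ is a strong peak point. $\rho A(B_X)$ is the set of strong peak points for $A(B_X)$. $F\subset B_X$ is a norming subset for $A(B_X,Y)$ if $\|f\|=\sup_{x\in F}\|f(x)\|$ for all $f\in A(B_X,Y)$;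 $\partial A(B_X,Y)$ is the smallest closed norming subset, when it exists. $z\in S_Z$ is a smooth point of $B_Z$ if there is $z^*\in B_{Z^*}$ with $1=\operatorname{Re}z^*(z)>\operatorname{Re}w^*(z)$ for all $w^*\in B_{Z^*}\setminus\{z^*\}$; $Z$ is smooth if every point of $S_Z$ is a smooth point of $B_Z$. A point $x\in B_X$ is a complex extreme point of $B_X$ if for every $y\ne0$ in $X$ there is a complex $\alpha$ with $|\alpha|\le1$ and $x+\alpha y\notin B_X$; $\mathrm{ext}_{\mathbb C}(B_X)$ is the set of these. $X$ has the Radon-Nikodým property if for every probability space $(\Omega,\mathcal B,\mu)$ and every $X$-valued countably additive measure $\tau$ on $\mathcal B$ with $\tau(E)/\mu(E)\in B_X$ whenever $E\in\mathcal B$, $\mu(E)>0$, there is a Bochner measurable $h:\Omega\to X$ with $\tau(E)=\int_E h\,d\mu$ for all $E\in\mathcal B$. *)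

theory Defs
  imports "HOL-Probability.Probability"
begin

section \<open>Complex Banach spaces\<close>

class complex_normed_vector = real_normed_vector +
  fixes scaleC :: "complex \<Rightarrow> 'a \<Rightarrow> 'a"  (infixr "*\<^sub>C" 75)
  assumes scaleC_add_right: "c *\<^sub>C (x + y) = c *\<^sub>C x + c *\<^sub>C y"
    and scaleC_add_left: "(c + d) *\<^sub>C x = c *\<^sub>C x + d *\<^sub>C x"
    and scaleC_scaleC: "c *\<^sub>C (d *\<^sub>C x) = (c * d) *\<^sub>C x"
    and scaleC_of_real: "complex_of_real r *\<^sub>C x = r *\<^sub>R x"
    and norm_scaleC: "norm (c *\<^sub>C x) = cmod c * norm x"

class complex_banach = complex_normed_vector + banach

instantiation complex :: complex_banach
begin

definition scaleC_complex :: "complex \<Rightarrow> complex \<Rightarrow> complex" where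
  "scaleC_complex c x = c * x"

instance
  by standard
    (simp_all add: scaleC_complex_def algebra_simps norm_mult scaleR_conv_of_real)

end

section \<open>The Radon-Nikodym property\<close>

text \<open>
  The library's Bochner integral is restricted to second-countable codomains. The two definitions
  below are the usual ones, through simple functions, for an arbitrary Banach space.
\<close>

definition bochner_measurable :: "'w measure \<Rightarrow> ('w \<Rightarrow> 'a::real_normed_vector) \<Rightarrow> bool" where
  "bochner_measurable M h \<longleftrightarrow>
     (\<exists>s. (\<forall>n. simple_function M (s n)) \<and> (AE \<omega> in M. (\<lambda>n. s n \<omega>) \<longlonglongrightarrow> h \<omega>))"

definition bochner_integral_is ::
    "'w measure \<Rightarrow> ('w \<Rightarrow> 'a::real_normed_vector) \<Rightarrow> 'a \<Rightarrow> bool" where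
  "bochner_integral_is M h v \<longleftrightarrow> bochner_measurable M h \<and>
     (\<exists>s. (\<forall>n. Bochner_Integration.simple_bochner_integrable M (s n)) \<and>
          (\<lambda>n. \<integral>\<^sup>+\<omega>. ennreal (norm (h \<omega> - s n \<omega>)) \<partial>M) \<longlonglongrightarrow> 0 \<and>
          (\<lambda>n. Bochner_Integration.simple_bochner_integral M (s n)) \<longlonglongrightarrow> v)"

definition countably_additive_vector_measure ::
    "'w measure \<Rightarrow> ('w set \<Rightarrow> 'a::real_normed_vector) \<Rightarrow> bool" where
  "countably_additive_vector_measure M \<tau> \<longleftrightarrow>
     (\<forall>E :: nat \<Rightarrow> 'w set. range E \<subseteq> sets M \<longrightarrow> disjoint_family E \<longrightarrow>
        (\<lambda>n. \<tau> (E n)) sums \<tau> (\<Union>n. E n))"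

text \<open>
  The type \<open>'w\<close> is the universe from which the probability spaces are drawn: any subset of it, with
  any sigma-algebra and any probability measure. Absolute continuity of \<open>\<tau>\<close> with respect to \<open>M\<close> is
  part of the notion (without it no nonzero space would have the property, as a two-point space
  with a null atom shows).
\<close>

definition radon_nikodym_property :: "'w itself \<Rightarrow> 'a::banach itself \<Rightarrow> bool" where
  "radon_nikodym_property _ _ \<longleftrightarrow>
     (\<forall>(M :: 'w measure) (\<tau> :: 'w set \<Rightarrow> 'a).
        prob_space M \<longrightarrow>
        countably_additive_vector_measure M \<tau> \<longrightarrow>
        (\<forall>E\<in>sets M. measure M E = 0 \<longrightarrow> \<tau> E = 0) \<longrightarrow>
        (\<forall>E\<in>sets M. measure M E > 0 \<longrightarrow> \<tau> E /\<^sub>R measure M E \<in> cball 0 1) \<longrightarrow>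
        (\<exists>h. bochner_measurable M h \<and>
             (\<forall>E\<in>sets M. bochner_integral_is M (\<lambda>\<omega>. indicat_real E \<omega> *\<^sub>R h \<omega>) (\<tau> E))))"

section \<open>The function spaces\<close>

text \<open>Analytic means complex Frechet differentiable at every point.\<close>

definition complex_differentiable_at ::
    "('x::complex_normed_vector \<Rightarrow> 'y::complex_normed_vector) \<Rightarrow> 'x \<Rightarrow> bool" where
  "complex_differentiable_at f x \<longleftrightarrow>
     (\<exists>D. (f has_derivative D) (at x) \<and> (\<forall>c v. D (c *\<^sub>C v) = c *\<^sub>C D v))"

text \<open>
  A function on the closed unit ball is represented by its extension by zero to the whole space,
  so that equality and the pointwise operations are those of functions on the ball.
\<close>

definition A_b :: "('x::complex_normed_vector \<Rightarrow> 'y::complex_normed_vector) set" where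
  "A_b = {f. (\<forall>x. x \<notin> cball 0 1 \<longrightarrow> f x = 0) \<and>
             continuous_on (cball 0 1) f \<and>
             bounded (f ` cball 0 1) \<and>
             (\<forall>x\<in>interior (cball 0 1). complex_differentiable_at f x)}"

definition A_u :: "('x::complex_normed_vector \<Rightarrow> 'y::complex_normed_vector) set" where
  "A_u = {f\<in>A_b. uniformly_continuous_on (cball 0 1) f}"

datatype algebra_kind = Bounded | Uniform

fun A_space :: "algebra_kind \<Rightarrow> ('x::complex_normed_vector \<Rightarrow> 'y::complex_normed_vector) set" where
  "A_space Bounded = A_b"
| "A_space Uniform = A_u"

definition sup_norm :: "('x::real_normed_vector \<Rightarrow> 'y::real_normed_vector) \<Rightarrow> real" where
  "sup_norm f = (SUP x\<in>cball 0 1. norm (f x))"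

definition dense_in ::
    "('x::real_normed_vector \<Rightarrow> 'y::real_normed_vector) set \<Rightarrow> ('x \<Rightarrow> 'y) set \<Rightarrow> bool" where
  "dense_in D S \<longleftrightarrow> D \<subseteq> S \<and> (\<forall>f\<in>S. \<forall>\<epsilon>>0. \<exists>g\<in>D. sup_norm (\<lambda>x. f x - g x) < \<epsilon>)"

section \<open>Peak functions and norming sets\<close>

definition peaks_strongly_at ::
    "('x::real_normed_vector \<Rightarrow> 'y::real_normed_vector) \<Rightarrow> 'x \<Rightarrow> bool" where
  "peaks_strongly_at f x \<longleftrightarrow>
     x \<in> cball 0 1 \<and> norm (f x) = sup_norm f \<and>
     (\<forall>y\<in>cball 0 1. norm (f y) = sup_norm f \<longrightarrow> y = x) \<and>
     (\<forall>V. x \<in> interior V \<longrightarrow>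
        (\<exists>\<delta>>0. \<forall>y\<in>cball 0 1 - V. norm (f y) \<le> sup_norm f - \<delta>))"

definition strong_peak_functions ::
    "algebra_kind \<Rightarrow> ('x::complex_normed_vector \<Rightarrow> 'y::complex_normed_vector) set" where
  "strong_peak_functions k = {f\<in>A_space k. f \<noteq> (\<lambda>_. 0) \<and> (\<exists>x. peaks_strongly_at f x)}"

definition strong_peak_points :: "algebra_kind \<Rightarrow> 'x::complex_normed_vector set" where
  "strong_peak_points k =
     {x. \<exists>f :: 'x \<Rightarrow> complex. f \<in> A_space k \<and> f \<noteq> (\<lambda>_. 0) \<and> peaks_strongly_at f x}"

text \<open>The supremum over the empty set is an unspecified real. If the codomain is nontrivial, the
  empty set is still not norming, because there are constants of different norms.\<close>

definition norming ::
    "('x::real_normed_vector \<Rightarrow> 'y::real_normed_vector) set \<Rightarrow> 'x set \<Rightarrow> bool" where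
  "norming S F \<longleftrightarrow> F \<subseteq> cball 0 1 \<and> (\<forall>f\<in>S. sup_norm f = (SUP x\<in>F. norm (f x)))"

definition smallest_closed_norming ::
    "('x::real_normed_vector \<Rightarrow> 'y::real_normed_vector) set \<Rightarrow> 'x set \<Rightarrow> bool" where
  "smallest_closed_norming S F \<longleftrightarrow>
     closed F \<and> norming S F \<and> (\<forall>G. closed G \<longrightarrow> norming S G \<longrightarrow> F \<subseteq> G)"

section \<open>Smooth points and complex extreme points\<close>

text \<open>
  A complex normed space is given here by its carrier \<open>Z\<close>, addition, scalar multiplication and
  norm \<open>N\<close>, so that the notion applies both to \<open>Y\<close> and to the function space over it. Functionals
  are made extensional, so that distinct elements of the dual ball differ on \<open>Z\<close>.
\<close>

definition dual_ball ::
    "'v set \<Rightarrow> ('v \<Rightarrow> 'v \<Rightarrow> 'v) \<Rightarrow> (complex \<Rightarrow> 'v \<Rightarrow> 'v) \<Rightarrow> ('v \<Rightarrow> real) \<Rightarrow> ('v \<Rightarrow> complex) set" where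
  "dual_ball Z add scl N =
     {\<phi> \<in> extensional Z.
        (\<forall>u\<in>Z. \<forall>v\<in>Z. \<phi> (add u v) = \<phi> u + \<phi> v) \<and>
        (\<forall>c. \<forall>u\<in>Z. \<phi> (scl c u) = c * \<phi> u) \<and>
        (\<forall>u\<in>Z. cmod (\<phi> u) \<le> N u)}"

definition smooth_points ::
    "'v set \<Rightarrow> ('v \<Rightarrow> 'v \<Rightarrow> 'v) \<Rightarrow> (complex \<Rightarrow> 'v \<Rightarrow> 'v) \<Rightarrow> ('v \<Rightarrow> real) \<Rightarrow> 'v set" where
  "smooth_points Z add scl N =
     {z\<in>Z. N z = 1 \<and>
        (\<exists>\<phi>\<in>dual_ball Z add scl N. 1 = Re (\<phi> z) \<and>
           (\<forall>\<psi>\<in>dual_ball Z add scl N - {\<phi>}. Re (\<phi> z) > Re (\<psi> z)))}"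

definition smooth_space :: "'y::complex_normed_vector itself \<Rightarrow> bool" where
  "smooth_space _ \<longleftrightarrow> sphere 0 1 \<subseteq> smooth_points (UNIV :: 'y set) (+) (*\<^sub>C) norm"

definition A_smooth_points ::
    "algebra_kind \<Rightarrow> ('x::complex_normed_vector \<Rightarrow> 'y::complex_normed_vector) set" where
  "A_smooth_points k =
     smooth_points (A_space k) (\<lambda>f g x. f x + g x) (\<lambda>c f x. c *\<^sub>C f x) sup_norm"

definition complex_extreme_points :: "'x::complex_normed_vector set" where
  "complex_extreme_points =
     {x\<in>cball 0 1. \<forall>y. y \<noteq> 0 \<longrightarrow> (\<exists>\<alpha>. cmod \<alpha> \<le> 1 \<and> x + \<alpha> *\<^sub>C y \<notin> cball 0 1)}"

end

theory Submission
  imports Defs "HOL-Complex_Analysis.Conformal_Mappings"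
begin

text \<open>
  Let \<open>f\<close> be a nonzero function of the algebra. For a real functional \<open>L\<close> with complexification \<open>x*\<close>,
  the function \<open>h = exp(x*) f\<close> is again in the algebra and satisfies \<open>ln |h| = ln |f| + L\<close>. Hence \<open>h\<close>
  peaks strongly as soon as \<open>ln |f| + L\<close> has arbitrarily small slices on the set where \<open>f\<close> does not
  vanish, and \<open>h\<close> is close to \<open>f\<close> if \<open>L\<close> is small. Such functionals exist by Stegall's variational
  principle: by Baire's theorem it suffices to make one slice small, and if all slices of \<open>\<psi> + L\<close>
  with \<open>|L| \<le> \<eta>\<close> were large, then by the Hahn-Banach theorem every point \<open>x\<close> would be nearly a
  mean of points far from \<open>x\<close> without loss in the concave \<open>\<eta>\<close>-Lipschitz envelope of \<open>\<psi>\<close>. Iterating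
  this gives a bounded quasi-martingale with separated increments, which the Radon-Nikodym property
  excludes.

  The remaining claims follow from the density of strong peak functions. Composition with a norming
  functional turns a vector-valued strong peak function into a scalar one. If \<open>g\<close> of norm one peaks
  strongly at \<open>x\<close>, then a norm-one functional attaining its norm at \<open>g\<close> kills every function that
  vanishes at \<open>x\<close>, so it factors through the evaluation at \<open>x\<close>. Strong peak points are complex
  extreme by the maximum principle.
\<close>

section \<open>Linear functionals below sublinear ones\<close>

text \<open>Functionals of norm at most \<eta> detect no more of \<psi> than its concave
  \<eta>-Lipschitz envelope \<Phi>, which charges \<open>\<eta> * norm (v - x)\<close> for a mean
  \<open>v\<close> that misses \<open>x\<close>. The means in the iteration are therefore not
  exactly \<open>x\<close>, and the tree of points is only a quasi-martingale; but every miss is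
  paid for by growth of the mean of the bounded function \<Phi>, so the misses are summable. Convex
  combinations are replaced by averages with equal weights, so that the tree lives on partitions of
  [0,1) into intervals of equal length, and probability spaces of reals are enough for the
  Radon-Nikodym property. No vector-valued martingale convergence theorem enters: the density of the
  limit measure is approximated in L1 by one simple function, and the averages of a simple function
  over the cells hardly change from one generation to the next once the generation is late, whereas
  the values of the quasi-martingale move by at least \<delta> on every cell in every
  generation.\<close>

definition sublinear :: "('a::real_vector \<Rightarrow> real) \<Rightarrow> bool" where
  "sublinear p \<longleftrightarrow> (\<forall>x y. p (x + y) \<le> p x + p y) \<and> (\<forall>t x. 0 \<le> t \<longrightarrow> p (t *\<^sub>R x) = t * p x)"

lemma sublinear_zero: "sublinear p \<Longrightarrow> p 0 = 0"
  unfolding sublinear_def by (metis mult_zero_left order_refl scaleR_zero_left)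

lemma sublinear_neg: "sublinear p \<Longrightarrow> - p (- x) \<le> p x"
  using sublinear_zero[of p] unfolding sublinear_def by (metis add.commute add.right_inverse minus_le_iff add_le_cancel_left diff_0 le_diff_eq)

text \<open>The reverse inequality of homogeneity comes from applying the given one to
  \<open>inverse t\<close>.\<close>

lemma sublinearI:
  assumes "\<And>x y. p (x + y) \<le> p x + p y" "\<And>t x. 0 < t \<Longrightarrow> p (t *\<^sub>R x) \<le> t * p x" "p 0 = 0"
  shows "sublinear p"
proof -
  have "p (t *\<^sub>R x) = t * p x" if "0 \<le> t" for t x
  proof (cases "t = 0")
    case False
    then have t: "t > 0" using that by simp
    have "p (inverse t *\<^sub>R (t *\<^sub>R x)) \<le> inverse t * p (t *\<^sub>R x)"
      using t by (intro assms(2)) simp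
    then have "t * p x \<le> p (t *\<^sub>R x)"
      using t by (simp add: field_simps)
    then show ?thesis using assms(2)[OF t, of x] by simp
  qed (use assms in simp)
  then show ?thesis using assms(1) by (simp add: sublinear_def)
qed

text \<open>A pointwise minimal sublinear functional \<open>p\<close> is linear: minimality applied to
  \<open>x \<mapsto> INF t\<ge>0. p (x + t a) - t p(a)\<close> gives \<open>p x + p a \<le> p (x + a)\<close>.\<close>

lemma minimal_sublinear_linear:
  assumes p: "sublinear p" and min: "\<And>q. sublinear q \<Longrightarrow> (\<And>x. q x \<le> p x) \<Longrightarrow> q = p"
  shows "linear p"
proof -
  have sub: "p (x + y) \<le> p x + p y" and hom: "0 \<le> t \<Longrightarrow> p (t *\<^sub>R x) = t * p x" for x y t
    using p by (auto simp: sublinear_def)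
  have super: "p x + p a \<le> p (x + a)" for x a
  proof -
    define F where "F x t = p (x + t *\<^sub>R a) - t * p a" for x t
    define q where "q x = (INF t\<in>{0..}. F x t)" for x
    \<comment> \<open>A bound independent of \<open>t\<close>; it keeps the infimum finite.\<close>
    have lb: "- p (- x) \<le> F x t" if "t \<ge> 0" for x t
      using sub[of "x + t *\<^sub>R a" "- x"] hom[OF that, of a] by (simp add: F_def)
    have bdd: "bdd_below (F x ` {0..})" for x
      using lb by (intro bdd_belowI[of _ "- p (- x)"]) auto
    have le: "q x \<le> F x t" if "t \<ge> 0" for x t
      unfolding q_def using that bdd by (intro cINF_lower) auto
    have ge: "c \<le> q x" if "\<And>t. t \<ge> 0 \<Longrightarrow> c \<le> F x t" for c x
      unfolding q_def using that by (intro cINF_greatest) auto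
    have "sublinear q"
    proof (rule sublinearI)
      fix x y
      have "q (x + y) - F y t \<le> F x s" if "s \<ge> 0" "t \<ge> 0" for s t
      proof -
        have "q (x + y) \<le> F (x + y) (s + t)" using that by (intro le) simp
        also have "\<dots> \<le> F x s + F y t"
          using sub[of "x + s *\<^sub>R a" "y + t *\<^sub>R a"] by (simp add: F_def algebra_simps)
        finally show ?thesis by simp
      qed
      then have "q (x + y) - F y t \<le> q x" if "t \<ge> 0" for t
        using that by (intro ge) auto
      then have "q (x + y) - q x \<le> q y"
        by (intro ge) (simp add: algebra_simps)
      then show "q (x + y) \<le> q x + q y" by simp
    next
      fix t :: real and x assume t: "0 < t"
      have "q (t *\<^sub>R x) / t \<le> F x s" if "s \<ge> 0" for s
      proof -
        have "q (t *\<^sub>R x) \<le> F (t *\<^sub>R x) (t * s)" using t that by (intro le) simp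
        also have "\<dots> = t * F x s"
          using hom[of t "x + s *\<^sub>R a"] t by (simp add: F_def algebra_simps)
        finally show ?thesis using t by (simp add: field_simps)
      qed
      then have "q (t *\<^sub>R x) / t \<le> q x" by (intro ge) auto
      then show "q (t *\<^sub>R x) \<le> t * q x" using t by (simp add: field_simps)
    next
      have "q 0 \<le> 0" using le[of 0 0] sublinear_zero[OF p] by (simp add: F_def)
      moreover have "0 \<le> q 0" by (rule ge) (simp add: F_def hom)
      ultimately show "q 0 = 0" by simp
    qed
    moreover have "q x \<le> p x" for x using le[of 0 x] by (simp add: F_def)
    ultimately have "q = p" by (rule min)
    then show ?thesis using le[of 1 x] by (simp add: F_def)
  qed
  have add: "p (x + y) = p x + p y" for x y
    using sub super by (simp add: order_antisym)
  have "p (- x) = - p x" for x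
    using add[of x "- x"] sublinear_zero[OF p] by simp
  then have "p (t *\<^sub>R x) = t * p x" for t x
    using hom[of t x] hom[of "- t" "- x"] by (cases "t \<ge> 0") auto
  with add show ?thesis by (intro linearI) auto
qed

text \<open>Zorn's lemma for the reversed pointwise order on the sublinear functionals below
  \<open>p\<close>: a maximal element is a minimal functional, and those are linear. No functional
  has to be extended from a subspace.\<close>

theorem hahn_banach_sublinear:
  fixes p :: "'a::real_vector \<Rightarrow> real"
  assumes p: "sublinear p"
  shows "\<exists>L. linear L \<and> (\<forall>x. L x \<le> p x)"
proof -
  define A where "A = {q. sublinear q \<and> (\<forall>x. q x \<le> p x)}"
  define P where "P q r \<longleftrightarrow> (\<forall>x. r x \<le> q x)" for q r :: "'a \<Rightarrow> real"
  have "\<exists>m\<in>A. \<forall>a\<in>A. P m a \<longrightarrow> a = m"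
  proof (rule predicate_Zorn)
    show "partial_order_on A (relation_of P A)"
      by (rule partial_order_on_relation_ofI) (auto simp: P_def fun_eq_iff intro: order_trans order_antisym)
  next
    fix C assume C: "C \<in> Chains (relation_of P A)"
    then have CA: "C \<subseteq> A" and tot: "\<And>q r. q \<in> C \<Longrightarrow> r \<in> C \<Longrightarrow> P q r \<or> P r q"
      by (auto simp: Chains_def relation_of_def)
    show "\<exists>u\<in>A. \<forall>a\<in>C. P a u"
    proof (cases "C = {}")
      case True
      then show ?thesis using p by (auto simp: A_def)
    next
      case False
      define u where "u x = (INF q\<in>C. q x)" for x
      have sl: "sublinear q" and qp: "q x \<le> p x" if "q \<in> C" for q x
        using that CA by (auto simp: A_def)
      have "- p (- x) \<le> q x" if "q \<in> C" for q x
        using sublinear_neg[OF sl[OF that], of x] qp[OF that, of "- x"] by simp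
      then have bdd: "bdd_below ((\<lambda>q. q x) ` C)" for x
        by (intro bdd_belowI[of _ "- p (- x)"]) auto
      have le: "u x \<le> q x" if "q \<in> C" for q x
        unfolding u_def using that bdd by (intro cINF_lower) auto
      have ge: "c \<le> u x" if "\<And>q. q \<in> C \<Longrightarrow> c \<le> q x" for c x
        unfolding u_def using that False by (intro cINF_greatest) auto
      have "sublinear u"
      proof (rule sublinearI)
        fix x y
        have "u (x + y) \<le> q x + r y" if qr: "q \<in> C" "r \<in> C" for q r
        proof -
          \<comment> \<open>The infima at \<open>x\<close> and \<open>y\<close> are approached by
            different members of the chain; the smaller of the two serves both points.\<close>
          obtain s where s: "s \<in> C" "s x \<le> q x" "s y \<le> r y"
            using tot[OF qr] qr unfolding P_def by auto
          have "u (x + y) \<le> s (x + y)" using s by (intro le)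
          also have "\<dots> \<le> s x + s y" using sl[OF s(1)] by (simp add: sublinear_def)
          finally show ?thesis using s by simp
        qed
        then have "u (x + y) - r y \<le> u x" if "r \<in> C" for r
          using that by (intro ge) (auto simp: algebra_simps)
        then have "u (x + y) - u x \<le> u y"
          by (intro ge) (auto simp: algebra_simps)
        then show "u (x + y) \<le> u x + u y" by simp
      next
        fix t :: real and x assume t: "0 < t"
        have "u (t *\<^sub>R x) / t \<le> q x" if "q \<in> C" for q
          using le[OF that, of "t *\<^sub>R x"] sl[OF that] t by (simp add: sublinear_def field_simps)
        then have "u (t *\<^sub>R x) / t \<le> u x" by (intro ge) auto
        then show "u (t *\<^sub>R x) \<le> t * u x" using t by (simp add: field_simps)
      next
        have q0: "q 0 = 0" if "q \<in> C" for q by (rule sublinear_zero[OF sl[OF that]])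
        obtain q where "q \<in> C" using False by auto
        then have "u 0 \<le> 0" using le[of q 0] q0[of q] by simp
        moreover have "0 \<le> u 0" by (intro ge) (simp add: q0)
        ultimately show "u 0 = 0" by simp
      qed
      moreover have "u x \<le> p x" for x
        using False le qp by (metis ex_in_conv order_trans)
      ultimately have "u \<in> A" by (simp add: A_def)
      then show ?thesis using le by (auto simp: P_def)
    qed
  qed
  then obtain m where m: "m \<in> A" "\<And>q. q \<in> A \<Longrightarrow> (\<And>x. q x \<le> m x) \<Longrightarrow> q = m"
    by (auto simp: P_def)
  have "linear m"
  proof (rule minimal_sublinear_linear)
    show "sublinear m" using m by (simp add: A_def)
    show "q = m" if "sublinear q" "\<And>x. q x \<le> m x" for q
      using that m(1) by (intro m(2)) (auto simp: A_def intro: order_trans)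
  qed
  then show ?thesis using m(1) by (auto simp: A_def)
qed

text \<open>The Mazur--Orlicz argument: the functional is dominated by
  \<open>w \<mapsto> INF t (v, s). \<eta> |w - t (v - x0)| - t (s - a)\<close>.\<close>

lemma support_functional:
  fixes C :: "('a::real_normed_vector \<times> real) set"
  assumes C: "convex C" "C \<noteq> {}" and \<eta>: "0 \<le> \<eta>"
    and bound: "\<And>v s. (v, s) \<in> C \<Longrightarrow> s - \<eta> * norm (v - x0) \<le> a"
  shows "\<exists>L :: 'a \<Rightarrow>\<^sub>L real. norm L \<le> \<eta> \<and> (\<forall>(v, s)\<in>C. s + blinfun_apply L (v - x0) \<le> a)"
proof -
  define F where "F w = (\<lambda>(t, v, s). \<eta> * norm (w - t *\<^sub>R (v - x0)) - t * (s - a))" for w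
  define I where "I = {0::real..} \<times> C"
  define p where "p w = (INF i\<in>I. F w i)" for w
  have I: "I \<noteq> {}" using C by (auto simp: I_def)
  have lb: "- \<eta> * norm w \<le> F w i" if "i \<in> I" for w i
  proof -
    obtain t v s where i: "i = (t, v, s)" "t \<ge> 0" "(v, s) \<in> C"
      using \<open>i \<in> I\<close> by (auto simp: I_def)
    have "t * (s - a) \<le> t * (\<eta> * norm (v - x0))"
      using bound[OF i(3)] i(2) by (intro mult_left_mono) auto
    also have "\<dots> = \<eta> * norm (t *\<^sub>R (v - x0))" using i(2) by simp
    also have "\<dots> \<le> \<eta> * (norm (w - t *\<^sub>R (v - x0)) + norm w)"
      using \<eta> norm_triangle_ineq3[of w "w - t *\<^sub>R (v - x0)"] norm_triangle_ineq4[of w "w - t *\<^sub>R (v - x0)"]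
      by (intro mult_left_mono) auto
    finally show ?thesis by (simp add: F_def i algebra_simps)
  qed
  have bdd: "bdd_below (F w ` I)" for w
    using lb by (intro bdd_belowI[of _ "- \<eta> * norm w"]) auto
  have le: "p w \<le> F w i" if "i \<in> I" for w i
    unfolding p_def using that bdd by (intro cINF_lower) auto
  have ge: "c \<le> p w" if "\<And>i. i \<in> I \<Longrightarrow> c \<le> F w i" for c w
    unfolding p_def using that I by (intro cINF_greatest) auto
  have "sublinear p"
  proof (rule sublinearI)
    fix x y
    have "p (x + y) \<le> F x i + F y j" if "i \<in> I" "j \<in> I" for i j
    proof -
      obtain t v s where i: "i = (t, v, s)" "t \<ge> 0" "(v, s) \<in> C"
        using \<open>i \<in> I\<close> by (auto simp: I_def)
      obtain t' v' s' where j: "j = (t', v', s')" "t' \<ge> 0" "(v', s') \<in> C"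
        using \<open>j \<in> I\<close> by (auto simp: I_def)
      \<comment> \<open>The mean of \<open>(v, s)\<close> and \<open>(v', s')\<close> with weights
        proportional to \<open>t\<close> and \<open>t'\<close>; if both are zero, any point of
        \<open>C\<close> will do.\<close>
      obtain v'' s'' where C'': "(v'', s'') \<in> C"
        and v'': "(t + t') *\<^sub>R v'' = t *\<^sub>R v + t' *\<^sub>R v'"
        and s'': "(t + t') * s'' = t * s + t' * s'"
      proof (cases "t + t' = 0")
        case True
        then have "t = 0" "t' = 0" using i j by auto
        then show ?thesis using i that[of v s] by auto
      next
        case False
        then have pos: "t + t' > 0" using i j by linarith
        have "(t / (t + t')) *\<^sub>R (v, s) + (t' / (t + t')) *\<^sub>R (v', s') \<in> C"
          using i j pos by (intro convexD[OF C(1)]) (auto simp: add_divide_distrib[symmetric])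
        also have "(t / (t + t')) *\<^sub>R (v, s) + (t' / (t + t')) *\<^sub>R (v', s')
            = ((1 / (t + t')) *\<^sub>R (t *\<^sub>R v + t' *\<^sub>R v'), (t * s + t' * s') / (t + t'))"
          by (simp add: scaleR_add_right add_divide_distrib)
        finally show ?thesis using pos that by simp
      qed
      have "p (x + y) \<le> F (x + y) (t + t', v'', s'')"
        using C'' i j by (intro le) (auto simp: I_def)
      also have "\<dots> = \<eta> * norm ((x - t *\<^sub>R (v - x0)) + (y - t' *\<^sub>R (v' - x0)))
          - t * (s - a) - t' * (s' - a)"
      proof -
        have e1: "x + y - (t + t') *\<^sub>R (v'' - x0) = (x - t *\<^sub>R (v - x0)) + (y - t' *\<^sub>R (v' - x0))"
          using v'' by (simp add: algebra_simps)
        have e2: "(t + t') * (s'' - a) = t * (s - a) + t' * (s' - a)"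
          using s'' by (simp add: algebra_simps)
        show ?thesis by (simp only: F_def prod.case e1 e2)
      qed
      also have "\<dots> \<le> F x i + F y j"
        using mult_left_mono[OF norm_triangle_ineq[of "x - t *\<^sub>R (v - x0)" "y - t' *\<^sub>R (v' - x0)"] \<eta>]
        by (simp add: F_def i j distrib_left)
      finally show ?thesis .
    qed
    then have "p (x + y) - F y j \<le> p x" if "j \<in> I" for j
      using that by (intro ge) (auto simp: algebra_simps)
    then have "p (x + y) - p x \<le> p y"
      by (intro ge) (auto simp: algebra_simps)
    then show "p (x + y) \<le> p x + p y" by simp
  next
    fix t :: real and x assume t: "0 < t"
    have "p (t *\<^sub>R x) / t \<le> F x i" if "i \<in> I" for i
    proof -
      obtain r v s where i: "i = (r, v, s)" "r \<ge> 0" "(v, s) \<in> C"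
        using \<open>i \<in> I\<close> by (auto simp: I_def)
      have "p (t *\<^sub>R x) \<le> F (t *\<^sub>R x) (t * r, v, s)" using t i by (intro le) (auto simp: I_def)
      also have "\<dots> = \<eta> * norm (t *\<^sub>R (x - r *\<^sub>R (v - x0))) - t * (r * (s - a))"
        by (simp add: F_def algebra_simps)
      also have "\<dots> = t * F x i"
        by (simp only: F_def i prod.case norm_scaleR) (use t in \<open>simp add: algebra_simps\<close>)
      finally show ?thesis using t by (simp add: field_simps)
    qed
    then have "p (t *\<^sub>R x) / t \<le> p x" by (intro ge) auto
    then show "p (t *\<^sub>R x) \<le> t * p x" using t by (simp add: field_simps)
  next
    obtain v s where "(v, s) \<in> C" using C by auto
    then have "p 0 \<le> F 0 (0, v, s)" by (intro le) (auto simp: I_def)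
    moreover have "0 \<le> p 0" using lb[of _ 0] by (intro ge) simp
    ultimately show "p 0 = 0" by (simp add: F_def)
  qed
  then obtain L where L: "linear L" "\<And>x. L x \<le> p x"
    using hahn_banach_sublinear by blast
  \<comment> \<open>The parameter \<open>t = 0\<close> in the infimum yields the norm bound, and
    \<open>t = 1\<close> below yields the inequality on \<open>C\<close>.\<close>
  have norm_le: "L x \<le> \<eta> * norm x" for x
  proof -
    obtain v s where "(v, s) \<in> C" using C by auto
    then have "p x \<le> F x (0, v, s)" by (intro le) (auto simp: I_def)
    then show ?thesis using L(2)[of x] by (simp add: F_def)
  qed
  have abs_le: "norm (L x) \<le> norm x * \<eta>" for x
    using norm_le[of x] norm_le[of "- x"] linear_neg[OF L(1), of x] by (simp add: abs_le_iff mult.commute)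
  have bl: "bounded_linear L"
    using L(1) abs_le by (intro bounded_linear.intro) (auto simp: bounded_linear_axioms_def)
  have "norm (Blinfun L) \<le> \<eta>"
    using abs_le \<eta> by (intro norm_blinfun_bound) (auto simp: bounded_linear_Blinfun_apply[OF bl] mult.commute)
  moreover have "s + blinfun_apply (Blinfun L) (v - x0) \<le> a" if "(v, s) \<in> C" for v s
  proof -
    have "p (v - x0) \<le> F (v - x0) (1, v, s)" using that by (intro le) (auto simp: I_def)
    then show ?thesis
      using L(2)[of "v - x0"] by (simp add: F_def bounded_linear_Blinfun_apply[OF bl])
  qed
  ultimately show ?thesis by blast
qed

section \<open>Slices of functions on subsets of the ball\<close>

lemma tendsto_scaled_subsequence:
  fixes a :: "nat \<Rightarrow> 'a::real_normed_vector"
  assumes a: "a \<longlonglongrightarrow> x" and k: "(\<lambda>N. real (k N) / real N) \<longlonglongrightarrow> u"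
  shows "(\<lambda>N. (real (k N) / real N) *\<^sub>R a (k N)) \<longlonglongrightarrow> u *\<^sub>R x"
proof (cases "u = 0")
  \<comment> \<open>Here \<open>k N\<close> need not tend to infinity and \<open>a (k N)\<close>
    need not converge, so only the boundedness of \<open>a\<close> is used.\<close>
  case True
  obtain B where B: "\<And>n. norm (a n) \<le> B"
    using convergent_imp_Bseq[of a] a by (auto simp: convergent_def Bseq_def)
  have "(\<lambda>N. (real (k N) / real N) *\<^sub>R a (k N)) \<longlonglongrightarrow> 0"
  proof (rule Lim_null_comparison)
    show "\<forall>\<^sub>F N in sequentially. norm ((real (k N) / real N) *\<^sub>R a (k N)) \<le> real (k N) / real N * B"
      using B by (intro always_eventually) (auto intro!: divide_right_mono mult_left_mono)
    show "(\<lambda>N. real (k N) / real N * B) \<longlonglongrightarrow> 0"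
      using tendsto_mult_right[OF k, of B] True by simp
  qed
  then show ?thesis using True by simp
next
  case False
  have "u \<ge> 0" by (rule LIMSEQ_le_const[OF k]) auto
  then have "filterlim (\<lambda>N. real (k N) / real N * real N) at_top sequentially"
    using False by (intro filterlim_tendsto_pos_mult_at_top[OF k]) (auto simp: filterlim_real_sequentially)
  moreover have "\<forall>\<^sub>F N in sequentially. real (k N) / real N * real N = real (k N)"
    using eventually_gt_at_top[of 0] by eventually_elim auto
  ultimately have "filterlim (\<lambda>N. real (k N)) at_top sequentially"
    by (simp cong: filterlim_cong)
  then have "filterlim k at_top sequentially"
    by (simp add: filterlim_sequentially_iff_filterlim_real)
  then show ?thesis
    using filterlim_compose[OF a] by (intro tendsto_scaleR k) auto
qed

lemma sum_lessThan_split: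
  fixes f g :: "nat \<Rightarrow> 'a::comm_monoid_add"
  assumes "k \<le> N"
  shows "(\<Sum>j<N. if j < k then f j else g (j - k)) = (\<Sum>j<k. f j) + (\<Sum>j<N - k. g j)"
proof -
  have "(\<Sum>j<k + m. if j < k then f j else g (j - k)) = (\<Sum>j<k. f j) + (\<Sum>j<m. g j)" for m
    by (induction m) (auto simp: add.assoc)
  from this[of "N - k"] show ?thesis using assms by simp
qed

text \<open>The set of limits of such averages is convex: to approximate a combination with weights
  \<open>u\<close> and \<open>v\<close>, about \<open>u * N\<close> of the \<open>N\<close> points
  are taken from the averages for \<open>x\<close> and the others from those for \<open>y\<close>.
  The points are given for every \<open>N\<close>, not for some \<open>N\<close>, because later one
  \<open>N\<close> has to serve all nodes of a generation at once.\<close>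

lemma convex_hull_equal_weights:
  fixes G :: "'a::real_normed_vector set"
  assumes "p \<in> convex hull G"
  shows "\<exists>Y. (\<forall>N j. Y N j \<in> G) \<and> (\<lambda>N. (1 / real N) *\<^sub>R (\<Sum>j<N. Y N j)) \<longlonglongrightarrow> p"
proof -
  define A where "A = {p. \<exists>Y. (\<forall>N j. Y N j \<in> G) \<and> (\<lambda>N. (1 / real N) *\<^sub>R (\<Sum>j<N. Y N j)) \<longlonglongrightarrow> p}"
  have "G \<subseteq> A"
  proof
    fix p assume p: "p \<in> G"
    have "(\<lambda>N. (1 / real N) *\<^sub>R (\<Sum>j<N. p)) \<longlonglongrightarrow> p"
    proof (rule tendsto_eventually)
      show "\<forall>\<^sub>F N in sequentially. (1 / real N) *\<^sub>R (\<Sum>j<N. p) = p"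
        using eventually_gt_at_top[of 0] by eventually_elim (auto simp: sum_constant_scaleR)
    qed
    then show "p \<in> A" unfolding A_def using p by (intro CollectI exI[of _ "\<lambda>_ _. p"]) auto
  qed
  moreover have "convex A"
  proof (rule convexI)
    fix x y and u v :: real
    assume "x \<in> A" "y \<in> A" and uv: "0 \<le> u" "0 \<le> v" "u + v = 1"
    then obtain X Y where X: "\<And>N j. X N j \<in> G" "(\<lambda>N. (1 / real N) *\<^sub>R (\<Sum>j<N. X N j)) \<longlonglongrightarrow> x"
      and Y: "\<And>N j. Y N j \<in> G" "(\<lambda>N. (1 / real N) *\<^sub>R (\<Sum>j<N. Y N j)) \<longlonglongrightarrow> y"
      unfolding A_def by blast
    define k where "k N = nat \<lfloor>u * real N\<rfloor>" for N
    have kle: "k N \<le> N" for N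
    proof -
      have "u * real N \<le> real N" using uv by (intro mult_left_le_one_le) auto
      then show ?thesis unfolding k_def by linarith
    qed
    have klim: "(\<lambda>N. real (k N) / real N) \<longlonglongrightarrow> u"
    proof (rule tendsto_sandwich)
      show "\<forall>\<^sub>F N in sequentially. u - 1 / real N \<le> real (k N) / real N"
        using eventually_gt_at_top[of 0]
      proof eventually_elim
        case (elim N)
        have "u * real N - 1 \<le> real (k N)" unfolding k_def by linarith
        then have "(u * real N - 1) / real N \<le> real (k N) / real N" by (rule divide_right_mono) simp
        then show ?case using elim by (simp add: diff_divide_distrib)
      qed
      show "\<forall>\<^sub>F N in sequentially. real (k N) / real N \<le> u"
        using eventually_gt_at_top[of 0]
      proof eventually_elim
        case (elim N)
        have "real (k N) \<le> u * real N" unfolding k_def using uv by simp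
        then show ?case using elim by (simp add: field_simps)
      qed
      show "(\<lambda>N. u - 1 / real N) \<longlonglongrightarrow> u"
        using tendsto_diff[OF tendsto_const[of u] lim_1_over_n] by simp
    qed auto
    have "v = 1 - u" using uv by simp
    then have "(\<lambda>N. 1 - real (k N) / real N) \<longlonglongrightarrow> v"
      using tendsto_diff[OF tendsto_const klim, of 1] by simp
    then have klim': "(\<lambda>N. real (N - k N) / real N) \<longlonglongrightarrow> v"
    proof (rule Lim_transform_eventually)
      show "\<forall>\<^sub>F N in sequentially. 1 - real (k N) / real N = real (N - k N) / real N"
        using eventually_gt_at_top[of 0] by eventually_elim (auto simp: of_nat_diff[OF kle] field_simps)
    qed
    define Z where "Z N j = (if j < k N then X (k N) j else Y (N - k N) (j - k N))" for N j
    have "(\<lambda>N. (real (k N) / real N) *\<^sub>R ((1 / real (k N)) *\<^sub>R (\<Sum>j<k N. X (k N) j))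
        + (real (N - k N) / real N) *\<^sub>R ((1 / real (N - k N)) *\<^sub>R (\<Sum>j<N - k N. Y (N - k N) j)))
        \<longlonglongrightarrow> u *\<^sub>R x + v *\<^sub>R y"
      by (intro tendsto_add tendsto_scaled_subsequence[where a="\<lambda>n. (1 / real n) *\<^sub>R (\<Sum>j<n. X n j)"]
          tendsto_scaled_subsequence[where a="\<lambda>n. (1 / real n) *\<^sub>R (\<Sum>j<n. Y n j)"] X Y klim klim')
    moreover have "(real (k N) / real N) *\<^sub>R ((1 / real (k N)) *\<^sub>R (\<Sum>j<k N. X (k N) j))
        + (real (N - k N) / real N) *\<^sub>R ((1 / real (N - k N)) *\<^sub>R (\<Sum>j<N - k N. Y (N - k N) j))
        = (1 / real N) *\<^sub>R (\<Sum>j<N. Z N j)" for N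
    proof -
      have *: "(real m / real N) *\<^sub>R ((1 / real m) *\<^sub>R (\<Sum>j<m. f j)) = (1 / real N) *\<^sub>R (\<Sum>j<m. f j)"
        for m and f :: "nat \<Rightarrow> 'a"
        by (cases "m = 0") auto
      show ?thesis unfolding * Z_def sum_lessThan_split[OF kle] scaleR_add_right ..
    qed
    ultimately have "(\<lambda>N. (1 / real N) *\<^sub>R (\<Sum>j<N. Z N j)) \<longlonglongrightarrow> u *\<^sub>R x + v *\<^sub>R y"
      by simp
    moreover have "\<forall>N j. Z N j \<in> G" using X(1) Y(1) by (simp add: Z_def)
    ultimately show "u *\<^sub>R x + v *\<^sub>R y \<in> A" unfolding A_def by blast
  qed
  ultimately have "convex hull G \<subseteq> A" by (rule hull_minimal)
  with assms show ?thesis by (auto simp: A_def)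
qed

text \<open>\<open>\<Phi>\<close> is the smallest concave \<open>\<eta>\<close>-Lipschitz majorant of \<open>\<psi>\<close>.\<close>

lemma no_small_slice_spread:
  fixes \<psi> :: "'a::real_normed_vector \<Rightarrow> real"
  assumes D: "D \<noteq> {}" and K: "\<And>x. x \<in> D \<Longrightarrow> \<psi> x \<le> K" and \<eta>: "0 < \<eta>"
    and neg: "\<And>(L :: 'a \<Rightarrow>\<^sub>L real) c a. norm L \<le> \<eta> \<Longrightarrow> \<exists>x\<in>D. a < \<psi> x + blinfun_apply L x \<Longrightarrow>
      \<exists>x\<in>D. a < \<psi> x + blinfun_apply L x \<and> \<delta> \<le> dist c x"
  obtains \<Phi> :: "'a \<Rightarrow> real" where "\<And>x. \<Phi> x \<le> K"
    and "\<And>x \<epsilon>. 0 < \<epsilon> \<Longrightarrow> \<forall>\<^sub>F N in sequentially. \<exists>y. (\<forall>j. y j \<in> D \<and> \<delta> \<le> dist x (y j)) \<and>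
      \<Phi> x - \<epsilon> + \<eta> * norm ((1 / real N) *\<^sub>R (\<Sum>j<N. y j) - x) \<le> (1 / real N) * (\<Sum>j<N. \<Phi> (y j))"
proof -
  define C where "C E = convex hull ((\<lambda>x. (x, \<psi> x)) ` E)" for E
  define \<Phi> where "\<Phi> x = (SUP (v, s)\<in>C D. s - \<eta> * norm (v - x))" for x
  have halfspace: "s + blinfun_apply L v \<le> a"
    if "(v, s) \<in> C E" "\<And>y. y \<in> E \<Longrightarrow> \<psi> y + blinfun_apply L y \<le> a" for E v s a and L :: "'a \<Rightarrow>\<^sub>L real"
  proof -
    have "convex {p :: 'a \<times> real. snd p + blinfun_apply L (fst p) \<le> a}"
    proof (rule convexI)
      fix p q :: "'a \<times> real" and u v :: real
      assume p: "p \<in> {p. snd p + blinfun_apply L (fst p) \<le> a}" and q: "q \<in> {p. snd p + blinfun_apply L (fst p) \<le> a}"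
        and uv: "0 \<le> u" "0 \<le> v" "u + v = 1"
      have "u * (snd p + blinfun_apply L (fst p)) + v * (snd q + blinfun_apply L (fst q)) \<le> u * a + v * a"
        using p q uv by (intro add_mono mult_left_mono) auto
      also have "\<dots> = a" using uv by (metis distrib_right mult_1)
      finally show "u *\<^sub>R p + v *\<^sub>R q \<in> {p. snd p + blinfun_apply L (fst p) \<le> a}"
        by (simp add: blinfun.add_right blinfun.scaleR_right algebra_simps)
    qed
    then have "C E \<subseteq> {p. snd p + blinfun_apply L (fst p) \<le> a}"
      unfolding C_def using that(2) by (intro hull_minimal) auto
    then show ?thesis using that(1) by auto
  qed
  have CK: "s \<le> K" if "(v, s) \<in> C D" for v s
    using halfspace[OF that, of 0 K] K by simp
  have leK: "s - \<eta> * norm (v - x) \<le> K" if "(v, s) \<in> C D" for v s x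
    using CK[OF that] \<eta> by (smt (verit) mult_nonneg_nonneg norm_ge_zero)
  then have bdd: "bdd_above ((\<lambda>(v, s). s - \<eta> * norm (v - x)) ` C D)" for x
    by (intro bdd_aboveI[of _ K]) auto
  have "C D \<noteq> {}" using D by (simp add: C_def)
  then have \<Phi>_le: "\<Phi> x \<le> K" for x
    using leK unfolding \<Phi>_def by (intro cSUP_least) auto
  have \<psi>\<Phi>: "\<psi> y \<le> \<Phi> y" if "y \<in> D" for y
  proof -
    have "(y, \<psi> y) \<in> C D" unfolding C_def using that by (intro hull_inc) auto
    from cSUP_upper[OF this bdd[of y]] show ?thesis by (simp add: \<Phi>_def)
  qed
  \<comment> \<open>Otherwise a functional separates the hull of the far points from
    \<open>x\<close> with margin \<open>\<epsilon>\<close>; \<open>neg\<close> carries the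
    inequality from the far points to all of \<open>D\<close>, and hence
    \<open>\<Phi> x \<le> \<Phi> x - \<epsilon>\<close>.\<close>
  have spread: "\<exists>(v, s)\<in>C {y\<in>D. \<delta> \<le> dist x y}. \<Phi> x - \<epsilon> < s - \<eta> * norm (v - x)" if "0 < \<epsilon>" for x \<epsilon>
  proof (rule ccontr)
    assume "\<not> ?thesis"
    then have le: "\<And>v s. (v, s) \<in> C {y\<in>D. \<delta> \<le> dist x y} \<Longrightarrow> s - \<eta> * norm (v - x) \<le> \<Phi> x - \<epsilon>"
      by force
    obtain x0 where "x0 \<in> D" using D by auto
    then have "\<exists>y\<in>D. \<delta> \<le> dist x y"
      using neg[of 0 "\<psi> x0 - 1" x] \<eta> by force
    then have ne: "C {y\<in>D. \<delta> \<le> dist x y} \<noteq> {}" by (auto simp: C_def)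
    obtain L :: "'a \<Rightarrow>\<^sub>L real" where L: "norm L \<le> \<eta>"
      and Lle: "\<And>v s. (v, s) \<in> C {y\<in>D. \<delta> \<le> dist x y} \<Longrightarrow> s + blinfun_apply L (v - x) \<le> \<Phi> x - \<epsilon>"
      using support_functional[OF _ ne less_imp_le[OF \<eta>] le] unfolding C_def by (auto simp: convex_convex_hull)
    have far: "\<psi> y + blinfun_apply L y \<le> \<Phi> x - \<epsilon> + blinfun_apply L x" if "y \<in> D" "\<delta> \<le> dist x y" for y
    proof -
      have "(y, \<psi> y) \<in> C {y\<in>D. \<delta> \<le> dist x y}" unfolding C_def using that by (intro hull_inc) auto
      from Lle[OF this] show ?thesis by (simp add: blinfun.diff_right)
    qed
    have all: "\<psi> y + blinfun_apply L y \<le> \<Phi> x - \<epsilon> + blinfun_apply L x" if "y \<in> D" for y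
      using neg[OF L, of "\<Phi> x - \<epsilon> + blinfun_apply L x" x] far that by (meson leD le_less_linear)
    have "s - \<eta> * norm (v - x) \<le> \<Phi> x - \<epsilon>" if "(v, s) \<in> C D" for v s
    proof -
      have "s + blinfun_apply L v \<le> \<Phi> x - \<epsilon> + blinfun_apply L x" by (rule halfspace[OF that all])
      moreover have "\<bar>blinfun_apply L (v - x)\<bar> \<le> \<eta> * norm (v - x)"
        using norm_blinfun[of L "v - x"] mult_right_mono[OF L norm_ge_zero[of "v - x"]] by simp
      ultimately show ?thesis by (simp add: blinfun.diff_right abs_le_iff)
    qed
    then have "\<Phi> x \<le> \<Phi> x - \<epsilon>"
      using D unfolding \<Phi>_def C_def by (intro cSUP_least) auto
    with \<open>0 < \<epsilon>\<close> show False by simp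
  qed
  show ?thesis
  proof (rule that[of \<Phi>])
    show "\<Phi> x \<le> K" for x by (rule \<Phi>_le)
    fix x and \<epsilon> :: real assume "0 < \<epsilon>"
    from spread[OF this, of x] obtain v s where vs: "(v, s) \<in> C {y\<in>D. \<delta> \<le> dist x y}"
      and less: "\<Phi> x - \<epsilon> < s - \<eta> * norm (v - x)" by auto
    from convex_hull_equal_weights[OF vs[unfolded C_def]]
    obtain Y where Y: "\<And>N j. Y N j \<in> (\<lambda>x. (x, \<psi> x)) ` {y\<in>D. \<delta> \<le> dist x y}"
      and lim: "(\<lambda>N. (1 / real N) *\<^sub>R (\<Sum>j<N. Y N j)) \<longlonglongrightarrow> (v, s)" by blast
    have lim1: "(\<lambda>N. (1 / real N) *\<^sub>R (\<Sum>j<N. fst (Y N j))) \<longlonglongrightarrow> v"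
      using tendsto_fst[OF lim] by (simp add: fst_sum)
    have lim2: "(\<lambda>N. (1 / real N) * (\<Sum>j<N. snd (Y N j))) \<longlonglongrightarrow> s"
      using tendsto_snd[OF lim] by (simp add: snd_sum)
    have "(\<lambda>N. (1 / real N) * (\<Sum>j<N. snd (Y N j)) - \<eta> * norm ((1 / real N) *\<^sub>R (\<Sum>j<N. fst (Y N j)) - x))
        \<longlonglongrightarrow> s - \<eta> * norm (v - x)"
      by (intro tendsto_intros lim1 lim2)
    \<comment> \<open>The inequality is strict in the limit and so holds for all large
      \<open>N\<close>; since \<open>\<psi> \<le> \<Phi>\<close> on \<open>D\<close>, the heights of
      the points can be replaced by values of \<open>\<Phi>\<close>.\<close>
    from order_tendstoD(1)[OF this less]
    show "\<forall>\<^sub>F N in sequentially. \<exists>y. (\<forall>j. y j \<in> D \<and> \<delta> \<le> dist x (y j)) \<and>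
      \<Phi> x - \<epsilon> + \<eta> * norm ((1 / real N) *\<^sub>R (\<Sum>j<N. y j) - x) \<le> (1 / real N) * (\<Sum>j<N. \<Phi> (y j))"
    proof eventually_elim
      case (elim N)
      have yD: "fst (Y N j) \<in> D \<and> \<delta> \<le> dist x (fst (Y N j))" "snd (Y N j) \<le> \<Phi> (fst (Y N j))" for j
        using Y[of N j] \<psi>\<Phi> by auto
      have "(1 / real N) * (\<Sum>j<N. snd (Y N j)) \<le> (1 / real N) * (\<Sum>j<N. \<Phi> (fst (Y N j)))"
        using yD by (intro mult_left_mono sum_mono) auto
      with elim yD(1) show ?case by (intro exI[of _ "\<lambda>j. fst (Y N j)"]) auto
    qed
  qed
qed

section \<open>Quasi-martingales in spaces with the Radon-Nikodym property\<close>

text \<open>The children of node \<open>i\<close> are numbered \<open>i * n + j\<close> with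
  \<open>j < n\<close>, so a sum over a generation can be taken family by family, and the parent of
  \<open>k\<close> is \<open>k div n\<close>.\<close>

lemma sum_lessThan_mult:
  fixes g :: "nat \<Rightarrow> 'a::comm_monoid_add"
  shows "(\<Sum>k<m * n. g k) = (\<Sum>i<m. \<Sum>j<n. g (i * n + j))"
proof -
  have "(\<Sum>j<n. g (i * n + j)) = sum g {i * n..<i * n + n}" for i
    by (rule sum.reindex_bij_witness[of _ "\<lambda>j. j - i * n" "\<lambda>j. i * n + j"]) auto
  then show ?thesis by (simp add: sum.nat_group)
qed

lemma sum_lessThan_mult_div:
  fixes f :: "nat \<Rightarrow> real"
  assumes "0 < n"
  shows "(\<Sum>k<m * n. f (k div n) / real n) = (\<Sum>i<m. f i)"
  unfolding sum_lessThan_mult using assms by (intro sum.cong) auto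

lemma convergent_uniform_approx:
  fixes t :: "nat \<Rightarrow> 'a::banach"
  assumes "\<And>\<epsilon>. 0 < \<epsilon> \<Longrightarrow> \<exists>b. convergent b \<and> (\<forall>n. norm (t n - b n) \<le> \<epsilon>)"
  shows "convergent t"
proof -
  have "Cauchy t"
  proof (rule metric_CauchyI)
    fix e :: real assume "0 < e"
    then obtain b where b: "convergent b" "\<And>n. norm (t n - b n) \<le> e / 4"
      using assms[of "e / 4"] by auto
    then obtain K where K: "\<And>m n. m \<ge> K \<Longrightarrow> n \<ge> K \<Longrightarrow> dist (b m) (b n) < e / 4"
      using metric_CauchyD[OF convergent_Cauchy, of b "e / 4"] \<open>0 < e\<close> by auto
    have "dist (t m) (t n) < e" if "m \<ge> K" "n \<ge> K" for m n
    proof -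
      have "dist (t m) (t n) \<le> dist (t m) (b m) + dist (b m) (b n) + dist (t n) (b n)"
        by (metis add.commute add_mono_thms_linordered_semiring(3) dist_commute dist_triangle2 dist_triangle_le order_refl)
      also have "\<dots> < e"
        using K[OF that] b(2)[of m] b(2)[of n] \<open>0 < e\<close> by (simp add: dist_norm)
      finally show ?thesis .
    qed
    then show "\<exists>K. \<forall>m\<ge>K. \<forall>n\<ge>K. dist (t m) (t n) < e" by blast
  qed
  then show ?thesis by (rule Cauchy_convergent)
qed

lemma finite_measure_disjoint_tail:
  fixes A :: "nat \<Rightarrow> 'a set"
  assumes "finite_measure M" "range A \<subseteq> sets M" "disjoint_family A"
  shows "(\<lambda>K. measure M (\<Union>k. A k) - (\<Sum>k<K. measure M (A k))) \<longlonglongrightarrow> 0"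
proof -
  have "(\<lambda>k. measure M (A k)) sums measure M (\<Union>k. A k)"
    using assms by (intro finite_measure.finite_measure_UNION)
  then have "(\<lambda>K. (\<Sum>k<K. measure M (A k))) \<longlonglongrightarrow> measure M (\<Union>k. A k)" by (simp add: sums_def)
  from tendsto_diff[OF tendsto_const[of "measure M (\<Union>k. A k)"] this] show ?thesis by simp
qed

lemma finite_measure_disjoint_partial_sum_le:
  fixes A :: "nat \<Rightarrow> 'a set"
  assumes "finite_measure M" "range A \<subseteq> sets M" "disjoint_family A"
  shows "(\<Sum>k<K. measure M (A k)) \<le> measure M (\<Union>k. A k)"
proof -
  have "(\<lambda>k. measure M (A k)) sums measure M (\<Union>k. A k)"
    using assms by (intro finite_measure.finite_measure_UNION)
  then show ?thesis by (metis finite_lessThan measure_nonneg sum_le_suminf sums_iff)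
qed

subsection \<open>Refining partitions of the unit interval\<close>

text \<open>Generation \<open>n\<close> consists of \<open>M n\<close> intervals of equal length,
  each cut into \<open>N n\<close> equal intervals of the next generation.\<close>

locale interval_partitions =
  fixes M N :: "nat \<Rightarrow> nat"
  assumes M0: "M 0 = 1" and MS: "M (Suc n) = M n * N n" and Npos: "0 < N n"
begin

lemma Mpos: "0 < M n"
  by (induction n) (auto simp: M0 MS Npos)

definition idx :: "nat \<Rightarrow> real \<Rightarrow> nat" where "idx n \<omega> = nat \<lfloor>real (M n) * \<omega>\<rfloor>"

definition cell :: "nat \<Rightarrow> nat \<Rightarrow> real set" where "cell n i = {\<omega>\<in>{0..<1}. idx n \<omega> = i}"

definition cells :: "real set set" where "cells = insert {} {cell n i |n i. True}"

text \<open>The sigma-algebra is generated by the cells, instead of being the Borel one, so that statements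
  about events follow from those about cells by induction.\<close>

definition P :: "real measure" where
  "P = restr_to_subalg (restrict_space lborel {0..<1}) (sigma {0..<1} cells)"

lemma cell_eq: "cell n i = (if i < M n then {real i / M n..<(real i + 1) / M n} else {})"
proof -
  have "\<omega> \<in> cell n i \<longleftrightarrow> i < M n \<and> real i / M n \<le> \<omega> \<and> \<omega> < (real i + 1) / M n" for \<omega>
  proof -
    have pos: "0 < real (M n)" using Mpos by simp
    have "\<omega> \<in> cell n i \<longleftrightarrow> 0 \<le> \<omega> \<and> \<omega> < 1 \<and> real i \<le> real (M n) * \<omega> \<and> real (M n) * \<omega> < real i + 1"
    proof (cases "0 \<le> \<omega>")
      case True
      then have "0 \<le> real (M n) * \<omega>" by simp
      then have "nat \<lfloor>real (M n) * \<omega>\<rfloor> = i \<longleftrightarrow> real i \<le> real (M n) * \<omega> \<and> real (M n) * \<omega> < real i + 1"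
        by linarith
      then show ?thesis by (auto simp: cell_def idx_def)
    qed (auto simp: cell_def)
    also have "\<dots> \<longleftrightarrow> i < M n \<and> real i \<le> real (M n) * \<omega> \<and> real (M n) * \<omega> < real i + 1"
    proof safe
      assume "\<omega> < 1" "real i \<le> real (M n) * \<omega>"
      then have "real i < real (M n) * 1" using pos by (meson le_less_trans mult_strict_left_mono)
      then show "i < M n" by simp
    next
      assume *: "i < M n" "real i \<le> real (M n) * \<omega>" "real (M n) * \<omega> < real i + 1"
      show "0 \<le> \<omega>" using * pos by (metis of_nat_0_le_iff order_trans zero_le_mult_iff not_less)
      have "real i + 1 \<le> real (M n)" using *(1) by linarith
      then have "real (M n) * \<omega> < real (M n) * 1" using * by linarith
      then show "\<omega> < 1" using pos by (simp only: mult_less_cancel_left_pos)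
    qed
    finally show ?thesis using pos by (simp add: field_simps)
  qed
  note iff = this
  show ?thesis by (rule set_eqI) (simp add: iff)
qed

lemma cells_subset: "cells \<subseteq> Pow {0..<1}"
  by (auto simp: cells_def cell_def)

lemma subalgebra_cells: "subalgebra (restrict_space lborel {0..<1}) (sigma {0..<1} cells)"
proof -
  have "cell n i \<in> sets (restrict_space lborel {0..<1})" for n i
  proof -
    have "cell n i = {0..<1} \<inter> cell n i" by (auto simp: cell_def)
    then show ?thesis by (subst sets_restrict_space_iff) (auto simp: cell_eq)
  qed
  then have "cells \<subseteq> sets (restrict_space lborel {0..<1})" by (auto simp: cells_def)
  then have "sigma_sets (space (restrict_space lborel {0..<1::real})) cells \<subseteq> sets (restrict_space lborel {0..<1})"
    by (rule sets.sigma_sets_subset)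
  then show ?thesis
    unfolding subalgebra_def using cells_subset by (simp add: space_restrict_space sets_measure_of)
qed

lemma space_P: "space P = {0..<1}"
  by (simp add: P_def space_restr_to_subalg space_restrict_space)

lemma sets_P: "sets P = sigma_sets {0..<1} cells"
  using cells_subset by (simp add: P_def sets_restr_to_subalg[OF subalgebra_cells] sets_measure_of)

lemma cell_sets [measurable]: "cell n i \<in> sets P"
  unfolding sets_P by (rule sigma_sets.Basic) (auto simp: cells_def)

lemma emeasure_P: "E \<in> sets P \<Longrightarrow> emeasure P E = emeasure lborel E"
proof -
  assume E: "E \<in> sets P"
  then have "E \<in> sets (sigma {0..<1} cells)"
    unfolding P_def by (simp add: sets_restr_to_subalg[OF subalgebra_cells])
  from emeasure_restr_to_subalg[OF subalgebra_cells this]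
  have "emeasure P E = emeasure (restrict_space lborel {0..<1}) E" by (simp add: P_def)
  also have "\<dots> = emeasure lborel E"
    using sets.sets_into_space[OF E] by (intro emeasure_restrict_space) (auto simp: space_P)
  finally show ?thesis .
qed

lemma prob_space_P: "prob_space P"
proof (rule prob_spaceI)
  have "emeasure P (space P) = emeasure lborel (space P)" by (intro emeasure_P) auto
  then show "emeasure P (space P) = 1" by (simp add: space_P)
qed

sublocale P: prob_space P by (rule prob_space_P)

lemma measure_cell: "i < M n \<Longrightarrow> measure P (cell n i) = 1 / M n"
proof -
  assume i: "i < M n"
  have "measure P (cell n i) = measure lborel (cell n i)"
    by (simp add: measure_def emeasure_P)
  also have "\<dots> = (real i + 1) / M n - real i / M n"
    using i by (simp add: cell_eq divide_right_mono)
  finally show ?thesis by (simp add: diff_divide_distrib[symmetric])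
qed

lemma idx_less: "\<omega> \<in> {0..<1} \<Longrightarrow> idx n \<omega> < M n"
proof -
  assume "\<omega> \<in> {0..<1}"
  then have "\<omega> \<in> cell n (idx n \<omega>)" by (simp add: cell_def)
  then show ?thesis unfolding cell_eq by (metis empty_iff)
qed

section \<open>Nested cells and induction over the generated sigma-algebra\<close>

lemma idx_Suc: "idx n \<omega> = idx (Suc n) \<omega> div N n"
proof -
  have "real (M n) * \<omega> = real (M (Suc n)) * \<omega> / real (N n)"
    using Npos[of n] by (simp add: MS)
  then have "\<lfloor>real (M n) * \<omega>\<rfloor> = \<lfloor>real (M (Suc n)) * \<omega>\<rfloor> div int (N n)"
    using floor_divide_real_eq_div[of "int (N n)" "real (M (Suc n)) * \<omega>"] by simp
  then show ?thesis by (simp add: idx_def nat_div_distrib')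
qed

lemma idx_determined: "m \<le> n \<Longrightarrow> idx n \<omega> = idx n \<omega>' \<Longrightarrow> idx m \<omega> = idx m \<omega>'"
proof (induction rule: inc_induct)
  case (step k)
  then show ?case using idx_Suc[of k] by simp
qed

lemma cell_Int: "m \<le> n \<Longrightarrow> cell m l \<inter> cell n i = {} \<or> cell n i \<subseteq> cell m l"
proof (rule disjCI)
  assume mn: "m \<le> n" and "\<not> cell n i \<subseteq> cell m l"
  then obtain \<omega> where \<omega>: "\<omega> \<in> cell n i" "\<omega> \<notin> cell m l" by blast
  have "\<omega>' \<notin> cell n i" if "\<omega>' \<in> cell m l" for \<omega>'
    using idx_determined[OF mn, of \<omega> \<omega>'] that \<omega> by (auto simp: cell_def)
  then show "cell m l \<inter> cell n i = {}" by blast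
qed

text \<open>Two cells are disjoint or nested, which is what Dynkin's theorem requires of the
  generator.\<close>

lemma Int_stable_cells: "Int_stable cells"
proof (rule Int_stableI)
  fix A B assume A: "A \<in> cells" and B: "B \<in> cells"
  show "A \<inter> B \<in> cells"
  proof (cases "A = {} \<or> B = {}")
    case False
    then obtain m l n i where AB: "A = cell m l" "B = cell n i" using A B by (auto simp: cells_def)
    then have "A \<inter> B = {} \<or> A \<inter> B = A \<or> A \<inter> B = B"
      using cell_Int[of m n l i] cell_Int[of n m i l] nat_le_linear[of m n] by blast
    then show ?thesis using A B by (auto simp: cells_def)
  qed (auto simp: cells_def)
qed

text \<open>Dynkin's pi-lambda theorem as an induction rule. The empty set has no case of its own,
  since it is the cell \<open>cell 0 1\<close> with an index out of range.\<close>

lemma sets_induct [consumes 1, case_names cell compl union]: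
  assumes "F \<in> sets P"
    and "\<And>m l. Q (cell m l)"
    and "\<And>A. A \<in> sets P \<Longrightarrow> Q A \<Longrightarrow> Q (space P - A)"
    and "\<And>A. disjoint_family A \<Longrightarrow> range A \<subseteq> sets P \<Longrightarrow> (\<And>i. Q (A i)) \<Longrightarrow> Q (\<Union>i::nat. A i)"
  shows "Q F"
proof -
  have "cell 0 1 = {}" by (simp add: cell_eq M0)
  then have "Q {}" using assms(2)[of 0 1] by simp
  with assms(2) have basic: "Q A" if "A \<in> cells" for A using that by (auto simp: cells_def)
  from Int_stable_cells cells_subset assms(1)[unfolded sets_P] show ?thesis
    by (rule sigma_sets_induct_disjoint)
      (use basic \<open>Q {}\<close> assms(3,4)[unfolded sets_P space_P] in blast)+
qed

section \<open>Distribution of events over the cells of a generation\<close>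

lemma measure_split_cells:
  assumes "E \<in> sets P"
  shows "(\<Sum>i<M n. measure P (E \<inter> cell n i)) = measure P E"
proof -
  have "E = (\<Union>i<M n. E \<inter> cell n i)"
    using sets.sets_into_space[OF assms] idx_less by (auto simp: cell_def space_P)
  moreover have "measure P (\<Union>i<M n. E \<inter> cell n i) = (\<Sum>i<M n. measure P (E \<inter> cell n i))"
  proof (rule P.finite_measure_finite_Union)
    show "disjoint_family_on (\<lambda>i. E \<inter> cell n i) {..<M n}"
      by (auto simp: disjoint_family_on_def cell_def)
  qed (use assms in auto)
  ultimately show ?thesis by simp
qed

lemma cell_tail_nonneg:
  fixes A :: "nat \<Rightarrow> real set"
  assumes "range A \<subseteq> sets P" "disjoint_family A"
  shows "0 \<le> measure P ((\<Union>k. A k) \<inter> cell n i) - (\<Sum>k<K. measure P (A k \<inter> cell n i))"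
proof -
  have "disjoint_family (\<lambda>k. A k \<inter> cell n i)" using assms(2) by (auto simp: disjoint_family_on_def)
  then have "(\<Sum>k<K. measure P (A k \<inter> cell n i)) \<le> measure P (\<Union>k. A k \<inter> cell n i)"
    using assms(1) by (intro finite_measure_disjoint_partial_sum_le P.finite_measure_axioms) auto
  then show ?thesis by simp
qed

text \<open>What the first \<open>K\<close> sets leave over is distributed among the cells, but its
  total does not depend on \<open>n\<close>. This makes all later tail estimates uniform in the
  generation.\<close>

lemma cell_tail_sum:
  fixes A :: "nat \<Rightarrow> real set"
  assumes "range A \<subseteq> sets P"
  shows "(\<Sum>i<M n. measure P ((\<Union>k. A k) \<inter> cell n i) - (\<Sum>k<K. measure P (A k \<inter> cell n i)))
    = measure P (\<Union>k. A k) - (\<Sum>k<K. measure P (A k))"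
proof -
  have "(\<Sum>i<M n. \<Sum>k<K. measure P (A k \<inter> cell n i)) = (\<Sum>k<K. \<Sum>i<M n. measure P (A k \<inter> cell n i))"
    by (rule sum.swap)
  also have "\<dots> = (\<Sum>k<K. measure P (A k))"
    using assms by (intro sum.cong measure_split_cells) auto
  finally show ?thesis using assms measure_split_cells[of "\<Union>k. A k" n] by (simp add: sum_subtractf)
qed

text \<open>The L1 distance between the conditional expectations of the indicator of
  \<open>F\<close> with respect to two successive generations.\<close>

definition uneven :: "nat \<Rightarrow> real set \<Rightarrow> real" where
  "uneven n F = (\<Sum>k<M (Suc n).
     \<bar>measure P (F \<inter> cell (Suc n) k) - measure P (F \<inter> cell n (k div N n)) / N n\<bar>)"

text \<open>A cell of generation \<open>m\<close> contains or misses each cell of a later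
  generation; in both cases a child receives exactly its share of the parent.\<close>

lemma even_cell:
  assumes "m \<le> n" "k < M (Suc n)"
  shows "measure P (cell m l \<inter> cell (Suc n) k) = measure P (cell m l \<inter> cell n (k div N n)) / N n"
proof -
  have kn: "k div N n < M n" using assms(2) by (simp add: MS less_mult_imp_div_less)
  have sub: "cell (Suc n) k \<subseteq> cell n (k div N n)"
    by (auto simp: cell_def idx_Suc[of n])
  from cell_Int[OF assms(1), of l "k div N n"] show ?thesis
  proof
    assume "cell m l \<inter> cell n (k div N n) = {}"
    moreover from this have "cell m l \<inter> cell (Suc n) k = {}" using sub by blast
    ultimately show ?thesis by simp
  next
    assume "cell n (k div N n) \<subseteq> cell m l"
    then have "cell m l \<inter> cell n (k div N n) = cell n (k div N n)"
      "cell m l \<inter> cell (Suc n) k = cell (Suc n) k" using sub by auto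
    then show ?thesis using measure_cell[OF kn] measure_cell[OF assms(2)] by (simp add: MS)
  qed
qed

lemma even_space:
  assumes "k < M (Suc n)"
  shows "measure P (cell (Suc n) k) = measure P (cell n (k div N n)) / N n"
proof -
  \<comment> \<open>\<open>cell 0 0\<close> is the whole interval, so this is the case
    \<open>m = 0\<close> of \<open>even_cell\<close>.\<close>
  have "cell 0 0 \<inter> cell n i = cell n i" for n i
    using idx_less[of _ 0] by (auto simp: cell_def M0)
  then show ?thesis using even_cell[of 0 n k 0] assms by simp
qed

lemma uneven_nonneg: "0 \<le> uneven n F"
  by (simp add: uneven_def sum_nonneg)

text \<open>The quantity is eventually zero for cells and does not change under complements. For a
  disjoint union, the first \<open>K\<close> sets contribute finitely many null sequences, and the
  remaining mass \<open>r K\<close> enters once for each of the two generations, whence the bound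
  \<open>2 * r K\<close> for all \<open>n\<close>.\<close>

lemma uneven_tendsto_0: "F \<in> sets P \<Longrightarrow> (\<lambda>n. uneven n F) \<longlonglongrightarrow> 0"
proof (induction rule: sets_induct)
  case (cell m l)
  show ?case
    by (rule tendsto_eventually) (auto simp: uneven_def eventually_sequentially even_cell intro!: exI[of _ m])
next
  case (compl A)
  have diff: "measure P ((space P - A) \<inter> cell n i) = measure P (cell n i) - measure P (A \<inter> cell n i)" for n i
  proof -
    have "(space P - A) \<inter> cell n i = cell n i - A \<inter> cell n i" using sets.sets_into_space[OF cell_sets] by auto
    then show ?thesis using compl by (simp add: P.finite_measure_Diff)
  qed
  have "uneven n (space P - A) = uneven n A" for n
    unfolding uneven_def
  proof (intro sum.cong refl)
    fix k assume "k \<in> {..<M (Suc n)}"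
    then have "measure P ((space P - A) \<inter> cell (Suc n) k) - measure P ((space P - A) \<inter> cell n (k div N n)) / N n
        = - (measure P (A \<inter> cell (Suc n) k) - measure P (A \<inter> cell n (k div N n)) / N n)"
      unfolding diff by (simp add: even_space diff_divide_distrib)
    then show "\<bar>measure P ((space P - A) \<inter> cell (Suc n) k) - measure P ((space P - A) \<inter> cell n (k div N n)) / N n\<bar>
        = \<bar>measure P (A \<inter> cell (Suc n) k) - measure P (A \<inter> cell n (k div N n)) / N n\<bar>"
      by (simp only: abs_minus_cancel)
  qed
  then show ?case using compl by simp
next
  case (union A)
  have A: "A k \<in> sets P" for k using union by auto
  define r where "r K = measure P (\<Union>k. A k) - (\<Sum>k<K. measure P (A k))" for K
  have le: "uneven n (\<Union>k. A k) \<le> (\<Sum>k<K. uneven n (A k)) + 2 * r K" for n K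
  proof -
    define q where "q n i = measure P ((\<Union>k. A k) \<inter> cell n i) - (\<Sum>k<K. measure P (A k \<inter> cell n i))" for n i
    have q0: "0 \<le> q n i" for n i
      using cell_tail_nonneg[OF union(2,1)] by (simp add: q_def)
    have qsum: "(\<Sum>i<M n. q n i) = r K" for n
      using cell_tail_sum[OF union(2)] by (simp add: q_def r_def)
    have "uneven n (\<Union>k. A k) \<le> (\<Sum>i<M (Suc n). (\<Sum>k<K. \<bar>measure P (A k \<inter> cell (Suc n) i) - measure P (A k \<inter> cell n (i div N n)) / N n\<bar>)
       + (q (Suc n) i + q n (i div N n) / N n))"
      unfolding uneven_def
    proof (intro sum_mono)
      fix i
      define e where "e k = measure P (A k \<inter> cell (Suc n) i) - measure P (A k \<inter> cell n (i div N n)) / N n" for k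
      have "measure P ((\<Union>k. A k) \<inter> cell (Suc n) i) - measure P ((\<Union>k. A k) \<inter> cell n (i div N n)) / N n
        = (\<Sum>k<K. e k) + (q (Suc n) i - q n (i div N n) / N n)"
        by (simp add: q_def e_def sum_subtractf sum_divide_distrib diff_divide_distrib)
      moreover have "\<bar>\<Sum>k<K. e k\<bar> \<le> (\<Sum>k<K. \<bar>e k\<bar>)" by (rule sum_abs)
      moreover have "0 \<le> q n (i div N n) / N n" by (intro divide_nonneg_nonneg q0) simp
      ultimately show "\<bar>measure P ((\<Union>k. A k) \<inter> cell (Suc n) i) - measure P ((\<Union>k. A k) \<inter> cell n (i div N n)) / N n\<bar>
        \<le> (\<Sum>k<K. \<bar>measure P (A k \<inter> cell (Suc n) i) - measure P (A k \<inter> cell n (i div N n)) / N n\<bar>)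
         + (q (Suc n) i + q n (i div N n) / N n)"
        using q0[of "Suc n" i] unfolding e_def[symmetric] by linarith
    qed
    also have "\<dots> = (\<Sum>k<K. uneven n (A k)) + (r K + (\<Sum>i<M (Suc n). q n (i div N n) / N n))"
      unfolding sum.distrib qsum uneven_def by (subst sum.swap) (rule refl)
    also have "(\<Sum>i<M (Suc n). q n (i div N n) / N n) = r K"
      unfolding MS sum_lessThan_mult_div[OF Npos] qsum ..
    finally show ?thesis by simp
  qed
  have r: "r \<longlonglongrightarrow> 0"
    unfolding r_def using union by (intro finite_measure_disjoint_tail P.finite_measure_axioms)
  show ?case
  proof (rule order_tendstoI)
    fix a :: real assume "a < 0"
    then show "\<forall>\<^sub>F n in sequentially. a < uneven n (\<Union>k. A k)"
      by (intro always_eventually allI less_le_trans[OF _ uneven_nonneg])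
  next
    fix a :: real assume a: "0 < a"
    then obtain K where K: "r K < a / 4"
      using order_tendstoD(2)[OF r, of "a / 4"] by (auto simp: eventually_sequentially)
    have "(\<lambda>n. \<Sum>k<K. uneven n (A k)) \<longlonglongrightarrow> (\<Sum>k<K. 0)"
      by (intro tendsto_sum union)
    then have "\<forall>\<^sub>F n in sequentially. (\<Sum>k<K. uneven n (A k)) < a / 2"
      using a by (intro order_tendstoD(2)) auto
    then show "\<forall>\<^sub>F n in sequentially. uneven n (\<Union>k. A k) < a"
    proof eventually_elim
      case (elim n)
      show ?case using le[of n K] elim K by linarith
    qed
  qed
qed

end

subsection \<open>Bochner integrals through simple functions\<close>

text \<open>The distance itself is only almost everywhere a limit of measurable functions; a
  measurable representative is required for the additivity of the nonnegative integral.\<close>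

lemma bochner_measurable_dist_AE:
  assumes h: "bochner_measurable M h" and s: "simple_function M s"
  obtains g where "g \<in> borel_measurable M" "AE \<omega> in M. norm (h \<omega> - s \<omega>) = g \<omega>" "\<And>\<omega>. 0 \<le> g \<omega>"
proof -
  obtain t where t: "\<And>n. simple_function M (t n)" and lim: "AE \<omega> in M. (\<lambda>n. t n \<omega>) \<longlonglongrightarrow> h \<omega>"
    using h by (auto simp: bochner_measurable_def)
  \<comment> \<open>\<open>lim\<close> is measurable even where the sequence diverges and its value
    is arbitrary; the absolute value makes it nonnegative there too.\<close>
  define g where "g \<omega> = \<bar>lim (\<lambda>n. norm (t n \<omega> - s \<omega>))\<bar>" for \<omega>
  have "(\<lambda>\<omega>. norm (t n \<omega> - s \<omega>)) \<in> borel_measurable M" for n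
    using simple_function_compose2[OF t[of n] s, of "\<lambda>a b. norm (a - b)"] by (rule borel_measurable_simple_function)
  then have "g \<in> borel_measurable M" unfolding g_def by measurable
  moreover have "AE \<omega> in M. norm (h \<omega> - s \<omega>) = g \<omega>"
    using lim
  proof eventually_elim
    case (elim \<omega>)
    then have "(\<lambda>n. norm (t n \<omega> - s \<omega>)) \<longlonglongrightarrow> norm (h \<omega> - s \<omega>)" by (intro tendsto_intros)
    then show ?case by (simp add: g_def limI)
  qed
  ultimately show ?thesis by (rule that) (simp add: g_def)
qed

lemma simple_bochner_integral_dist_le:
  assumes s: "Bochner_Integration.simple_bochner_integrable M s"
    and t: "Bochner_Integration.simple_bochner_integrable M t"
    and h: "bochner_measurable M h"
  shows "ennreal (norm (Bochner_Integration.simple_bochner_integral M s - Bochner_Integration.simple_bochner_integral M t))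
    \<le> (\<integral>\<^sup>+\<omega>. ennreal (norm (h \<omega> - s \<omega>)) \<partial>M) + (\<integral>\<^sup>+\<omega>. ennreal (norm (h \<omega> - t \<omega>)) \<partial>M)"
proof -
  have st: "simple_function M s" "simple_function M t"
    using s t by (auto elim: Bochner_Integration.simple_bochner_integrable.cases)
  obtain g1 where g1: "g1 \<in> borel_measurable M" "AE \<omega> in M. norm (h \<omega> - s \<omega>) = g1 \<omega>" "\<And>\<omega>. 0 \<le> g1 \<omega>"
    using bochner_measurable_dist_AE[OF h st(1)] by blast
  obtain g2 where g2: "g2 \<in> borel_measurable M" "AE \<omega> in M. norm (h \<omega> - t \<omega>) = g2 \<omega>" "\<And>\<omega>. 0 \<le> g2 \<omega>"
    using bochner_measurable_dist_AE[OF h st(2)] by blast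
  have "ennreal (norm (Bochner_Integration.simple_bochner_integral M s - Bochner_Integration.simple_bochner_integral M t))
      = ennreal (norm (Bochner_Integration.simple_bochner_integral M (\<lambda>x. s x - t x)))"
    using s t by (subst simple_bochner_integral_diff) auto
  also have "\<dots> \<le> ennreal (Bochner_Integration.simple_bochner_integral M (\<lambda>x. norm (s x - t x)))"
    using simple_bochner_integrable_compose2[of "(-)" M s t] s t
    by (intro ennreal_leI simple_bochner_integral_norm_bound) auto
  also have "\<dots> = (\<integral>\<^sup>+x. ennreal (norm (s x - t x)) \<partial>M)"
    using simple_bochner_integrable_compose2[of "\<lambda>x y. norm (x - y)" M s t] s t
    by (intro simple_bochner_integral_eq_nn_integral) auto
  also have "\<dots> \<le> (\<integral>\<^sup>+x. ennreal (g1 x) + ennreal (g2 x) \<partial>M)"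
    using g1(2) g2(2)
  proof (intro nn_integral_mono_AE, eventually_elim)
    case (elim x)
    have "norm (s x - t x) \<le> g1 x + g2 x"
      using elim norm_triangle_ineq4[of "h x - t x" "h x - s x"] by simp
    then show ?case using g1(3) g2(3) by (metis ennreal_leI ennreal_plus)
  qed
  also have "\<dots> = (\<integral>\<^sup>+x. ennreal (g1 x) \<partial>M) + (\<integral>\<^sup>+x. ennreal (g2 x) \<partial>M)"
    using g1(1) g2(1) by (intro nn_integral_add) auto
  also have "(\<integral>\<^sup>+x. ennreal (g1 x) \<partial>M) = (\<integral>\<^sup>+\<omega>. ennreal (norm (h \<omega> - s \<omega>)) \<partial>M)"
    using g1(2) by (intro nn_integral_cong_AE) auto
  also have "(\<integral>\<^sup>+x. ennreal (g2 x) \<partial>M) = (\<integral>\<^sup>+\<omega>. ennreal (norm (h \<omega> - t \<omega>)) \<partial>M)"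
    using g2(2) by (intro nn_integral_cong_AE) auto
  finally show ?thesis .
qed

text \<open>The previous estimate in the limit along the simple functions that define
  \<open>v\<close>.\<close>

lemma bochner_integral_is_dist_le:
  assumes v: "bochner_integral_is M h v" and t: "Bochner_Integration.simple_bochner_integrable M t"
  shows "ennreal (norm (v - Bochner_Integration.simple_bochner_integral M t))
    \<le> (\<integral>\<^sup>+\<omega>. ennreal (norm (h \<omega> - t \<omega>)) \<partial>M)"
proof -
  obtain s where s: "\<And>n. Bochner_Integration.simple_bochner_integrable M (s n)"
    and lim0: "(\<lambda>n. \<integral>\<^sup>+\<omega>. ennreal (norm (h \<omega> - s n \<omega>)) \<partial>M) \<longlonglongrightarrow> 0"
    and limv: "(\<lambda>n. Bochner_Integration.simple_bochner_integral M (s n)) \<longlonglongrightarrow> v"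
    using v by (auto simp: bochner_integral_is_def)
  have h: "bochner_measurable M h" using v by (simp add: bochner_integral_is_def)
  have "(\<lambda>n. ennreal (norm (Bochner_Integration.simple_bochner_integral M (s n) - Bochner_Integration.simple_bochner_integral M t)))
      \<longlonglongrightarrow> ennreal (norm (v - Bochner_Integration.simple_bochner_integral M t))"
    by (intro tendsto_intros limv)
  moreover have "(\<lambda>n. (\<integral>\<^sup>+\<omega>. ennreal (norm (h \<omega> - s n \<omega>)) \<partial>M) + (\<integral>\<^sup>+\<omega>. ennreal (norm (h \<omega> - t \<omega>)) \<partial>M))
      \<longlonglongrightarrow> 0 + (\<integral>\<^sup>+\<omega>. ennreal (norm (h \<omega> - t \<omega>)) \<partial>M)"
    by (intro tendsto_add lim0 tendsto_const)
  ultimately have "ennreal (norm (v - Bochner_Integration.simple_bochner_integral M t))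
      \<le> 0 + (\<integral>\<^sup>+\<omega>. ennreal (norm (h \<omega> - t \<omega>)) \<partial>M)"
    by (rule LIMSEQ_le) (use simple_bochner_integral_dist_le[OF s t h] in blast)
  then show ?thesis by simp
qed

subsection \<open>The limit vector measure of a quasi-martingale\<close>

text \<open>\<open>X n i\<close> is the value on cell \<open>i\<close> of generation
  \<open>n\<close>. The summand of the drift series is the L1 distance between \<open>X n\<close>
  and the conditional expectation of \<open>X (Suc n)\<close>; for a martingale it would
  vanish.\<close>

locale quasi_martingale = interval_partitions +
  fixes X :: "nat \<Rightarrow> nat \<Rightarrow> 'a::banach"
  assumes norm_X: "norm (X n i) \<le> 1"
    and summable_drift: "summable (\<lambda>n. 1 / real (M n) *
      (\<Sum>i<M n. norm ((1 / real (N n)) *\<^sub>R (\<Sum>j<N n. X (Suc n) (i * N n + j)) - X n i)))"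
begin

definition drift :: "nat \<Rightarrow> nat \<Rightarrow> 'a" where
  "drift n i = (1 / real (N n)) *\<^sub>R (\<Sum>j<N n. X (Suc n) (i * N n + j)) - X n i"

definition total_drift :: "nat \<Rightarrow> real" where
  "total_drift n = (\<Sum>i<M n. measure P (cell n i) * norm (drift n i))"

text \<open>The vector measure whose density is the step function with value \<open>X n i\<close> on
  \<open>cell n i\<close>.\<close>

definition T :: "nat \<Rightarrow> real set \<Rightarrow> 'a" where
  "T n E = (\<Sum>i<M n. measure P (E \<inter> cell n i) *\<^sub>R X n i)"

definition \<tau> :: "real set \<Rightarrow> 'a" where
  "\<tau> E = lim (\<lambda>n. T n E)"

lemma summable_total_drift: "summable total_drift"
proof -
  have "total_drift = (\<lambda>n. 1 / real (M n) * (\<Sum>i<M n. norm (drift n i)))"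
    by (rule ext) (simp add: total_drift_def measure_cell sum_divide_distrib)
  then show ?thesis using summable_drift by (simp add: drift_def)
qed

lemma total_drift_nonneg: "0 \<le> total_drift n"
  by (simp add: total_drift_def sum_nonneg)

text \<open>If every child receives the same share of \<open>F\<close>, the new generation enters
  only through the averages over families, and these differ from the old values by the
  drift.\<close>

lemma T_Suc_diff:
  assumes "\<And>k. k < M (Suc n) \<Longrightarrow>
    measure P (F \<inter> cell (Suc n) k) = measure P (F \<inter> cell n (k div N n)) / N n"
  shows "T (Suc n) F - T n F = (\<Sum>i<M n. measure P (F \<inter> cell n i) *\<^sub>R drift n i)"
proof -
  have "T (Suc n) F = (\<Sum>i<M n. \<Sum>j<N n. measure P (F \<inter> cell (Suc n) (i * N n + j)) *\<^sub>R X (Suc n) (i * N n + j))"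
    unfolding T_def MS sum_lessThan_mult ..
  also have "\<dots> = (\<Sum>i<M n. measure P (F \<inter> cell n i) *\<^sub>R ((1 / real (N n)) *\<^sub>R (\<Sum>j<N n. X (Suc n) (i * N n + j))))"
  proof (rule sum.cong[OF refl])
    fix i assume i: "i \<in> {..<M n}"
    have "measure P (F \<inter> cell (Suc n) (i * N n + j)) = measure P (F \<inter> cell n i) * (1 / real (N n))" if j: "j < N n" for j
    proof -
      have "i * N n + j < Suc i * N n" using j by simp
      also have "\<dots> \<le> M n * N n" using i by (intro mult_right_mono) auto
      finally show ?thesis using assms[of "i * N n + j"] j by (simp add: MS)
    qed
    then show "(\<Sum>j<N n. measure P (F \<inter> cell (Suc n) (i * N n + j)) *\<^sub>R X (Suc n) (i * N n + j)) =
        measure P (F \<inter> cell n i) *\<^sub>R ((1 / real (N n)) *\<^sub>R (\<Sum>j<N n. X (Suc n) (i * N n + j)))"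
      unfolding scaleR_sum_right scaleR_scaleR by (intro sum.cong) auto
  qed
  finally show ?thesis by (simp add: T_def drift_def scaleR_diff_right sum_subtractf)
qed

text \<open>As the values have norm at most 1, the error is bounded by the mass left over. The bound
  does not depend on \<open>n\<close>, so it carries convergence to countable unions and countable
  additivity to the limit.\<close>

lemma norm_T_disjoint_le:
  fixes A :: "nat \<Rightarrow> real set"
  assumes A: "range A \<subseteq> sets P" "disjoint_family A"
  shows "norm (T n (\<Union>k. A k) - (\<Sum>k<K. T n (A k))) \<le> measure P (\<Union>k. A k) - (\<Sum>k<K. measure P (A k))"
proof -
  define q where "q i = measure P ((\<Union>k. A k) \<inter> cell n i) - (\<Sum>k<K. measure P (A k \<inter> cell n i))" for i
  have "(\<Sum>k<K. T n (A k)) = (\<Sum>i<M n. (\<Sum>k<K. measure P (A k \<inter> cell n i)) *\<^sub>R X n i)"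
    unfolding T_def scaleR_sum_left by (rule sum.swap)
  then have "T n (\<Union>k. A k) - (\<Sum>k<K. T n (A k)) = (\<Sum>i<M n. q i *\<^sub>R X n i)"
    by (simp add: T_def q_def scaleR_diff_left sum_subtractf)
  also have "norm \<dots> \<le> (\<Sum>i<M n. q i)"
  proof (rule sum_norm_le)
    fix i
    have "0 \<le> q i" using cell_tail_nonneg[OF A] by (simp add: q_def)
    then show "norm (q i *\<^sub>R X n i) \<le> q i"
      using mult_left_mono[OF norm_X[of n i], of "q i"] by simp
  qed
  also have "\<dots> = measure P (\<Union>k. A k) - (\<Sum>k<K. measure P (A k))"
    unfolding q_def using A(1) by (rule cell_tail_sum)
  finally show ?thesis .
qed

lemma norm_T_le: "E \<in> sets P \<Longrightarrow> norm (T n E) \<le> measure P E"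
proof -
  assume E: "E \<in> sets P"
  have "norm (T n E) \<le> (\<Sum>i<M n. measure P (E \<inter> cell n i))"
    unfolding T_def
  proof (rule sum_norm_le)
    fix i show "norm (measure P (E \<inter> cell n i) *\<^sub>R X n i) \<le> measure P (E \<inter> cell n i)"
      using mult_left_mono[OF norm_X[of n i], of "measure P (E \<inter> cell n i)"] by simp
  qed
  also have "\<dots> = measure P E" by (rule measure_split_cells[OF E])
  finally show ?thesis .
qed

lemma T_cell_diff_le:
  assumes "m \<le> n"
  shows "norm (T (Suc n) (cell m l) - T n (cell m l)) \<le> (\<Sum>i<M n. measure P (cell m l \<inter> cell n i) * norm (drift n i))"
proof -
  have "T (Suc n) (cell m l) - T n (cell m l) = (\<Sum>i<M n. measure P (cell m l \<inter> cell n i) *\<^sub>R drift n i)"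
    using assms by (intro T_Suc_diff even_cell)
  then show ?thesis using norm_sum[of "\<lambda>i. measure P (cell m l \<inter> cell n i) *\<^sub>R drift n i" "{..<M n}"] by simp
qed

text \<open>A telescoping series: from generation \<open>m\<close> on, \<open>cell m l\<close> is
  divided evenly, so the increments are dominated by the summable drift.\<close>

lemma T_convergent_cell: "convergent (\<lambda>n. T n (cell m l))"
proof -
  have "summable (\<lambda>n. T (Suc n) (cell m l) - T n (cell m l))"
  proof (rule summable_comparison_test[OF _ summable_total_drift], intro exI allI impI)
    fix n assume "m \<le> n"
    then have "norm (T (Suc n) (cell m l) - T n (cell m l)) \<le> (\<Sum>i<M n. measure P (cell m l \<inter> cell n i) * norm (drift n i))"
      by (rule T_cell_diff_le)
    also have "\<dots> \<le> total_drift n"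
      unfolding total_drift_def by (intro sum_mono mult_right_mono P.finite_measure_mono) auto
    finally show "norm (T (Suc n) (cell m l) - T n (cell m l)) \<le> total_drift n" .
  qed
  then have "convergent (\<lambda>n. (\<Sum>k<n. T (Suc k) (cell m l) - T k (cell m l)) + T 0 (cell m l))"
    by (intro convergent_add convergent_const) (simp add: summable_iff_convergent)
  moreover have "(\<Sum>k<n. T (Suc k) (cell m l) - T k (cell m l)) + T 0 (cell m l) = T n (cell m l)" for n
    using sum_lessThan_telescope[of "\<lambda>k. T k (cell m l)" n] by simp
  ultimately show ?thesis by simp
qed

text \<open>For a disjoint union, the sequence is a uniform limit of the finite sums
  \<open>\<Sum>k<K. T n (A k)\<close>, which converge by induction.\<close>

lemma T_convergent: "F \<in> sets P \<Longrightarrow> convergent (\<lambda>n. T n F)"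
proof (induction rule: sets_induct)
  case (cell m l)
  show ?case by (rule T_convergent_cell)
next
  case (compl A)
  have eq: "T n (space P - A) = T n (space P) - T n A" for n
  proof -
    have "measure P ((space P - A) \<inter> cell n i) = measure P (cell n i) - measure P (A \<inter> cell n i)" for i
    proof -
      have "(space P - A) \<inter> cell n i = cell n i - A \<inter> cell n i" using sets.sets_into_space[OF cell_sets] by auto
      then show ?thesis using compl by (simp add: P.finite_measure_Diff)
    qed
    moreover have "space P \<inter> cell n i = cell n i" for i using sets.sets_into_space[OF cell_sets] by auto
    ultimately show ?thesis by (simp add: T_def scaleR_diff_left sum_subtractf)
  qed
  have "space P = cell 0 0" using idx_less[of _ 0] by (auto simp: space_P cell_def M0)
  then have "convergent (\<lambda>n. T n (space P))" by (simp add: T_convergent_cell)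
  then show ?case unfolding eq using compl by (intro convergent_diff)
next
  case (union A)
  define r where "r K = measure P (\<Union>k. A k) - (\<Sum>k<K. measure P (A k))" for K
  have r: "r \<longlonglongrightarrow> 0"
    unfolding r_def using union by (intro finite_measure_disjoint_tail P.finite_measure_axioms)
  show ?case
  proof (rule convergent_uniform_approx)
    fix \<epsilon> :: real assume "0 < \<epsilon>"
    then obtain K where "r K < \<epsilon>"
      using order_tendstoD(2)[OF r] by (auto simp: eventually_sequentially)
    then have "norm (T n (\<Union>k. A k) - (\<Sum>k<K. T n (A k))) \<le> \<epsilon>" for n
      using norm_T_disjoint_le[OF union(2,1), of n K] by (simp add: r_def)
    moreover have "convergent (\<lambda>n. \<Sum>k<K. T n (A k))"
      using union(3) by (intro convergent_sum) auto
    ultimately show "\<exists>b. convergent b \<and> (\<forall>n. norm (T n (\<Union>k. A k) - b n) \<le> \<epsilon>)" by blast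
  qed
qed

lemma T_tendsto: "E \<in> sets P \<Longrightarrow> (\<lambda>n. T n E) \<longlonglongrightarrow> \<tau> E"
  unfolding \<tau>_def using T_convergent by (simp add: convergent_LIMSEQ_iff)

lemma norm_\<tau>_le: "E \<in> sets P \<Longrightarrow> norm (\<tau> E) \<le> measure P E"
  using norm_T_le by (intro LIMSEQ_le_const2[OF tendsto_norm[OF T_tendsto]]) auto

lemma \<tau>_countably_additive: "countably_additive_vector_measure P \<tau>"
  unfolding countably_additive_vector_measure_def sums_def
proof safe
  fix A :: "nat \<Rightarrow> real set"
  assume A: "range A \<subseteq> sets P" "disjoint_family A"
  define r where "r K = measure P (\<Union>k. A k) - (\<Sum>k<K. measure P (A k))" for K
  have r: "r \<longlonglongrightarrow> 0"
    unfolding r_def using A by (intro finite_measure_disjoint_tail P.finite_measure_axioms)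
  have "norm (\<tau> (\<Union>k. A k) - (\<Sum>k<K. \<tau> (A k))) \<le> r K" for K
  proof (rule LIMSEQ_le_const2)
    show "(\<lambda>n. norm (T n (\<Union>k. A k) - (\<Sum>k<K. T n (A k)))) \<longlonglongrightarrow> norm (\<tau> (\<Union>k. A k) - (\<Sum>k<K. \<tau> (A k)))"
      using A by (intro tendsto_intros T_tendsto) auto
    show "\<exists>n0. \<forall>n\<ge>n0. norm (T n (\<Union>k. A k) - (\<Sum>k<K. T n (A k))) \<le> r K"
      using norm_T_disjoint_le[OF A] by (auto simp: r_def)
  qed
  then have "(\<lambda>K. \<tau> (\<Union>k. A k) - (\<Sum>k<K. \<tau> (A k))) \<longlonglongrightarrow> 0"
    by (intro Lim_null_comparison[OF _ r] always_eventually) auto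
  from tendsto_diff[OF tendsto_const[of "\<tau> (\<Union>k. A k)"] this]
  show "(\<lambda>K. \<Sum>k<K. \<tau> (A k)) \<longlonglongrightarrow> \<tau> (\<Union>k. A k)" by simp
qed

text \<open>Passing from generation \<open>L\<close> to the next costs at most
  \<open>total_drift L\<close> altogether, because the mass of each cell of generation
  \<open>L\<close> is counted only once among the cells of generation \<open>n\<close>. The
  right-hand side is the tail of a convergent series.\<close>

lemma \<tau>_near_T:
  "(\<Sum>i<M n. norm (\<tau> (cell n i) - T n (cell n i))) \<le> suminf total_drift - (\<Sum>k<n. total_drift k)"
proof (rule LIMSEQ_le_const2)
  show "(\<lambda>L. \<Sum>i<M n. norm (T L (cell n i) - T n (cell n i))) \<longlonglongrightarrow> (\<Sum>i<M n. norm (\<tau> (cell n i) - T n (cell n i)))"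
    by (intro tendsto_intros T_tendsto) auto
  have "(\<Sum>i<M n. norm (T L (cell n i) - T n (cell n i))) \<le> (\<Sum>k<L. total_drift k) - (\<Sum>k<n. total_drift k)" if "n \<le> L" for L
    using that
  proof (induction rule: dec_induct)
    case (step L)
    have "(\<Sum>i<M n. norm (T (Suc L) (cell n i) - T n (cell n i)))
        \<le> (\<Sum>i<M n. norm (T (Suc L) (cell n i) - T L (cell n i)) + norm (T L (cell n i) - T n (cell n i)))"
    proof (rule sum_mono)
      fix i
      show "norm (T (Suc L) (cell n i) - T n (cell n i))
          \<le> norm (T (Suc L) (cell n i) - T L (cell n i)) + norm (T L (cell n i) - T n (cell n i))"
        using norm_triangle_ineq[of "T (Suc L) (cell n i) - T L (cell n i)" "T L (cell n i) - T n (cell n i)"] by simp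
    qed
    also have "\<dots> = (\<Sum>i<M n. norm (T (Suc L) (cell n i) - T L (cell n i))) + (\<Sum>i<M n. norm (T L (cell n i) - T n (cell n i)))"
      by (rule sum.distrib)
    also have "(\<Sum>i<M n. norm (T (Suc L) (cell n i) - T L (cell n i)))
        \<le> (\<Sum>i<M n. \<Sum>k<M L. measure P (cell n i \<inter> cell L k) * norm (drift L k))"
      using step.hyps by (intro sum_mono T_cell_diff_le)
    also have "\<dots> = (\<Sum>k<M L. (\<Sum>i<M n. measure P (cell L k \<inter> cell n i)) * norm (drift L k))"
      unfolding sum_distrib_right by (subst sum.swap) (simp add: Int_commute)
    also have "\<dots> = total_drift L"
      by (simp add: total_drift_def measure_split_cells)
    finally show ?case using step.IH by simp
  qed simp
  note partial = this
  have "(\<Sum>k<L. total_drift k) \<le> suminf total_drift" for L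
    using summable_total_drift total_drift_nonneg by (intro sum_le_suminf) auto
  with partial have "(\<Sum>i<M n. norm (T L (cell n i) - T n (cell n i)))
      \<le> suminf total_drift - (\<Sum>k<n. total_drift k)" if "n \<le> L" for L
    using that by (meson diff_right_mono order_trans)
  then show "\<exists>L0. \<forall>L\<ge>L0. (\<Sum>i<M n. norm (T L (cell n i) - T n (cell n i)))
      \<le> suminf total_drift - (\<Sum>k<n. total_drift k)"
    by blast
qed

section \<open>A separated quasi-martingale has no density\<close>

lemma simple_bochner_integral_indicator:
  assumes s: "simple_function P s" and E: "E \<in> sets P"
  shows "Bochner_Integration.simple_bochner_integrable P (\<lambda>\<omega>. indicat_real E \<omega> *\<^sub>R s \<omega>)" (is ?integrable)
    and "Bochner_Integration.simple_bochner_integral P (\<lambda>\<omega>. indicat_real E \<omega> *\<^sub>R s \<omega>)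
      = (\<Sum>c\<in>s ` space P. measure P (E \<inter> {\<omega>\<in>space P. s \<omega> = c}) *\<^sub>R (c :: 'b::real_normed_vector))"
proof -
  have ind: "simple_function P (indicat_real E)" using E by (rule simple_function_indicator)
  have "simple_function P (\<lambda>\<omega>. indicat_real E \<omega> *\<^sub>R s \<omega>)"
    using simple_function_compose2[OF ind s] .
  then show int: ?integrable
    by (intro Bochner_Integration.simple_bochner_integrable.intros) auto
  \<comment> \<open>The value of \<open>s\<close> is paired with membership in \<open>E\<close>, so
    that the integrand is constant on the level sets of \<open>g\<close>. The sum is then extended
    to all pairs, the empty level sets contributing zero.\<close>
  define g where "g \<omega> = (\<omega> \<in> E, s \<omega>)" for \<omega>
  have g: "simple_function P g"
    using simple_function_compose2[OF ind s, of "\<lambda>a b. (a = 1, b)"] unfolding g_def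
    by (rule back_subst[of "simple_function P"]) (auto simp: indicator_def)
  have fin: "finite (s ` space P)" using s by (simp add: simple_function_def)
  have "Bochner_Integration.simple_bochner_integral P (\<lambda>\<omega>. indicat_real E \<omega> *\<^sub>R s \<omega>)
      = (\<Sum>y\<in>g ` space P. measure P {\<omega>\<in>space P. g \<omega> = y} *\<^sub>R (if fst y then snd y else 0))"
    by (rule simple_bochner_integral_partition[OF int g]) (auto simp: g_def indicator_def)
  also have "\<dots> = (\<Sum>y\<in>UNIV \<times> s ` space P. measure P {\<omega>\<in>space P. g \<omega> = y} *\<^sub>R (if fst y then snd y else 0))"
  proof (rule sum.mono_neutral_left)
    show "finite ((UNIV :: bool set) \<times> s ` space P)" using fin by simp
    show "g ` space P \<subseteq> UNIV \<times> s ` space P" by (auto simp: g_def)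
    show "\<forall>y\<in>UNIV \<times> s ` space P - g ` space P. measure P {\<omega>\<in>space P. g \<omega> = y} *\<^sub>R (if fst y then snd y else 0) = 0"
    proof
      fix y assume "y \<in> UNIV \<times> s ` space P - g ` space P"
      then have "{\<omega>\<in>space P. g \<omega> = y} = {}" by blast
      then show "measure P {\<omega>\<in>space P. g \<omega> = y} *\<^sub>R (if fst y then snd y else 0) = 0"
        by (simp only: measure_empty scaleR_zero_left)
    qed
  qed
  also have "\<dots> = (\<Sum>b\<in>UNIV. \<Sum>c\<in>s ` space P. measure P {\<omega>\<in>space P. g \<omega> = (b, c)} *\<^sub>R (if b then c else 0))"
    by (simp add: sum.cartesian_product case_prod_unfold)
  also have "\<dots> = (\<Sum>c\<in>s ` space P. measure P {\<omega>\<in>space P. g \<omega> = (True, c)} *\<^sub>R c)"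
    by (simp add: UNIV_bool)
  also have "\<dots> = (\<Sum>c\<in>s ` space P. measure P (E \<inter> {\<omega>\<in>space P. s \<omega> = c}) *\<^sub>R c)"
  proof -
    have "{\<omega>\<in>space P. g \<omega> = (True, c)} = E \<inter> {\<omega>\<in>space P. s \<omega> = c}" for c by (auto simp: g_def)
    then show ?thesis by simp
  qed
  finally show "Bochner_Integration.simple_bochner_integral P (\<lambda>\<omega>. indicat_real E \<omega> *\<^sub>R s \<omega>)
      = (\<Sum>c\<in>s ` space P. measure P (E \<inter> {\<omega>\<in>space P. s \<omega> = c}) *\<^sub>R c)" .
qed

text \<open>The simple function is L1-close to the Radon-Nikodym density. The error on each cell is
  at most the integral of the distance over that cell, and the cells of a generation are disjoint,
  so one \<open>s\<close> serves all generations.\<close>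

lemma density_approximation:
  assumes rnp: "radon_nikodym_property TYPE(real) TYPE('a)" and "0 < \<epsilon>"
  obtains s where "simple_function P s"
    and "\<And>n. (\<Sum>i<M n. norm (\<tau> (cell n i) -
      (\<Sum>c\<in>s ` space P. measure P (cell n i \<inter> {\<omega>\<in>space P. s \<omega> = c}) *\<^sub>R c))) \<le> \<epsilon>"
proof -
  have ball: "\<forall>E\<in>sets P. 0 < measure P E \<longrightarrow> \<tau> E /\<^sub>R measure P E \<in> cball 0 1"
    using norm_\<tau>_le by (auto simp: field_simps)
  have null: "\<forall>E\<in>sets P. measure P E = 0 \<longrightarrow> \<tau> E = 0"
    using norm_\<tau>_le by fastforce
  from rnp[unfolded radon_nikodym_property_def, THEN spec[of _ P], THEN spec[of _ \<tau>], THEN mp, OF prob_space_P,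
      THEN mp, OF \<tau>_countably_additive, THEN mp, OF null, THEN mp, OF ball]
  obtain h where h: "bochner_measurable P h"
    and hE: "\<And>E. E \<in> sets P \<Longrightarrow> bochner_integral_is P (\<lambda>\<omega>. indicat_real E \<omega> *\<^sub>R h \<omega>) (\<tau> E)"
    by (elim exE conjE) simp
  obtain t where t: "\<And>n. Bochner_Integration.simple_bochner_integrable P (t n)"
    and lim: "(\<lambda>n. \<integral>\<^sup>+\<omega>. ennreal (norm (indicat_real (space P) \<omega> *\<^sub>R h \<omega> - t n \<omega>)) \<partial>P) \<longlonglongrightarrow> 0"
    using hE[OF sets.top] by (auto simp: bochner_integral_is_def)
  have "\<forall>\<^sub>F n in sequentially. (\<integral>\<^sup>+\<omega>. ennreal (norm (indicat_real (space P) \<omega> *\<^sub>R h \<omega> - t n \<omega>)) \<partial>P) < ennreal \<epsilon>"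
    using \<open>0 < \<epsilon>\<close> by (intro order_tendstoD(2)[OF lim]) auto
  then obtain n where "(\<integral>\<^sup>+\<omega>. ennreal (norm (indicat_real (space P) \<omega> *\<^sub>R h \<omega> - t n \<omega>)) \<partial>P) < ennreal \<epsilon>"
    by (auto simp: eventually_sequentially)
  then have small: "(\<integral>\<^sup>+\<omega>. ennreal (norm (h \<omega> - t n \<omega>)) \<partial>P) < ennreal \<epsilon>"
    by (simp add: indicator_def cong: nn_integral_cong)
  define s where "s = t n"
  have s: "simple_function P s"
    using t[of n] by (auto simp: s_def elim: Bochner_Integration.simple_bochner_integrable.cases)
  define \<sigma> where "\<sigma> E = (\<Sum>c\<in>s ` space P. measure P (E \<inter> {\<omega>\<in>space P. s \<omega> = c}) *\<^sub>R c)" for E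
  obtain g where g: "g \<in> borel_measurable P" "AE \<omega> in P. norm (h \<omega> - s \<omega>) = g \<omega>" "\<And>\<omega>. 0 \<le> g \<omega>"
    using bochner_measurable_dist_AE[OF h s] by blast
  have dist: "ennreal (norm (\<tau> E - \<sigma> E)) \<le> (\<integral>\<^sup>+\<omega>. ennreal (g \<omega>) * indicator E \<omega> \<partial>P)" if E: "E \<in> sets P" for E
  proof -
    have "ennreal (norm (\<tau> E - \<sigma> E)) \<le> (\<integral>\<^sup>+\<omega>. ennreal (norm (indicat_real E \<omega> *\<^sub>R h \<omega> - indicat_real E \<omega> *\<^sub>R s \<omega>)) \<partial>P)"
      using bochner_integral_is_dist_le[OF hE[OF E] simple_bochner_integral_indicator(1)[OF s E]]
      by (simp add: \<sigma>_def simple_bochner_integral_indicator(2)[OF s E])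
    also have "\<dots> = (\<integral>\<^sup>+\<omega>. ennreal (g \<omega>) * indicator E \<omega> \<partial>P)"
      using g(2) by (intro nn_integral_cong_AE, eventually_elim) (auto simp: indicator_def)
    finally show ?thesis .
  qed
  have "(\<Sum>i<M m. norm (\<tau> (cell m i) - \<sigma> (cell m i))) \<le> \<epsilon>" for m
  proof -
    have "ennreal (\<Sum>i<M m. norm (\<tau> (cell m i) - \<sigma> (cell m i))) = (\<Sum>i<M m. ennreal (norm (\<tau> (cell m i) - \<sigma> (cell m i))))"
      by (intro sum_ennreal[symmetric]) auto
    also have "\<dots> \<le> (\<Sum>i<M m. \<integral>\<^sup>+\<omega>. ennreal (g \<omega>) * indicator (cell m i) \<omega> \<partial>P)"
      by (intro sum_mono dist) auto
    also have "\<dots> = (\<integral>\<^sup>+\<omega>. (\<Sum>i<M m. ennreal (g \<omega>) * indicator (cell m i) \<omega>) \<partial>P)"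
      using g(1) cell_sets
      by (intro nn_integral_sum[symmetric] borel_measurable_times_ennreal borel_measurable_indicator) auto
    also have "\<dots> \<le> (\<integral>\<^sup>+\<omega>. ennreal (g \<omega>) \<partial>P)"
    proof (intro nn_integral_mono)
      fix \<omega>
      have "(\<Sum>i<M m. ennreal (g \<omega>) * indicator (cell m i) \<omega>) \<le> (\<Sum>i<M m. if i = idx m \<omega> then ennreal (g \<omega>) else 0)"
        by (intro sum_mono) (auto simp: indicator_def cell_def)
      also have "\<dots> \<le> ennreal (g \<omega>)" by (simp add: sum.delta)
      finally show "(\<Sum>i<M m. ennreal (g \<omega>) * indicator (cell m i) \<omega>) \<le> ennreal (g \<omega>)" .
    qed
    also have "\<dots> = (\<integral>\<^sup>+\<omega>. ennreal (norm (h \<omega> - s \<omega>)) \<partial>P)"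
      using g(2) by (intro nn_integral_cong_AE) auto
    also have "\<dots> \<le> ennreal \<epsilon>" using small by (simp add: s_def less_imp_le)
    finally show ?thesis using \<open>0 < \<epsilon>\<close> by simp
  qed
  with s show ?thesis by (intro that) (auto simp: \<sigma>_def)
qed

text \<open>On a cell of its own generation \<open>T n\<close> equals \<open>X n i\<close> divided
  by \<open>M n\<close>, so separation forces the \<open>T\<close>-value of a child and the equal
  share of its parent's \<open>T\<close>-value apart by \<open>\<delta> / M (Suc n)\<close>, which
  sums to \<delta>. Each generation is within \<delta>/4 plus a vanishing tail of the integral
  \<sigma> of a simple function, and \<sigma> divides almost equally among the children because its
  finitely many level sets do. In the limit \<delta> would be at most \<delta>/2.\<close>

lemma rnp_not_separated:
  assumes rnp: "radon_nikodym_property TYPE(real) TYPE('a)" and \<delta>: "0 < \<delta>"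
  shows "\<exists>n. \<exists>k<M (Suc n). norm (X (Suc n) k - X n (k div N n)) < \<delta>"
proof (rule ccontr)
  assume "\<not> ?thesis"
  then have far: "\<And>n k. k < M (Suc n) \<Longrightarrow> \<delta> \<le> norm (X (Suc n) k - X n (k div N n))" by force
  obtain s where s: "simple_function P s"
    and close: "\<And>n. (\<Sum>i<M n. norm (\<tau> (cell n i) -
      (\<Sum>c\<in>s ` space P. measure P (cell n i \<inter> {\<omega>\<in>space P. s \<omega> = c}) *\<^sub>R c))) \<le> \<delta> / 4"
    using density_approximation[OF rnp, of "\<delta> / 4"] \<delta> by auto
  have fin: "finite (s ` space P)" using s by (simp add: simple_function_def)
  define S where "S c = {\<omega>\<in>space P. s \<omega> = c}" for c
  have S: "S c \<in> sets P" for c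
  proof -
    have "S c = s -` {c} \<inter> space P" by (auto simp: S_def)
    then show ?thesis using simple_functionD(2)[OF s] by simp
  qed
  define \<sigma> where "\<sigma> E = (\<Sum>c\<in>s ` space P. measure P (E \<inter> S c) *\<^sub>R c)" for E
  define tail where "tail n = suminf total_drift - (\<Sum>k<n. total_drift k)" for n
  define p where "p n i = norm (\<tau> (cell n i) - T n (cell n i)) + norm (\<tau> (cell n i) - \<sigma> (cell n i))" for n i
  have p_le: "(\<Sum>i<M n. p n i) \<le> tail n + \<delta> / 4" for n
    using \<tau>_near_T[of n] close[of n] by (simp add: p_def sum.distrib tail_def \<sigma>_def S_def)
  have T_cell: "T n (cell n i) = (1 / real (M n)) *\<^sub>R X n i" if "i < M n" for n i
  proof -
    have "cell n i \<inter> cell n k = (if k = i then cell n i else {})" for k by (auto simp: cell_def)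
    then have "T n (cell n i) = (\<Sum>k<M n. if k = i then measure P (cell n i) *\<^sub>R X n i else 0)"
      unfolding T_def by (intro sum.cong) auto
    then show ?thesis using that by (simp add: measure_cell)
  qed
  have \<sigma>_diff: "(\<Sum>k<M (Suc n). norm (\<sigma> (cell (Suc n) k) - (1 / real (N n)) *\<^sub>R \<sigma> (cell n (k div N n))))
      \<le> (\<Sum>c\<in>s ` space P. norm c * uneven n (S c))" for n
  proof -
    have "norm (\<sigma> (cell (Suc n) k) - (1 / real (N n)) *\<^sub>R \<sigma> (cell n (k div N n)))
        \<le> (\<Sum>c\<in>s ` space P. norm c * \<bar>measure P (S c \<inter> cell (Suc n) k) - measure P (S c \<inter> cell n (k div N n)) / N n\<bar>)" for k
    proof -
      have "\<sigma> (cell (Suc n) k) - (1 / real (N n)) *\<^sub>R \<sigma> (cell n (k div N n))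
        = (\<Sum>c\<in>s ` space P. (measure P (S c \<inter> cell (Suc n) k) - measure P (S c \<inter> cell n (k div N n)) / N n) *\<^sub>R c)"
        by (simp add: \<sigma>_def scaleR_sum_right sum_subtractf[symmetric] scaleR_diff_left Int_commute)
      then show ?thesis
        using norm_sum[of "\<lambda>c. (measure P (S c \<inter> cell (Suc n) k) - measure P (S c \<inter> cell n (k div N n)) / N n) *\<^sub>R c" "s ` space P"]
        by (simp add: mult.commute)
    qed
    then have "(\<Sum>k<M (Suc n). norm (\<sigma> (cell (Suc n) k) - (1 / real (N n)) *\<^sub>R \<sigma> (cell n (k div N n))))
      \<le> (\<Sum>k<M (Suc n). \<Sum>c\<in>s ` space P. norm c * \<bar>measure P (S c \<inter> cell (Suc n) k) - measure P (S c \<inter> cell n (k div N n)) / N n\<bar>)"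
      by (rule sum_mono)
    also have "\<dots> = (\<Sum>c\<in>s ` space P. norm c * uneven n (S c))"
      unfolding uneven_def sum_distrib_left by (rule sum.swap)
    finally show ?thesis .
  qed
  have main: "\<delta> \<le> (tail (Suc n) + \<delta> / 4) + (\<Sum>c\<in>s ` space P. norm c * uneven n (S c)) + (tail n + \<delta> / 4)" for n
  proof -
    have cellwise: "\<delta> / M (Suc n) \<le> p (Suc n) k + norm (\<sigma> (cell (Suc n) k) - (1 / real (N n)) *\<^sub>R \<sigma> (cell n (k div N n)))
       + p n (k div N n) / N n" if k: "k < M (Suc n)" for k
    proof -
      let ?i = "k div N n"
      have i: "?i < M n" using k by (simp add: MS less_mult_imp_div_less)
      define a where "a = T (Suc n) (cell (Suc n) k)"
      define b where "b = (1 / real (N n)) *\<^sub>R T n (cell n ?i)"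
      have "b = (1 / real (M (Suc n))) *\<^sub>R X n ?i"
        unfolding b_def T_cell[OF i] by (simp add: MS mult.commute)
      then have "a - b = (1 / real (M (Suc n))) *\<^sub>R (X (Suc n) k - X n ?i)"
        unfolding a_def T_cell[OF k] by (simp add: scaleR_diff_right)
      then have "\<delta> / M (Suc n) \<le> norm (a - b)"
        using far[OF k] by (simp add: divide_right_mono)
      have norm5: "norm (- v1 + (v2 + (v3 + (- v4 + v5)))) \<le> norm v1 + (norm v2 + (norm v3 + (norm v4 + norm v5)))"
        for v1 v2 v3 v4 v5 :: 'a
        using norm_triangle_ineq[of "- v1" "v2 + (v3 + (- v4 + v5))"] norm_triangle_ineq[of v2 "v3 + (- v4 + v5)"]
          norm_triangle_ineq[of v3 "- v4 + v5"] norm_triangle_ineq[of "- v4" v5] by simp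
      note \<open>\<delta> / M (Suc n) \<le> norm (a - b)\<close>
      \<comment> \<open>The path runs through \<open>T\<close>, \<open>\<tau>\<close> and
        \<open>\<sigma>\<close> on the child, then back through \<open>\<sigma>\<close>,
        \<open>\<tau>\<close> and \<open>T\<close> on the parent.\<close>
      also have "a - b = - (\<tau> (cell (Suc n) k) - a) + ((\<tau> (cell (Suc n) k) - \<sigma> (cell (Suc n) k))
          + ((\<sigma> (cell (Suc n) k) - (1 / real (N n)) *\<^sub>R \<sigma> (cell n ?i))
          + (- ((1 / real (N n)) *\<^sub>R (\<tau> (cell n ?i) - \<sigma> (cell n ?i)))
          + (1 / real (N n)) *\<^sub>R (\<tau> (cell n ?i) - T n (cell n ?i)))))"
        by (simp add: b_def scaleR_diff_right)
      also have "norm \<dots> \<le> norm (\<tau> (cell (Suc n) k) - a) + (norm (\<tau> (cell (Suc n) k) - \<sigma> (cell (Suc n) k))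
          + (norm (\<sigma> (cell (Suc n) k) - (1 / real (N n)) *\<^sub>R \<sigma> (cell n ?i))
          + (norm (\<tau> (cell n ?i) - \<sigma> (cell n ?i)) / N n
          + norm (\<tau> (cell n ?i) - T n (cell n ?i)) / N n)))"
        by (rule order_trans[OF norm5]) simp
      also have "\<dots> = p (Suc n) k + norm (\<sigma> (cell (Suc n) k) - (1 / real (N n)) *\<^sub>R \<sigma> (cell n ?i)) + p n ?i / N n"
        by (simp add: p_def a_def add_divide_distrib)
      finally show ?thesis .
    qed
    have "\<delta> = (\<Sum>k<M (Suc n). \<delta> / M (Suc n))" using Mpos[of "Suc n"] by simp
    also have "\<dots> \<le> (\<Sum>k<M (Suc n). p (Suc n) k + norm (\<sigma> (cell (Suc n) k) - (1 / real (N n)) *\<^sub>R \<sigma> (cell n (k div N n)))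
       + p n (k div N n) / N n)"
      by (intro sum_mono cellwise) simp
    also have "\<dots> = (\<Sum>k<M (Suc n). p (Suc n) k) + (\<Sum>k<M (Suc n). norm (\<sigma> (cell (Suc n) k) - (1 / real (N n)) *\<^sub>R \<sigma> (cell n (k div N n))))
       + (\<Sum>k<M (Suc n). p n (k div N n) / N n)"
      by (simp only: sum.distrib)
    also have "(\<Sum>k<M (Suc n). p n (k div N n) / N n) = (\<Sum>i<M n. p n i)"
      unfolding MS by (rule sum_lessThan_mult_div[OF Npos])
    finally show ?thesis using p_le[of n] p_le[of "Suc n"] \<sigma>_diff[of n] by linarith
  qed
  have tail: "tail \<longlonglongrightarrow> 0"
    unfolding tail_def using tendsto_diff[OF tendsto_const[of "suminf total_drift"] summable_LIMSEQ[OF summable_total_drift]] by simp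
  have "(\<lambda>n. (tail (Suc n) + \<delta> / 4) + (\<Sum>c\<in>s ` space P. norm c * uneven n (S c)) + (tail n + \<delta> / 4))
      \<longlonglongrightarrow> (0 + \<delta> / 4) + (\<Sum>c\<in>s ` space P. norm c * 0) + (0 + \<delta> / 4)"
    by (intro tendsto_intros tail LIMSEQ_Suc[OF tail] uneven_tendsto_0 S)
  then have "\<delta> \<le> (0 + \<delta> / 4) + (\<Sum>c\<in>s ` space P. norm c * 0) + (0 + \<delta> / 4)"
    using main by (intro LIMSEQ_le_const) auto
  then show False using \<delta> by simp
qed

end

section \<open>Perturbation by small functionals\<close>

definition has_slice :: "('a::real_normed_vector \<Rightarrow> real) \<Rightarrow> 'a set \<Rightarrow> real \<Rightarrow> bool" where
  "has_slice f D \<delta> \<longleftrightarrow> (\<exists>c a. (\<exists>x\<in>D. a < f x) \<and> (\<forall>x\<in>D. a < f x \<longrightarrow> dist c x < \<delta>))"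

text \<open>The points provided by \<open>spread\<close> exist for all large \<open>N\<close>, hence
  a common \<open>N\<close> works for the finitely many nodes of the generation. The loss
  \<open>\<epsilon>\<close> occurs at every node and is again \<open>\<epsilon>\<close> in the
  mean.\<close>

lemma refine_nodes:
  fixes \<Phi> :: "'a::real_normed_vector \<Rightarrow> real"
  assumes spread: "\<And>x \<epsilon>. 0 < \<epsilon> \<Longrightarrow> \<forall>\<^sub>F N in sequentially. \<exists>y. (\<forall>j. y j \<in> D \<and> \<delta> \<le> dist x (y j)) \<and>
      \<Phi> x - \<epsilon> + \<eta> * norm ((1 / real N) *\<^sub>R (\<Sum>j<N. y j) - x) \<le> (1 / real N) * (\<Sum>j<N. \<Phi> (y j))"
    and X: "\<And>i. X i \<in> D" and "0 < M" "0 < \<epsilon>"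
  shows "\<exists>N X'. 0 < N \<and> (\<forall>k. X' k \<in> D) \<and> (\<forall>k<M * N. \<delta> \<le> norm (X' k - X (k div N))) \<and>
    (\<Sum>i<M. \<Phi> (X i)) / M - \<epsilon> + \<eta> * (1 / real M * (\<Sum>i<M. norm ((1 / real N) *\<^sub>R (\<Sum>j<N. X' (i * N + j)) - X i)))
      \<le> (\<Sum>k<M * N. \<Phi> (X' k)) / (M * N)"
proof -
  define good where "good i N y \<longleftrightarrow> (\<forall>j. y j \<in> D \<and> \<delta> \<le> dist (X i) (y j)) \<and>
      \<Phi> (X i) - \<epsilon> + \<eta> * norm ((1 / real N) *\<^sub>R (\<Sum>j<N. y j) - X i) \<le> (1 / real N) * (\<Sum>j<N. \<Phi> (y j))" for i N y
  have "\<forall>\<^sub>F N in sequentially. \<forall>i\<in>{..<M}. \<exists>y. good i N y"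
    using spread[OF \<open>0 < \<epsilon>\<close>] by (intro eventually_ball_finite) (auto simp: good_def)
  from eventually_conj[OF this eventually_gt_at_top[of 0]]
  obtain N where N: "0 < N" "\<forall>i\<in>{..<M}. \<exists>y. good i N y"
    by (auto simp: eventually_sequentially)
  then obtain y where y: "\<And>i. i < M \<Longrightarrow> good i N (y i)"
    using bchoice[of "{..<M}" "\<lambda>i y. good i N y"] by auto
  \<comment> \<open>Indices outside the generation get the filler value \<open>X 0\<close>, so that
    all values lie in \<open>D\<close>.\<close>
  define X' where "X' k = (if k div N < M then y (k div N) (k mod N) else X 0)" for k
  have X'y: "X' (i * N + j) = y i j" if "i < M" "j < N" for i j
    using that by (simp add: X'_def)
  have "(\<Sum>i<M. \<Phi> (X i) - \<epsilon> + \<eta> * norm ((1 / real N) *\<^sub>R (\<Sum>j<N. y i j) - X i))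
      \<le> (\<Sum>i<M. (1 / real N) * (\<Sum>j<N. \<Phi> (y i j)))"
    using y by (intro sum_mono) (auto simp: good_def)
  then have "(1 / real M) * (\<Sum>i<M. \<Phi> (X i) - \<epsilon> + \<eta> * norm ((1 / real N) *\<^sub>R (\<Sum>j<N. y i j) - X i))
      \<le> (1 / real M) * (\<Sum>i<M. (1 / real N) * (\<Sum>j<N. \<Phi> (y i j)))"
    by (intro mult_left_mono) auto
  moreover have "(1 / real M) * (\<Sum>i<M. \<Phi> (X i) - \<epsilon> + \<eta> * norm ((1 / real N) *\<^sub>R (\<Sum>j<N. y i j) - X i))
      = (\<Sum>i<M. \<Phi> (X i)) / M - \<epsilon> + \<eta> * (1 / real M * (\<Sum>i<M. norm ((1 / real N) *\<^sub>R (\<Sum>j<N. y i j) - X i)))"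
    using \<open>0 < M\<close> by (simp add: sum.distrib sum_subtractf sum_distrib_left[symmetric] field_simps)
  moreover have "(1 / real M) * (\<Sum>i<M. (1 / real N) * (\<Sum>j<N. \<Phi> (y i j))) = (\<Sum>k<M * N. \<Phi> (X' k)) / (M * N)"
    unfolding sum_lessThan_mult by (simp add: X'y sum_divide_distrib mult.commute cong: sum.cong_simp)
  moreover have "(\<Sum>i<M. norm ((1 / real N) *\<^sub>R (\<Sum>j<N. y i j) - X i))
      = (\<Sum>i<M. norm ((1 / real N) *\<^sub>R (\<Sum>j<N. X' (i * N + j)) - X i))"
    by (simp add: X'y cong: sum.cong_simp)
  moreover have "X' k \<in> D" for k using y X by (auto simp: X'_def good_def)
  moreover have "\<delta> \<le> norm (X' k - X (k div N))" if "k < M * N" for k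
    using y[of "k div N"] that by (simp add: X'_def good_def less_mult_imp_div_less dist_norm norm_minus_commute)
  ultimately show ?thesis using N(1) by (intro exI[of _ N] exI[of _ X']) auto
qed

text \<open>If every slice were large, \<open>refine_nodes\<close> would produce a separated quasi-martingale. Its drift is
  summable since \<open>\<eta>\<close> times the drift is paid for by the growth of the mean of the bounded function \<open>\<Phi>\<close>.\<close>

lemma exists_small_slice:
  fixes \<psi> :: "'a::banach \<Rightarrow> real"
  assumes rnp: "radon_nikodym_property TYPE(real) TYPE('a)"
    and D: "D \<subseteq> cball 0 1" "D \<noteq> {}" and K: "\<And>x. x \<in> D \<Longrightarrow> \<psi> x \<le> K" and \<eta>: "0 < \<eta>" and \<delta>: "0 < \<delta>"
  shows "\<exists>L :: 'a \<Rightarrow>\<^sub>L real. norm L \<le> \<eta> \<and> has_slice (\<lambda>x. \<psi> x + blinfun_apply L x) D \<delta>"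
proof (rule ccontr)
  assume "\<not> ?thesis"
  then have neg: "\<exists>x\<in>D. a < \<psi> x + blinfun_apply L x \<and> \<delta> \<le> dist c x"
    if "norm L \<le> \<eta>" "\<exists>x\<in>D. a < \<psi> x + blinfun_apply L x" for L :: "'a \<Rightarrow>\<^sub>L real" and c a
    using that unfolding has_slice_def by (metis linorder_not_less)
  obtain \<Phi> where \<Phi>K: "\<And>x. \<Phi> x \<le> K"
    and spread: "\<And>x \<epsilon>. 0 < \<epsilon> \<Longrightarrow> \<forall>\<^sub>F N in sequentially. \<exists>y. (\<forall>j. y j \<in> D \<and> \<delta> \<le> dist x (y j)) \<and>
      \<Phi> x - \<epsilon> + \<eta> * norm ((1 / real N) *\<^sub>R (\<Sum>j<N. y j) - x) \<le> (1 / real N) * (\<Sum>j<N. \<Phi> (y j))"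
    using no_small_slice_spread[OF D(2) K \<eta> neg] by blast
  \<comment> \<open>The tree has a single root, as \<open>interval_partitions\<close> demands
    \<open>M 0 = 1\<close>.\<close>
  define inv where "inv = (\<lambda>(n :: nat) (M :: nat, X :: nat \<Rightarrow> 'a). (n = 0 \<longrightarrow> M = 1) \<and> 0 < M \<and> (\<forall>i. X i \<in> D))"
  define refines where "refines = (\<lambda>(n :: nat) (M :: nat, X :: nat \<Rightarrow> 'a) (M', X'). \<exists>N. 0 < N \<and> M' = M * N \<and>
    (\<forall>k<M * N. \<delta> \<le> norm (X' k - X (k div N))) \<and>
    (\<Sum>i<M. \<Phi> (X i)) / M - (1 / 2) ^ n + \<eta> * (1 / real M * (\<Sum>i<M. norm ((1 / real N) *\<^sub>R (\<Sum>j<N. X' (i * N + j)) - X i)))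
      \<le> (\<Sum>k<M'. \<Phi> (X' k)) / M')"
  have "\<exists>f. \<forall>n. inv n (f n) \<and> refines n (f n) (f (Suc n))"
  proof (rule dependent_nat_choice)
    obtain x where "x \<in> D" using D by auto
    then show "\<exists>s. inv 0 s" by (intro exI[of _ "(1, \<lambda>_. x)"]) (simp add: inv_def)
  next
    fix s n assume "inv n s"
    then obtain M X where s: "s = (M, X)" "0 < M" "\<And>i. X i \<in> D" by (cases s) (auto simp: inv_def)
    from refine_nodes[where X = X and \<epsilon> = "(1 / 2) ^ n", OF spread s(3,2)]
    obtain N X' where N: "0 < N" "\<forall>k. X' k \<in> D" "\<forall>k<M * N. \<delta> \<le> norm (X' k - X (k div N))"
      "(\<Sum>i<M. \<Phi> (X i)) / M - (1 / 2) ^ n + \<eta> * (1 / real M * (\<Sum>i<M. norm ((1 / real N) *\<^sub>R (\<Sum>j<N. X' (i * N + j)) - X i)))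
        \<le> (\<Sum>k<M * N. \<Phi> (X' k)) / (M * N)" by auto
    then have "inv (Suc n) (M * N, X') \<and> refines n s (M * N, X')"
      using s(2) by (auto simp: inv_def refines_def s(1) intro!: exI[of _ N])
    then show "\<exists>s'. inv (Suc n) s' \<and> refines n s s'" by blast
  qed
  then obtain f where f: "\<And>n. inv n (f n)" "\<And>n. refines n (f n) (f (Suc n))" by blast
  define M where "M n = fst (f n)" for n
  define X where "X n = snd (f n)" for n
  have fMX: "f n = (M n, X n)" for n by (simp add: M_def X_def)
  have M0: "M 0 = 1" and Mpos: "0 < M n" and XD: "X n i \<in> D" for n i
    using f(1)[of 0] f(1)[of n] by (auto simp: inv_def fMX)
  define A where "A n = (\<Sum>i<M n. \<Phi> (X n i)) / M n" for n
  have "\<exists>N. \<forall>n. 0 < N n \<and> M (Suc n) = M n * N n \<and>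
    (\<forall>k<M n * N n. \<delta> \<le> norm (X (Suc n) k - X n (k div N n))) \<and>
    A n - (1 / 2) ^ n + \<eta> * (1 / real (M n) * (\<Sum>i<M n. norm ((1 / real (N n)) *\<^sub>R (\<Sum>j<N n. X (Suc n) (i * N n + j)) - X n i)))
      \<le> A (Suc n)"
    using f(2) by (intro choice) (auto simp: refines_def fMX A_def)
  then obtain N where N: "\<And>n. 0 < N n" "\<And>n. M (Suc n) = M n * N n"
    "\<And>n k. k < M n * N n \<Longrightarrow> \<delta> \<le> norm (X (Suc n) k - X n (k div N n))"
    and step: "\<And>n. A n - (1 / 2) ^ n + \<eta> * (1 / real (M n) * (\<Sum>i<M n. norm ((1 / real (N n)) *\<^sub>R (\<Sum>j<N n. X (Suc n) (i * N n + j)) - X n i)))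
      \<le> A (Suc n)" by blast
  define a where "a n = 1 / real (M n) * (\<Sum>i<M n. norm ((1 / real (N n)) *\<^sub>R (\<Sum>j<N n. X (Suc n) (i * N n + j)) - X n i))" for n
  have AK: "A n \<le> K" for n
  proof -
    have "(\<Sum>i<M n. \<Phi> (X n i)) \<le> (\<Sum>i<M n. K)" by (intro sum_mono \<Phi>K)
    then show ?thesis using Mpos[of n] by (simp add: A_def field_simps)
  qed
  have "summable a"
  proof (rule summableI_nonneg_bounded)
    show "0 \<le> a n" for n by (simp add: a_def sum_nonneg)
    fix m
    \<comment> \<open>The inequalities \<open>step\<close> telescope, and the losses
      \<open>(1 / 2) ^ n\<close> add up to at most 2.\<close>
    have "\<eta> * (\<Sum>n<m. a n) \<le> A m - A 0 + (\<Sum>n<m. (1 / 2) ^ n)"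
    proof (induction m)
      case (Suc m)
      have "A m - (1 / 2) ^ m + \<eta> * a m \<le> A (Suc m)" using step[of m] by (simp only: a_def)
      with Suc show ?case by (simp add: distrib_left)
    qed simp
    also have "(\<Sum>n<m. (1 / 2) ^ n :: real) \<le> (\<Sum>n. (1 / 2) ^ n)"
      by (intro sum_le_suminf) auto
    also have "\<dots> = (2 :: real)" by (simp add: suminf_geometric)
    finally show "(\<Sum>n<m. a n) \<le> (K - A 0 + 2) / \<eta>"
      using AK[of m] \<eta> by (simp add: field_simps)
  qed
  then interpret quasi_martingale M N X
    using M0 N XD D(1) by unfold_locales (auto simp: a_def[abs_def] subset_iff)
  show False
    using rnp_not_separated[OF rnp \<delta>] N(2,3) by (metis linorder_not_less)
qed

lemma Baire_dense_open:
  fixes U :: "nat \<Rightarrow> 'a::complete_space set"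
  assumes "\<And>n. open (U n)" "\<And>n. closure (U n) = UNIV"
  shows "closure (\<Inter>n. U n) = UNIV"
proof -
  have "Met_TC.mtopology closure_of \<Inter> (range U) = (UNIV :: 'a set)"
    using assms by (intro Met_TC.metric_Baire_category) (auto simp: complete_UNIV)
  then show ?thesis by simp
qed

text \<open>Stegall's variational principle.\<close>

theorem exists_all_small_slices:
  fixes \<psi> :: "'a::banach \<Rightarrow> real"
  assumes rnp: "radon_nikodym_property TYPE(real) TYPE('a)"
    and D: "D \<subseteq> cball 0 1" "D \<noteq> {}" and K: "\<And>x. x \<in> D \<Longrightarrow> \<psi> x \<le> K" and \<eta>: "0 < \<eta>"
  shows "\<exists>L :: 'a \<Rightarrow>\<^sub>L real. norm L < \<eta> \<and> (\<forall>\<delta>>0. has_slice (\<lambda>x. \<psi> x + blinfun_apply L x) D \<delta>)"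
proof -
  define U where "U n = {L :: 'a \<Rightarrow>\<^sub>L real. has_slice (\<lambda>x. \<psi> x + blinfun_apply L x) D (1 / real (Suc n))}" for n
  have L_le: "\<bar>blinfun_apply L x\<bar> \<le> norm L" if "x \<in> D" for L :: "'a \<Rightarrow>\<^sub>L real" and x
  proof -
    have "norm x \<le> 1" using that D(1) by auto
    then show ?thesis
      using norm_blinfun[of L x] mult_left_mono[of "norm x" 1 "norm L"] by simp
  qed
  have "open (U n)" for n
  proof (rule openI)
    fix L assume "L \<in> U n"
    then obtain c a x0 where x0: "x0 \<in> D" "a < \<psi> x0 + blinfun_apply L x0"
      and sl: "\<And>x. x \<in> D \<Longrightarrow> a < \<psi> x + blinfun_apply L x \<Longrightarrow> dist c x < 1 / real (Suc n)"
      by (auto simp: U_def has_slice_def)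
    \<comment> \<open>Half the height of \<open>x0\<close> above the level: within distance
      \<open>e\<close> of \<open>L\<close>, the values on \<open>D\<close> move by less than
      \<open>e\<close>, so the slice at the raised level \<open>a + e\<close> still contains
      \<open>x0\<close> and lies in the old slice.\<close>
    define e where "e = (\<psi> x0 + blinfun_apply L x0 - a) / 2"
    have "L' \<in> U n" if "L' \<in> ball L e" for L'
    proof -
      have diff: "\<bar>blinfun_apply L' x - blinfun_apply L x\<bar> < e" if "x \<in> D" for x
        using L_le[OF that, of "L' - L"] \<open>L' \<in> ball L e\<close>
        by (simp add: dist_norm norm_minus_commute blinfun.diff_left)
      have "2 * e = \<psi> x0 + blinfun_apply L x0 - a" by (simp add: e_def)
      then have "a + e < \<psi> x0 + blinfun_apply L' x0"
        using diff[OF x0(1)] unfolding abs_less_iff by linarith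
      moreover have "dist c x < 1 / real (Suc n)" if "x \<in> D" "a + e < \<psi> x + blinfun_apply L' x" for x
        using diff[OF that(1)] that(2) by (intro sl[OF that(1)]) (simp add: abs_less_iff)
      ultimately show ?thesis using x0(1) by (auto simp: U_def has_slice_def)
    qed
    moreover have "0 < e" using x0 by (simp add: e_def)
    ultimately show "\<exists>e>0. ball L e \<subseteq> U n" by blast
  qed
  moreover have "closure (U n) = UNIV" for n
  proof -
    have "L \<in> closure (U n)" for L
      unfolding closure_approachable
    proof (intro allI impI)
      fix e :: real assume "0 < e"
      \<comment> \<open>The perturbed function is again bounded above on \<open>D\<close>, so a
        further functional of norm at most \<open>e / 2\<close> gives it a small slice.\<close>
      have "\<psi> x + blinfun_apply L x \<le> K + norm L" if "x \<in> D" for x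
        using K[OF that] L_le[OF that, of L] by (simp add: abs_le_iff)
      from exists_small_slice[where \<psi> = "\<lambda>x. \<psi> x + blinfun_apply L x" and \<eta> = "e / 2" and \<delta> = "1 / real (Suc n)", OF rnp D this] \<open>0 < e\<close>
      obtain L' :: "'a \<Rightarrow>\<^sub>L real" where "norm L' \<le> e / 2"
        "has_slice (\<lambda>x. \<psi> x + blinfun_apply L x + blinfun_apply L' x) D (1 / real (Suc n))" by auto
      then have "L + L' \<in> U n" "dist (L + L') L < e"
        using \<open>0 < e\<close> by (simp_all add: U_def blinfun.add_left add.assoc dist_norm)
      then show "\<exists>y\<in>U n. dist y L < e" by blast
    qed
    then show ?thesis by blast
  qed
  ultimately have "closure (\<Inter>n. U n) = UNIV" by (rule Baire_dense_open)
  then have "0 \<in> closure (\<Inter>n. U n)" by simp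
  then obtain L where "L \<in> (\<Inter>n. U n)" "dist L 0 < \<eta>"
    using \<eta> unfolding closure_approachable by blast
  then have L: "\<And>n. L \<in> U n" "norm L < \<eta>" by auto
  have "has_slice (\<lambda>x. \<psi> x + blinfun_apply L x) D \<delta>" if "0 < \<delta>" for \<delta>
  proof -
    obtain n where n: "inverse (real (Suc n)) < \<delta>" using reals_Archimedean[OF \<open>0 < \<delta>\<close>] by blast
    then have "1 / real (Suc n) < \<delta>" by (simp add: inverse_eq_divide)
    then show ?thesis using L(1)[of n] unfolding U_def has_slice_def by (blast intro: less_trans)
  qed
  with L(2) show ?thesis by blast
qed

section \<open>The function spaces\<close>

lemma scaleC_one [simp]: "(1 :: complex) *\<^sub>C x = x"
  using scaleC_of_real[of 1 x] by simp

lemma scaleC_zero_left [simp]: "(0 :: complex) *\<^sub>C x = 0"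
  using scaleC_of_real[of 0 x] by simp

lemma scaleC_zero_right [simp]: "c *\<^sub>C (0 :: 'a::complex_normed_vector) = 0"
  using scaleC_add_right[of c 0 "0 :: 'a"] by simp

lemma scaleC_diff_left: "(c - d) *\<^sub>C (x :: 'a::complex_normed_vector) = c *\<^sub>C x - d *\<^sub>C x"
  using scaleC_add_left[of "c - d" d x] by (simp add: algebra_simps)

lemma bounded_bilinear_scaleC: "bounded_bilinear ((*\<^sub>C) :: complex \<Rightarrow> 'a::complex_normed_vector \<Rightarrow> 'a)"
proof
  fix r :: real and c :: complex and x :: 'a
  show "(r *\<^sub>R c) *\<^sub>C x = r *\<^sub>R (c *\<^sub>C x)"
    by (simp add: scaleR_conv_of_real scaleC_scaleC[symmetric] scaleC_of_real)
  show "c *\<^sub>C (r *\<^sub>R x) = r *\<^sub>R (c *\<^sub>C x)"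
    by (simp add: scaleC_of_real[symmetric] scaleC_scaleC mult.commute)
  show "\<exists>K. \<forall>c (x :: 'a). norm (c *\<^sub>C x) \<le> cmod c * norm x * K"
    by (intro exI[of _ 1]) (simp add: norm_scaleC)
qed (simp_all add: scaleC_add_left scaleC_add_right)

lemma uniformly_continuous_on_mono:
  fixes f :: "'a::metric_space \<Rightarrow> 'b::metric_space"
  shows "uniformly_continuous_on T f \<Longrightarrow> S \<subseteq> T \<Longrightarrow> uniformly_continuous_on S f"
  unfolding uniformly_continuous_on_def by (meson subsetD)

lemma bounded_bilinear_uniformly_continuous_on:
  fixes B :: "'b::real_normed_vector \<Rightarrow> 'c::real_normed_vector \<Rightarrow> 'd::real_normed_vector"
    and f :: "'a::metric_space \<Rightarrow> 'b"
  assumes "bounded_bilinear B" and f: "uniformly_continuous_on S f" "bounded (f ` S)"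
    and g: "uniformly_continuous_on S g" "bounded (g ` S)"
  shows "uniformly_continuous_on S (\<lambda>x. B (f x) (g x))"
proof -
  interpret bounded_bilinear B by fact
  obtain K where K: "0 \<le> K" "\<And>a b. norm (B a b) \<le> norm a * norm b * K"
    using nonneg_bounded by blast
  obtain F where F: "\<And>x. x \<in> S \<Longrightarrow> norm (f x) \<le> F" using f(2) by (auto simp: bounded_iff)
  obtain G where G: "\<And>x. x \<in> S \<Longrightarrow> norm (g x) \<le> G" using g(2) by (auto simp: bounded_iff)
  show ?thesis
    unfolding uniformly_continuous_on_sequentially
  proof (intro allI impI)
    fix x y assume xy: "(\<forall>n. x n \<in> S) \<and> (\<forall>n. y n \<in> S) \<and> (\<lambda>n. dist (x n) (y n)) \<longlonglongrightarrow> 0"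
    then have lf: "(\<lambda>n. dist (f (x n)) (f (y n))) \<longlonglongrightarrow> 0" and lg: "(\<lambda>n. dist (g (x n)) (g (y n))) \<longlonglongrightarrow> 0"
      using f(1) g(1) unfolding uniformly_continuous_on_sequentially by blast+
    show "(\<lambda>n. dist (B (f (x n)) (g (x n))) (B (f (y n)) (g (y n)))) \<longlonglongrightarrow> 0"
    proof (rule Lim_null_comparison)
      have "(\<lambda>n. dist (f (x n)) (f (y n)) * G * K + F * dist (g (x n)) (g (y n)) * K) \<longlonglongrightarrow> 0 * G * K + F * 0 * K"
        by (intro tendsto_intros lf lg)
      then show "(\<lambda>n. dist (f (x n)) (f (y n)) * G * K + F * dist (g (x n)) (g (y n)) * K) \<longlonglongrightarrow> 0" by simp
      show "\<forall>\<^sub>F n in sequentially. norm (dist (B (f (x n)) (g (x n))) (B (f (y n)) (g (y n))))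
          \<le> dist (f (x n)) (f (y n)) * G * K + F * dist (g (x n)) (g (y n)) * K"
      proof (intro always_eventually allI)
        fix n
        have "B (f (x n)) (g (x n)) - B (f (y n)) (g (y n))
          = B (f (x n) - f (y n)) (g (x n)) + B (f (y n)) (g (x n) - g (y n))"
          by (simp add: diff_left diff_right)
        then have "dist (B (f (x n)) (g (x n))) (B (f (y n)) (g (y n)))
          \<le> norm (B (f (x n) - f (y n)) (g (x n))) + norm (B (f (y n)) (g (x n) - g (y n)))"
          by (simp add: dist_norm norm_triangle_ineq)
        also have "\<dots> \<le> dist (f (x n)) (f (y n)) * G * K + F * dist (g (x n)) (g (y n)) * K"
        proof (rule add_mono)
          have "norm (B (f (x n) - f (y n)) (g (x n))) \<le> norm (f (x n) - f (y n)) * norm (g (x n)) * K"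
            by (rule K(2))
          also have "\<dots> \<le> norm (f (x n) - f (y n)) * G * K"
            using G xy K(1) by (intro mult_right_mono mult_left_mono) auto
          finally show "norm (B (f (x n) - f (y n)) (g (x n))) \<le> dist (f (x n)) (f (y n)) * G * K"
            by (simp add: dist_norm)
          have "norm (B (f (y n)) (g (x n) - g (y n))) \<le> norm (f (y n)) * norm (g (x n) - g (y n)) * K"
            by (rule K(2))
          also have "\<dots> \<le> F * norm (g (x n) - g (y n)) * K"
            using F xy K(1) by (intro mult_right_mono) auto
          finally show "norm (B (f (y n)) (g (x n) - g (y n))) \<le> F * dist (g (x n)) (g (y n)) * K"
            by (simp add: dist_norm)
        qed
        finally show "norm (dist (B (f (x n)) (g (x n))) (B (f (y n)) (g (y n))))
          \<le> dist (f (x n)) (f (y n)) * G * K + F * dist (g (x n)) (g (y n)) * K" by simp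
      qed
    qed
  qed
qed

subsection \<open>Complex-linear maps\<close>

text \<open>The unique complex-linear functional with real part \<open>L\<close>.\<close>

definition complex_functional :: "('x::complex_normed_vector \<Rightarrow>\<^sub>L real) \<Rightarrow> 'x \<Rightarrow> complex" where
  "complex_functional L x = Complex (blinfun_apply L x) (- blinfun_apply L (\<i> *\<^sub>C x))"

lemma Re_complex_functional [simp]: "Re (complex_functional L x) = blinfun_apply L x"
  by (simp add: complex_functional_def)

lemma complex_functional_add: "complex_functional L (x + y) = complex_functional L x + complex_functional L y"
  by (simp add: complex_functional_def complex_eq_iff blinfun.add_right scaleC_add_right)

lemma complex_functional_scaleC: "complex_functional L (c *\<^sub>C x) = c * complex_functional L x"
proof -
  have eq: "d *\<^sub>C y = Re d *\<^sub>R y + Im d *\<^sub>R (\<i> *\<^sub>C y)" for d and y :: 'a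
  proof -
    have "d = of_real (Re d) + of_real (Im d) * \<i>" by (simp add: complex_eq_iff)
    then have "d *\<^sub>C y = (of_real (Re d) + of_real (Im d) * \<i>) *\<^sub>C y" by simp
    then show ?thesis by (simp only: scaleC_add_left scaleC_scaleC[symmetric] scaleC_of_real)
  qed
  have "blinfun_apply L (c *\<^sub>C x) = Re c * blinfun_apply L x + Im c * blinfun_apply L (\<i> *\<^sub>C x)"
    by (subst eq) (simp add: blinfun.add_right blinfun.scaleR_right)
  moreover have "blinfun_apply L (\<i> *\<^sub>C c *\<^sub>C x) = - Im c * blinfun_apply L x + Re c * blinfun_apply L (\<i> *\<^sub>C x)"
    unfolding scaleC_scaleC by (subst eq) (simp add: blinfun.add_right blinfun.diff_right blinfun.scaleR_right blinfun.minus_right)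
  ultimately show ?thesis by (simp add: complex_functional_def complex_eq_iff algebra_simps)
qed

text \<open>Rotating \<open>x\<close> by a unimodular scalar makes the value real and nonnegative,
  and then \<open>L\<close> sees all of it.\<close>

lemma norm_complex_functional_le: "norm (complex_functional L x) \<le> norm L * norm x"
proof (cases "complex_functional L x = 0")
  case False
  define z where "z = complex_functional L x"
  define u where "u = cnj z / of_real (cmod z)"
  have z: "z \<noteq> 0" using False by (simp add: z_def)
  have u: "cmod u = 1" using z by (simp add: u_def norm_divide)
  have "u * z = (z * cnj z) / of_real (cmod z)" by (simp add: u_def)
  also have "\<dots> = of_real (cmod z)"
    unfolding complex_norm_square[symmetric] using z by (simp add: power2_eq_square)
  finally have "u * z = of_real (cmod z)" .
  then have "cmod z = Re (complex_functional L (u *\<^sub>C x))"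
    unfolding complex_functional_scaleC z_def[symmetric] by simp
  also have "\<dots> \<le> norm L * norm (u *\<^sub>C x)"
    using norm_blinfun[of L "u *\<^sub>C x"] by simp
  finally show ?thesis using u by (simp add: z_def norm_scaleC)
qed simp

lemma bounded_linear_complex_functional: "bounded_linear (complex_functional L)"
proof
  show "complex_functional L (r *\<^sub>R x) = r *\<^sub>R complex_functional L x" for r x
    using complex_functional_scaleC[of L "of_real r" x] by (simp add: scaleC_of_real scaleR_conv_of_real)
  show "\<exists>K. \<forall>x. norm (complex_functional L x) \<le> norm x * K"
    using norm_complex_functional_le[of L] by (intro exI[of _ "norm L"]) (simp add: mult.commute)
qed (rule complex_functional_add)

text \<open>The supporting functional of the one-point set \<open>{(y, norm y)}\<close> satisfies
  \<open>norm y + L y \<le> 0\<close>, so \<open>- L\<close> is the one wanted; a complex number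
  whose real part equals its modulus is real.\<close>

lemma exists_norming_functional:
  fixes y :: "'y::complex_normed_vector"
  shows "\<exists>L :: 'y \<Rightarrow>\<^sub>L real. norm L \<le> 1 \<and> complex_functional L y = of_real (norm y)"
proof -
  obtain L :: "'y \<Rightarrow>\<^sub>L real" where L: "norm L \<le> 1" "norm y + blinfun_apply L y \<le> 0"
    using support_functional[of "{(y, norm y)}" 1 0 0] by auto
  define z where "z = complex_functional (- L) y"
  have "cmod z \<le> norm y"
    using norm_complex_functional_le[of "- L" y] mult_right_mono[OF L(1) norm_ge_zero[of y]] by (simp add: z_def)
  moreover have "norm y \<le> Re z" using L(2) by (simp add: z_def blinfun.minus_left)
  ultimately have "Re z = cmod z" "cmod z = norm y" using complex_Re_le_cmod[of z] by linarith+
  then have "z = of_real (norm y)"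
    using cmod_power2[of z] by (simp add: complex_eq_iff)
  then show ?thesis using L(1) by (intro exI[of _ "- L"]) (simp add: z_def)
qed

subsection \<open>Closure properties\<close>

lemma interior_unit_cball: "interior (cball 0 1) = ball (0 :: 'a::real_normed_vector) 1"
proof
  show "ball 0 1 \<subseteq> interior (cball (0 :: 'a) 1)" by (intro interior_maximal) auto
  show "interior (cball (0 :: 'a) 1) \<subseteq> ball 0 1"
  proof
    fix x :: 'a assume "x \<in> interior (cball 0 1)"
    then obtain e where e: "0 < e" "ball x e \<subseteq> cball 0 1" by (auto simp: mem_interior)
    \<comment> \<open>Pushes \<open>x\<close> outwards within the ball of radius \<open>e\<close>.
      For \<open>x = 0\<close> nothing moves, but \<open>x\<close> lies in the open ball
      anyway.\<close>
    define y where "y = x + (e / 2) *\<^sub>R sgn x"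
    have "dist x y = (e / 2) * norm (sgn x)" using e(1) by (simp add: y_def dist_norm)
    also have "\<dots> < e" using e(1) by (simp add: norm_sgn)
    finally have "y \<in> cball 0 1" using e(2) by auto
    moreover have "norm y = norm x + e / 2" if "x \<noteq> 0"
    proof -
      have "norm x *\<^sub>R sgn x = x" using that by (simp add: sgn_div_norm)
      then have "y = (norm x + e / 2) *\<^sub>R sgn x" by (simp add: y_def scaleR_add_left)
      then show ?thesis using e(1) \<open>x \<noteq> 0\<close> by (simp add: norm_sgn)
    qed
    ultimately show "x \<in> ball 0 1" using e(1) by (cases "x = 0") auto
  qed
qed

lemma A_space_iff:
  "f \<in> A_space k \<longleftrightarrow> (\<forall>x. x \<notin> cball 0 1 \<longrightarrow> f x = 0) \<and> continuous_on (cball 0 1) f \<and>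
     bounded (f ` cball 0 1) \<and> (\<forall>x\<in>ball 0 1. complex_differentiable_at f x) \<and>
     (k = Uniform \<longrightarrow> uniformly_continuous_on (cball 0 1) f)"
  by (cases k) (auto simp: A_b_def A_u_def interior_unit_cball)

lemma A_space_bounded_linear:
  assumes T: "bounded_linear T" "\<And>c v. T (c *\<^sub>C v) = c *\<^sub>C T v" and f: "f \<in> A_space k"
  shows "(\<lambda>x. T (f x)) \<in> A_space k"
proof -
  interpret bounded_linear T by fact
  have "complex_differentiable_at (\<lambda>x. T (f x)) x" if fx: "complex_differentiable_at f x" for x
  proof -
    obtain F where "(f has_derivative F) (at x)" "\<And>c v. F (c *\<^sub>C v) = c *\<^sub>C F v"
      using fx by (auto simp: complex_differentiable_at_def)
    then show ?thesis unfolding complex_differentiable_at_def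
      using T(2) by (intro exI[of _ "\<lambda>v. T (F v)"]) (auto intro: has_derivative)
  qed
  moreover have "bounded ((\<lambda>x. T (f x)) ` cball 0 1)"
    using bounded_linear_image[OF _ T(1), of "f ` cball 0 1"] f by (simp add: A_space_iff image_image)
  ultimately show ?thesis using f unfolding A_space_iff
    by (auto simp: zero intro: continuous_on uniformly_continuous_on)
qed

lemma A_space_add:
  assumes "f \<in> A_space k" "g \<in> A_space k"
  shows "(\<lambda>x. f x + g x) \<in> A_space k"
proof -
  have "complex_differentiable_at (\<lambda>x. f x + g x) x"
    if fg: "complex_differentiable_at f x" "complex_differentiable_at g x" for x
  proof -
    obtain F G where "(f has_derivative F) (at x)" "\<And>c v. F (c *\<^sub>C v) = c *\<^sub>C F v"
      "(g has_derivative G) (at x)" "\<And>c v. G (c *\<^sub>C v) = c *\<^sub>C G v"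
      using fg by (auto simp: complex_differentiable_at_def)
    then show ?thesis unfolding complex_differentiable_at_def
      by (intro exI[of _ "\<lambda>v. F v + G v"]) (auto intro: has_derivative_add simp: scaleC_add_right)
  qed
  moreover have "bounded ((\<lambda>x. f x + g x) ` cball 0 1)"
    using assms by (auto simp: A_space_iff intro: bounded_plus_comp)
  ultimately show ?thesis using assms unfolding A_space_iff
    by (auto intro: continuous_on_add uniformly_continuous_on_add)
qed

lemma A_space_scaleC:
  assumes "f \<in> A_space k"
  shows "(\<lambda>x. c *\<^sub>C f x) \<in> A_space k"
  using bounded_bilinear.bounded_linear_right[OF bounded_bilinear_scaleC, of c] assms
  by (intro A_space_bounded_linear[where T = "\<lambda>v. c *\<^sub>C v" and f = f]) (simp_all add: scaleC_scaleC mult.commute)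

lemma A_space_scaleC_vector:
  fixes f :: "'x::complex_normed_vector \<Rightarrow> complex"
  assumes "f \<in> A_space k"
  shows "(\<lambda>x. f x *\<^sub>C y) \<in> A_space k"
  using bounded_bilinear.bounded_linear_left[OF bounded_bilinear_scaleC, of y] assms
  by (intro A_space_bounded_linear[where T = "\<lambda>c. c *\<^sub>C y" and f = f]) (simp_all add: scaleC_scaleC scaleC_complex_def)

lemma A_space_diff:
  assumes "f \<in> A_space k" "g \<in> A_space k"
  shows "(\<lambda>x. f x - g x) \<in> A_space k"
proof -
  have "(\<lambda>x. f x + (-1) *\<^sub>C g x) \<in> A_space k"
    using assms by (intro A_space_add A_space_scaleC)
  moreover have "(-1) *\<^sub>C y = - y" for y :: 'b
    using scaleC_of_real[of "-1" y] by simp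
  ultimately show ?thesis by simp
qed

lemma A_space_const: "(\<lambda>x. if x \<in> cball 0 1 then y else 0) \<in> A_space k"
proof -
  define f where "f = (\<lambda>x :: 'a. if x \<in> cball 0 1 then y else 0)"
  have "complex_differentiable_at f x" if "x \<in> ball 0 1" for x
    unfolding complex_differentiable_at_def
  proof (intro exI conjI allI)
    have "((\<lambda>x. y) has_derivative (\<lambda>v. 0)) (at x)" by simp
    then show "(f has_derivative (\<lambda>v. 0)) (at x)"
    proof (rule has_derivative_transform_within_open)
      show "open (ball (0::'a) 1)" "x \<in> ball 0 1" using that by auto
    qed (auto simp: f_def)
  qed auto
  moreover have "uniformly_continuous_on (cball 0 1) f"
    by (auto simp: uniformly_continuous_on_def f_def intro: exI[of _ 1])
  moreover have "bounded (f ` cball 0 1)"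
    by (rule bounded_subset[of "{y}"]) (auto simp: f_def)
  ultimately have "f \<in> A_space k"
    unfolding A_space_iff using uniformly_continuous_imp_continuous by (auto simp: f_def)
  then show ?thesis by (simp add: f_def)
qed

lemma exp_functional_differentiable:
  "complex_differentiable_at (\<lambda>x. exp (complex_functional L x)) x"
proof -
  have "((\<lambda>x. exp (complex_functional L x)) has_derivative (\<lambda>v. exp (complex_functional L x) * complex_functional L v)) (at x)"
    by (rule has_derivative_compose[OF bounded_linear_imp_has_derivative[OF bounded_linear_complex_functional]
        DERIV_exp[unfolded has_field_derivative_def]])
  then show ?thesis unfolding complex_differentiable_at_def
    by (intro exI[of _ "\<lambda>v. exp (complex_functional L x) * complex_functional L v"])
      (auto simp: complex_functional_scaleC scaleC_complex_def mult.left_commute)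
qed

text \<open>The functional maps the unit ball into the disc of radius \<open>norm L\<close>; on this
  compact disc \<open>exp\<close> is bounded and uniformly continuous, which it is not on the whole
  plane.\<close>

lemma A_space_exp_mult:
  assumes f: "f \<in> A_space k"
  shows "(\<lambda>x. exp (complex_functional L x) *\<^sub>C f x) \<in> A_space k"
proof -
  interpret S: bounded_bilinear "(*\<^sub>C) :: complex \<Rightarrow> 'b \<Rightarrow> 'b" by (rule bounded_bilinear_scaleC)
  interpret L: bounded_linear "complex_functional L" by (rule bounded_linear_complex_functional)
  let ?e = "\<lambda>x. exp (complex_functional L x)"
  have le: "norm (complex_functional L x) \<le> norm L" if "x \<in> cball 0 1" for x
    using norm_complex_functional_le[of L x] mult_left_mono[of "norm x" 1 "norm L"] that by simp
  have "uniformly_continuous_on (cball 0 (norm L)) (exp :: complex \<Rightarrow> complex)"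
    by (intro compact_uniformly_continuous continuous_intros) auto
  then have "uniformly_continuous_on (complex_functional L ` cball 0 1) exp"
    by (rule uniformly_continuous_on_mono) (use le in auto)
  then have uc: "uniformly_continuous_on (cball 0 1) ?e"
    by (rule uniformly_continuous_on_compose[OF L.uniformly_continuous_on[OF uniformly_continuous_on_id]])
  have be: "norm (?e x) \<le> exp (norm L)" if "x \<in> cball 0 1" for x
    using norm_exp[of "complex_functional L x"] le[OF that] by (meson exp_le_cancel_iff order_trans)
  have bd: "bounded (?e ` cball 0 1)"
    by (rule boundedI[of _ "exp (norm L)"]) (use be in blast)
  have "bounded (f ` cball 0 1)" using f by (simp add: A_space_iff)
  then obtain B where B: "\<And>x. x \<in> cball 0 1 \<Longrightarrow> norm (f x) \<le> B"
    unfolding bounded_iff by blast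
  have le_B: "norm (?e x *\<^sub>C f x) \<le> exp (norm L) * B" if "x \<in> cball 0 1" for x
    unfolding norm_scaleC using be[OF that] B[OF that] by (intro mult_mono) auto
  have "bounded ((\<lambda>x. ?e x *\<^sub>C f x) ` cball 0 1)"
    by (rule boundedI[of _ "exp (norm L) * B"]) (use le_B in blast)
  moreover have "complex_differentiable_at (\<lambda>x. ?e x *\<^sub>C f x) x" if fx: "complex_differentiable_at f x" for x
  proof -
    obtain F where F: "(f has_derivative F) (at x)" "\<And>c v. F (c *\<^sub>C v) = c *\<^sub>C F v"
      using fx by (auto simp: complex_differentiable_at_def)
    obtain E where E: "(?e has_derivative E) (at x)" "\<And>c v. E (c *\<^sub>C v) = c *\<^sub>C E v"
      using exp_functional_differentiable[of L x] by (auto simp: complex_differentiable_at_def)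
    show ?thesis unfolding complex_differentiable_at_def
      using S.FDERIV[OF E(1) F(1)] E(2) F(2)
      by (intro exI[of _ "\<lambda>v. ?e x *\<^sub>C F v + E v *\<^sub>C f x"])
        (auto simp: scaleC_add_right scaleC_scaleC scaleC_complex_def mult.commute)
  qed
  moreover have "continuous_on (cball 0 1) (\<lambda>x. ?e x *\<^sub>C f x)"
    using f uniformly_continuous_imp_continuous[OF uc] by (intro S.continuous_on) (auto simp: A_space_iff)
  moreover have "uniformly_continuous_on (cball 0 1) (\<lambda>x. ?e x *\<^sub>C f x)" if "k = Uniform"
    using f[unfolded A_space_iff] that
    by (intro bounded_bilinear_uniformly_continuous_on[OF bounded_bilinear_scaleC] uc bd) auto
  ultimately show ?thesis using f unfolding A_space_iff by auto
qed

section \<open>Strong peak functions\<close>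

lemma norm_le_sup_norm: "f \<in> A_space k \<Longrightarrow> x \<in> cball 0 1 \<Longrightarrow> norm (f x) \<le> sup_norm f"
  unfolding sup_norm_def A_space_iff by (intro cSUP_upper) (auto simp: bounded_iff bdd_above_def)

lemma sup_norm_le: "(\<And>x. x \<in> cball 0 1 \<Longrightarrow> norm (f x) \<le> B) \<Longrightarrow> sup_norm f \<le> B"
  unfolding sup_norm_def by (intro cSUP_least) auto

lemma sup_norm_approx:
  assumes "f \<in> A_space k" "a < sup_norm f"
  obtains x where "x \<in> cball 0 1" "a < norm (f x)"
  using assms(2) sup_norm_le[of f a] by (meson linorder_not_less)

lemma sup_norm_nonneg: "f \<in> A_space k \<Longrightarrow> 0 \<le> sup_norm f"
  by (rule order_trans[OF norm_ge_zero norm_le_sup_norm[of f k 0]]) auto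

lemma A_space_outside: "f \<in> A_space k \<Longrightarrow> x \<notin> cball 0 1 \<Longrightarrow> f x = 0"
  by (simp add: A_space_iff)

lemma sup_norm_pos:
  assumes "f \<in> A_space k" "f \<noteq> (\<lambda>_. 0)"
  shows "0 < sup_norm f"
proof -
  obtain x where x: "f x \<noteq> 0" using assms(2) by auto
  then have "x \<in> cball 0 1" using A_space_outside[OF assms(1)] by blast
  from norm_le_sup_norm[OF assms(1) this] x show ?thesis by (metis less_le_trans zero_less_norm_iff)
qed

text \<open>Uniqueness of the maximum point follows from the gap for the radius
  \<open>dist x y\<close>, and every neighbourhood contains a ball.\<close>

lemma peaks_stronglyI:
  assumes "x \<in> cball 0 1" "norm (f x) = sup_norm f"
    and gap: "\<And>r. 0 < r \<Longrightarrow> \<exists>\<delta>>0. \<forall>y\<in>cball 0 1 - ball x r. norm (f y) \<le> sup_norm f - \<delta>"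
  shows "peaks_strongly_at f x"
  unfolding peaks_strongly_at_def
proof (intro conjI ballI impI allI assms)
  fix y assume y: "y \<in> cball 0 1" "norm (f y) = sup_norm f"
  show "y = x"
  proof (rule ccontr)
    assume "y \<noteq> x"
    then obtain \<delta> where "0 < \<delta>" "\<forall>z\<in>cball 0 1 - ball x (dist x y). norm (f z) \<le> sup_norm f - \<delta>"
      using gap[of "dist x y"] by auto
    then show False using y by force
  qed
next
  fix V assume "x \<in> interior V"
  then obtain r where "0 < r" "ball x r \<subseteq> V" by (auto simp: mem_interior)
  then show "\<exists>\<delta>>0. \<forall>y\<in>cball 0 1 - V. norm (f y) \<le> sup_norm f - \<delta>"
    using gap[of r] by blast
qed

text \<open>Multiplying \<open>f\<close> by the exponential of a complex functional adds the real functional \<open>L\<close> to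
  \<open>ln |f|\<close>, so small slices of \<open>ln |f| + L\<close> make the product peak strongly.\<close>

lemma exp_mult_peaks_strongly:
  fixes f :: "'x::complex_banach \<Rightarrow> 'y::complex_banach"
  assumes f: "f \<in> A_space k" "f \<noteq> (\<lambda>_. 0)"
    and slices: "\<And>\<delta>. 0 < \<delta> \<Longrightarrow> has_slice (\<lambda>x. ln (norm (f x)) + blinfun_apply L x) {x\<in>cball 0 1. f x \<noteq> 0} \<delta>"
  defines "h \<equiv> \<lambda>x. exp (complex_functional L x) *\<^sub>C f x"
  shows "\<exists>x. peaks_strongly_at h x"
proof -
  have h: "h \<in> A_space k" unfolding h_def using f(1) by (rule A_space_exp_mult)
  have "h \<noteq> (\<lambda>_. 0)"
  proof
    assume "h = (\<lambda>_. 0)"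
    then have "norm (h x) = 0" for x by simp
    then have "f x = 0" for x by (simp add: h_def norm_scaleC)
    then show False using f(2) by auto
  qed
  then have pos: "0 < sup_norm h" by (rule sup_norm_pos[OF h])
  \<comment> \<open>The level \<open>exp a\<close> is positive, so the zeros of \<open>f\<close>,
    about which the slice of \<open>ln (norm (f x))\<close> says nothing, stay below it.\<close>
  have slice: "\<exists>c b. b < sup_norm h \<and> (\<forall>x\<in>cball 0 1. b < norm (h x) \<longrightarrow> dist c x < \<delta>)" if \<delta>: "0 < \<delta>" for \<delta>
  proof -
    obtain c a x0 where x0: "x0 \<in> cball 0 1" "f x0 \<noteq> 0" "a < ln (norm (f x0)) + blinfun_apply L x0"
      and sl: "\<And>x. x \<in> cball 0 1 \<Longrightarrow> f x \<noteq> 0 \<Longrightarrow> a < ln (norm (f x)) + blinfun_apply L x \<Longrightarrow> dist c x < \<delta>"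
      using slices[OF \<delta>] by (auto simp: has_slice_def)
    have norm_h: "norm (h x) = exp (ln (norm (f x)) + blinfun_apply L x)" if "f x \<noteq> 0" for x
      using that by (simp add: h_def norm_scaleC exp_add mult.commute)
    have "exp a < norm (h x0)" unfolding norm_h[OF x0(2)] using x0(3) by simp
    also have "\<dots> \<le> sup_norm h" by (rule norm_le_sup_norm[OF h x0(1)])
    finally have "exp a < sup_norm h" .
    moreover have "dist c x < \<delta>" if "x \<in> cball 0 1" "exp a < norm (h x)" for x
    proof -
      have "f x \<noteq> 0"
      proof
        assume "f x = 0"
        then show False using that(2) exp_gt_zero[of a] by (simp add: h_def)
      qed
      then show ?thesis using that norm_h sl by auto
    qed
    ultimately show ?thesis by blast
  qed
  have "\<exists>x\<in>cball 0 1. sup_norm h - 1 / real (Suc n) < norm (h x)" for n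
    by (rule sup_norm_approx[OF h, of "sup_norm h - 1 / real (Suc n)"]) auto
  then obtain x where x: "\<And>n. x n \<in> cball 0 1" "\<And>n. sup_norm h - 1 / real (Suc n) < norm (h (x n))"
    by metis
  have "(\<lambda>n. sup_norm h - 1 / real (Suc n)) \<longlonglongrightarrow> sup_norm h - 0"
    by (intro tendsto_intros LIMSEQ_Suc[OF lim_1_over_n])
  then have lower: "(\<lambda>n. sup_norm h - 1 / real (Suc n)) \<longlonglongrightarrow> sup_norm h" by simp
  have lim_le: "(\<lambda>n. norm (h (x n))) \<longlonglongrightarrow> sup_norm h"
  proof (rule tendsto_sandwich[OF _ _ lower tendsto_const])
    show "\<forall>\<^sub>F n in sequentially. sup_norm h - 1 / real (Suc n) \<le> norm (h (x n))"
      by (intro always_eventually allI less_imp_le x(2))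
    show "\<forall>\<^sub>F n in sequentially. norm (h (x n)) \<le> sup_norm h"
      by (intro always_eventually allI norm_le_sup_norm[OF h] x(1))
  qed
  \<comment> \<open>A maximising sequence eventually enters every small slice. Its limit is taken in
    the closed ball, where \<open>h\<close> is continuous, since the set on which \<open>f\<close>
    does not vanish need not be closed.\<close>
  have "Cauchy x"
  proof (rule metric_CauchyI)
    fix e :: real assume "0 < e"
    then obtain c b where cb: "b < sup_norm h" "\<And>y. y \<in> cball 0 1 \<Longrightarrow> b < norm (h y) \<Longrightarrow> dist c y < e / 2"
      using slice[OF half_gt_zero[OF \<open>0 < e\<close>]] by blast
    obtain K where "\<And>n. n \<ge> K \<Longrightarrow> b < norm (h (x n))"
      using order_tendstoD(1)[OF lim_le cb(1)] by (auto simp: eventually_sequentially)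
    then have "dist c (x n) < e / 2" if "n \<ge> K" for n using cb(2) x(1) that by auto
    then show "\<exists>K. \<forall>m\<ge>K. \<forall>n\<ge>K. dist (x m) (x n) < e"
      by (meson dist_triangle_half_r)
  qed
  then obtain z where z: "x \<longlonglongrightarrow> z" using Cauchy_convergent convergent_def by blast
  have zB: "z \<in> cball 0 1" by (rule closed_sequentially[OF closed_cball _ z]) (use x in auto)
  have "(\<lambda>n. h (x n)) \<longlonglongrightarrow> h z"
    using h zB x(1) z by (intro continuous_on_tendsto_compose[of "cball 0 1" h]) (auto simp: A_space_iff)
  then have "(\<lambda>n. norm (h (x n))) \<longlonglongrightarrow> norm (h z)" by (rule tendsto_norm)
  then have hz: "norm (h z) = sup_norm h" using lim_le by (rule LIMSEQ_unique)
  have "peaks_strongly_at h z"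
  proof (rule peaks_stronglyI[OF zB hz])
    fix r :: real assume "0 < r"
    then obtain c b where cb: "b < sup_norm h" "\<And>y. y \<in> cball 0 1 \<Longrightarrow> b < norm (h y) \<Longrightarrow> dist c y < r / 2"
      using slice[OF half_gt_zero[OF \<open>0 < r\<close>]] by blast
    have "dist c z < r / 2" using cb zB hz by auto
    then have "norm (h y) \<le> b" if "y \<in> cball 0 1 - ball z r" for y
      using cb(2)[of y] that dist_triangle_half_r[of c z r y] by force
    then show "\<exists>\<delta>>0. \<forall>y\<in>cball 0 1 - ball z r. norm (h y) \<le> sup_norm h - \<delta>"
      using cb(1) by (intro exI[of _ "sup_norm h - b"]) auto
  qed
  then show ?thesis ..
qed

lemma strong_peak_near_nonzero:
  fixes f :: "'x::complex_banach \<Rightarrow> 'y::complex_banach"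
  assumes rnp: "radon_nikodym_property TYPE(real) TYPE('x)"
    and f: "f \<in> A_space k" "f \<noteq> (\<lambda>_. 0)" and "0 < \<epsilon>"
  shows "\<exists>g\<in>strong_peak_functions k. sup_norm (\<lambda>x. f x - g x) < \<epsilon>"
proof -
  let ?D = "{x\<in>cball 0 1. f x \<noteq> 0}"
  have pos: "0 < sup_norm f" by (rule sup_norm_pos[OF f])
  have "isCont (exp :: complex \<Rightarrow> complex) 0" by simp
  \<comment> \<open>The bound is chosen so that the distance from \<open>f\<close> to
    \<open>g\<close> is at most \<open>\<epsilon> / 2\<close>, since strictness would be lost in the
    supremum.\<close>
  then obtain \<eta> where \<eta>: "0 < \<eta>" "\<And>z :: complex. norm z < \<eta> \<Longrightarrow> norm (exp z - 1) < \<epsilon> / (2 * sup_norm f)"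
    unfolding continuous_at_eps_delta using \<open>0 < \<epsilon>\<close> pos
    by (auto simp: dist_norm elim!: allE[of _ "\<epsilon> / (2 * sup_norm f)"])
  have ln_le: "ln (norm (f x)) \<le> ln (sup_norm f)" if "x \<in> ?D" for x
    using that norm_le_sup_norm[OF f(1), of x] pos by simp
  have sub: "?D \<subseteq> cball 0 1" by auto
  have ne: "?D \<noteq> {}" using f A_space_outside[OF f(1)] by fastforce
  obtain L :: "'x \<Rightarrow>\<^sub>L real" where L: "norm L < \<eta>"
    and slices: "\<And>\<delta>. 0 < \<delta> \<Longrightarrow> has_slice (\<lambda>x. ln (norm (f x)) + blinfun_apply L x) ?D \<delta>"
    using exists_all_small_slices[where \<psi> = "\<lambda>x. ln (norm (f x))", OF rnp sub ne ln_le \<eta>(1)] by blast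
  define g where "g x = exp (complex_functional L x) *\<^sub>C f x" for x
  have g: "g \<in> A_space k" unfolding g_def[abs_def] using f(1) by (rule A_space_exp_mult)
  have "\<exists>x. peaks_strongly_at g x"
    using exp_mult_peaks_strongly[OF f slices] by (simp add: g_def[abs_def])
  moreover have "g \<noteq> (\<lambda>_. 0)"
  proof
    assume "g = (\<lambda>_. 0)"
    then have "norm (g x) = 0" for x by simp
    then have "f x = 0" for x by (simp add: g_def norm_scaleC)
    then show False using f(2) by auto
  qed
  moreover have "sup_norm (\<lambda>x. f x - g x) \<le> \<epsilon> / 2"
  proof (rule sup_norm_le)
    fix x :: 'x assume x: "x \<in> cball 0 1"
    have "norm (complex_functional L x) < \<eta>"
      using norm_complex_functional_le[of L x] mult_left_mono[of "norm x" 1 "norm L"] x L by simp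
    then have "norm (1 - exp (complex_functional L x)) \<le> \<epsilon> / (2 * sup_norm f)"
      using \<eta>(2) by (metis less_imp_le norm_minus_commute)
    moreover have "f x - g x = (1 - exp (complex_functional L x)) *\<^sub>C f x"
      by (simp add: g_def scaleC_diff_left)
    ultimately have "norm (f x - g x) \<le> \<epsilon> / (2 * sup_norm f) * sup_norm f"
      unfolding norm_scaleC using norm_le_sup_norm[OF f(1) x] \<open>0 < \<epsilon>\<close> pos
      by (simp only: norm_scaleC) (intro mult_mono, auto)
    then show "norm (f x - g x) \<le> \<epsilon> / 2" using pos by simp
  qed
  ultimately show ?thesis using g \<open>0 < \<epsilon>\<close> unfolding strong_peak_functions_def by (intro bexI[of _ g]) auto
qed

lemma strong_peak_functions_dense:
  assumes rnp: "radon_nikodym_property TYPE(real) TYPE('x::complex_banach)"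
    and Y: "\<exists>y::'y::complex_banach. y \<noteq> 0"
  shows "dense_in (strong_peak_functions k :: ('x \<Rightarrow> 'y) set) (A_space k)"
  unfolding dense_in_def
proof (intro conjI ballI allI impI)
  show "(strong_peak_functions k :: ('x \<Rightarrow> 'y) set) \<subseteq> A_space k" by (auto simp: strong_peak_functions_def)
  fix f :: "'x \<Rightarrow> 'y" and \<epsilon> :: real assume f: "f \<in> A_space k" and \<epsilon>: "0 < \<epsilon>"
  show "\<exists>g\<in>strong_peak_functions k. sup_norm (\<lambda>x. f x - g x) < \<epsilon>"
  proof (cases "f = (\<lambda>_. 0)")
    case False
    then show ?thesis using strong_peak_near_nonzero[OF rnp f _ \<epsilon>] by blast
  next
    case True
    obtain y :: 'y where "y \<noteq> 0" using Y by auto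
    \<comment> \<open>Multiplication cannot perturb the zero function, so it is first replaced by a
      constant of norm \<open>\<epsilon> / 2\<close>; this is where a nonzero vector of the codomain
      enters.\<close>
    define c where "c = (\<lambda>x::'x. if x \<in> cball 0 1 then (\<epsilon> / 2 / norm y) *\<^sub>R y else 0)"
    have c: "c \<in> A_space k" unfolding c_def by (rule A_space_const)
    have "c 0 \<noteq> 0" using \<open>y \<noteq> 0\<close> \<epsilon> by (simp add: c_def)
    then have "c \<noteq> (\<lambda>_. 0)" by (metis)
    with strong_peak_near_nonzero[OF rnp c] \<epsilon>
    obtain g where g: "g \<in> strong_peak_functions k" "sup_norm (\<lambda>x. c x - g x) < \<epsilon> / 2"
      by (metis half_gt_zero)
    have gA: "g \<in> A_space k" using g(1) by (simp add: strong_peak_functions_def)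
    have "sup_norm (\<lambda>x. f x - g x) \<le> \<epsilon> / 2 + sup_norm (\<lambda>x. c x - g x)"
    proof (rule sup_norm_le)
      fix x :: 'x assume x: "x \<in> cball 0 1"
      have "norm (c x) = \<epsilon> / 2" using x \<open>y \<noteq> 0\<close> \<epsilon> by (simp add: c_def)
      then show "norm (f x - g x) \<le> \<epsilon> / 2 + sup_norm (\<lambda>x. c x - g x)"
        using norm_le_sup_norm[OF A_space_diff[OF c gA] x] norm_triangle_ineq4[of "c x" "c x - g x"] True by simp
    qed
    then show ?thesis using g by (intro bexI[of _ g]) auto
  qed
qed

section \<open>Rules for the supremum norm\<close>

lemma sup_norm_triangle:
  assumes "f \<in> A_space k" "g \<in> A_space k"
  shows "sup_norm f \<le> sup_norm g + sup_norm (\<lambda>x. f x - g x)"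
proof (rule sup_norm_le)
  fix x :: 'a assume x: "x \<in> cball 0 1"
  have "norm (f x) \<le> norm (g x) + norm (f x - g x)" by (rule norm_triangle_sub)
  also have "\<dots> \<le> sup_norm g + sup_norm (\<lambda>x. f x - g x)"
    by (intro add_mono norm_le_sup_norm[OF assms(2) x] norm_le_sup_norm[OF A_space_diff[OF assms] x])
  finally show "norm (f x) \<le> sup_norm g + sup_norm (\<lambda>x. f x - g x)" .
qed

lemma sup_norm_minus_commute: "sup_norm (\<lambda>x. f x - g x) = sup_norm (\<lambda>x. g x - f x)"
  by (simp add: sup_norm_def norm_minus_commute)

lemma sup_norm_scaleC:
  assumes "f \<in> A_space k"
  shows "sup_norm (\<lambda>x. c *\<^sub>C f x) = cmod c * sup_norm f"
proof (rule antisym)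
  show "sup_norm (\<lambda>x. c *\<^sub>C f x) \<le> cmod c * sup_norm f"
    using norm_le_sup_norm[OF assms] by (intro sup_norm_le) (simp add: norm_scaleC mult_left_mono)
  show "cmod c * sup_norm f \<le> sup_norm (\<lambda>x. c *\<^sub>C f x)"
  proof (cases "c = 0")
    case True
    then show ?thesis using sup_norm_nonneg[OF A_space_scaleC[OF assms, of c]] by simp
  next
    case False
    have "norm (f x) \<le> sup_norm (\<lambda>x. c *\<^sub>C f x) / cmod c" if "x \<in> cball 0 1" for x
      using norm_le_sup_norm[OF A_space_scaleC[OF assms, of c] that] False
      by (simp add: norm_scaleC field_simps)
    then have "sup_norm f \<le> sup_norm (\<lambda>x. c *\<^sub>C f x) / cmod c" by (rule sup_norm_le)
    then show ?thesis using False by (simp add: field_simps)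
  qed
qed

lemma sup_norm_const: "sup_norm (\<lambda>x :: 'x::complex_normed_vector. if x \<in> cball 0 1 then y else 0) = norm (y :: 'y::complex_normed_vector)"
proof (rule antisym)
  show "sup_norm (\<lambda>x :: 'x. if x \<in> cball 0 1 then y else 0) \<le> norm y" by (rule sup_norm_le) simp
  show "norm y \<le> sup_norm (\<lambda>x :: 'x. if x \<in> cball 0 1 then y else 0)"
    using norm_le_sup_norm[OF A_space_const[where k = Bounded and y = y], of 0] by simp
qed

section \<open>Norming sets\<close>

lemma peak_point_of_vector_function:
  fixes g :: "'x::complex_normed_vector \<Rightarrow> 'y::complex_normed_vector"
  assumes g: "g \<in> A_space k" "g \<noteq> (\<lambda>_. 0)" and peak: "peaks_strongly_at g x"
  shows "x \<in> strong_peak_points k"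
proof -
  have x: "x \<in> cball 0 1" "norm (g x) = sup_norm g" using peak unfolding peaks_strongly_at_def by blast+
  obtain L :: "'y \<Rightarrow>\<^sub>L real" where L: "norm L \<le> 1" "complex_functional L (g x) = of_real (norm (g x))"
    using exists_norming_functional by blast
  define f where "f = (\<lambda>z. complex_functional L (g z))"
  have f: "f \<in> A_space k" unfolding f_def
    by (rule A_space_bounded_linear[OF bounded_linear_complex_functional _ g(1)])
      (simp add: complex_functional_scaleC scaleC_complex_def)
  have le: "norm (f z) \<le> norm (g z)" for z
    using norm_complex_functional_le[of L "g z"] mult_right_mono[OF L(1), of "norm (g z)"] by (simp add: f_def)
  have fx: "norm (f x) = norm (g x)" by (simp add: f_def L(2))
  have eq: "sup_norm f = sup_norm g"
  proof (rule antisym)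
    show "sup_norm f \<le> sup_norm g"
      using le norm_le_sup_norm[OF g(1)] by (intro sup_norm_le) (meson order_trans)
    show "sup_norm g \<le> sup_norm f" using norm_le_sup_norm[OF f x(1)] fx x(2) by simp
  qed
  have "f \<noteq> (\<lambda>_. 0)" using sup_norm_pos[OF g] fx x(2) by auto
  moreover have "peaks_strongly_at f x"
    unfolding peaks_strongly_at_def eq
  proof (intro conjI ballI impI allI)
    show "x \<in> cball 0 1" "norm (f x) = sup_norm g" using x fx by auto
    fix y assume y: "y \<in> cball 0 1" "norm (f y) = sup_norm g"
    then have "norm (g y) = sup_norm g" using le[of y] norm_le_sup_norm[OF g(1) y(1)] by simp
    then show "y = x" using peak y(1) unfolding peaks_strongly_at_def by blast
  next
    fix V assume "x \<in> interior V"
    then obtain \<delta> where "0 < \<delta>" "\<forall>y\<in>cball 0 1 - V. norm (g y) \<le> sup_norm g - \<delta>"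
      using peak unfolding peaks_strongly_at_def by blast
    then show "\<exists>\<delta>>0. \<forall>y\<in>cball 0 1 - V. norm (f y) \<le> sup_norm g - \<delta>"
      using le by (intro exI[of _ \<delta>]) (meson order_trans)
  qed
  ultimately show ?thesis using f by (auto simp: strong_peak_points_def)
qed

lemma strong_peak_points_subset: "strong_peak_points k \<subseteq> cball 0 1"
  unfolding strong_peak_points_def peaks_strongly_at_def by blast

text \<open>At the peak of a strong peak function \<open>g\<close> close to \<open>f\<close>, the
  function \<open>f\<close> is nearly maximal: exchanging \<open>f\<close> for \<open>g\<close>
  costs less than \<open>e / 2\<close> in the norm and again at the point.\<close>

lemma strong_peak_points_approx:
  fixes f :: "'x::complex_banach \<Rightarrow> 'y::complex_banach"
  assumes dense: "dense_in (strong_peak_functions k :: ('x \<Rightarrow> 'y) set) (A_space k)"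
    and f: "f \<in> A_space k" and e: "0 < e"
  shows "\<exists>x\<in>strong_peak_points k. sup_norm f - e < norm (f x)"
proof -
  obtain g where g: "g \<in> strong_peak_functions k" "sup_norm (\<lambda>x. f x - g x) < e / 2"
    using dense f e unfolding dense_in_def by (meson half_gt_zero)
  then obtain x where gA: "g \<in> A_space k" "g \<noteq> (\<lambda>_. 0)" and peak: "peaks_strongly_at g x"
    by (auto simp: strong_peak_functions_def)
  have x: "x \<in> cball 0 1" "norm (g x) = sup_norm g" using peak unfolding peaks_strongly_at_def by blast+
  have "norm (g x) \<le> norm (f x) + norm (f x - g x)"
    using norm_triangle_ineq4[of "f x" "f x - g x"] by simp
  moreover have "norm (f x - g x) \<le> sup_norm (\<lambda>x. f x - g x)"
    by (rule norm_le_sup_norm[OF A_space_diff[OF f gA(1)] x(1)])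
  ultimately have "sup_norm f - e < norm (f x)"
    using sup_norm_triangle[OF f gA(1)] g(2) x(2) by linarith
  then show ?thesis using peak_point_of_vector_function[OF gA peak] by blast
qed

lemma normingI:
  fixes F :: "'x::complex_normed_vector set"
  assumes F: "F \<subseteq> cball 0 1"
    and approx: "\<And>(f :: 'x \<Rightarrow> 'y::complex_normed_vector) e. f \<in> A_space k \<Longrightarrow> 0 < e \<Longrightarrow> \<exists>x\<in>F. sup_norm f - e < norm (f x)"
  shows "norming (A_space k :: ('x \<Rightarrow> 'y) set) F"
  unfolding norming_def
proof (intro conjI ballI F)
  fix f :: "'x \<Rightarrow> 'y" assume f: "f \<in> A_space k"
  have "F \<noteq> {}" using approx[OF f, of 1] by auto
  have le: "norm (f x) \<le> sup_norm f" if "x \<in> F" for x using norm_le_sup_norm[OF f] F that by auto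
  show "sup_norm f = (SUP x\<in>F. norm (f x))"
  proof (rule antisym)
    show "(SUP x\<in>F. norm (f x)) \<le> sup_norm f" by (rule cSUP_least[OF \<open>F \<noteq> {}\<close> le])
    show "sup_norm f \<le> (SUP x\<in>F. norm (f x))"
    proof (rule field_le_epsilon)
      fix e :: real assume "0 < e"
      then obtain x where x: "x \<in> F" "sup_norm f - e < norm (f x)" using approx[OF f] by blast
      have "norm (f x) \<le> (SUP x\<in>F. norm (f x))"
        using le x(1) by (intro cSUP_upper bdd_aboveI[of _ "sup_norm f"]) auto
      then show "sup_norm f \<le> (SUP x\<in>F. norm (f x)) + e" using x(2) by simp
    qed
  qed
qed

text \<open>If a closed \<open>G\<close> missed the peak point \<open>x\<close> of \<open>f\<close>,
  then \<open>f\<close> would stay below its maximum by a fixed \<delta> on \<open>G\<close>, and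
  \<open>G\<close> would fail to norm the function
  \<open>\<lambda>z. f z *\<^sub>C y\<close>.\<close>

lemma strong_peak_points_minimal:
  fixes G :: "'x::complex_normed_vector set"
  assumes Y: "\<exists>y::'y::complex_normed_vector. y \<noteq> 0"
    and G: "closed G" "norming (A_space k :: ('x \<Rightarrow> 'y) set) G"
  shows "strong_peak_points k \<subseteq> G"
proof
  fix x :: 'x assume "x \<in> strong_peak_points k"
  then obtain f :: "'x \<Rightarrow> complex" where f: "f \<in> A_space k" "f \<noteq> (\<lambda>_. 0)" and peak: "peaks_strongly_at f x"
    by (auto simp: strong_peak_points_def)
  obtain y :: 'y where y: "y \<noteq> 0" using Y by auto
  have x: "x \<in> cball 0 1" "norm (f x) = sup_norm f" using peak unfolding peaks_strongly_at_def by blast+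
  have Gn: "G \<subseteq> cball 0 1" "\<And>h :: 'x \<Rightarrow> 'y. h \<in> A_space k \<Longrightarrow> sup_norm h = (SUP x\<in>G. norm (h x))"
    using G(2) by (auto simp: norming_def)
  show "x \<in> G"
  proof (rule ccontr)
    assume "x \<notin> G"
    then have "x \<in> interior (- G)" using G(1) by (simp add: interior_open open_Compl)
    moreover have "\<forall>V. x \<in> interior V \<longrightarrow> (\<exists>\<delta>>0. \<forall>z\<in>cball 0 1 - V. norm (f z) \<le> sup_norm f - \<delta>)"
      using peak unfolding peaks_strongly_at_def by blast
    ultimately obtain \<delta> where "0 < \<delta>" "\<forall>z\<in>cball 0 1 - - G. norm (f z) \<le> sup_norm f - \<delta>"
      by blast
    then have \<delta>: "0 < \<delta>" "\<And>z. z \<in> G \<Longrightarrow> norm (f z) \<le> sup_norm f - \<delta>"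
      using Gn(1) by auto
    have "G \<noteq> {}"
    proof
      assume "G = {}"
      then have "norm y = norm (2 *\<^sub>R y)"
        using Gn(2)[OF A_space_const[of y k]] Gn(2)[OF A_space_const[of "2 *\<^sub>R y" k]]
        unfolding sup_norm_const by (simp only: image_empty)
      then show False using y by simp
    qed
    define h where "h = (\<lambda>z. f z *\<^sub>C y)"
    have h: "h \<in> A_space k" unfolding h_def by (rule A_space_scaleC_vector[OF f(1)])
    have "sup_norm f * norm y \<le> sup_norm h"
      using norm_le_sup_norm[OF h x(1)] x(2) by (simp add: h_def norm_scaleC)
    also have "\<dots> = (SUP z\<in>G. norm (h z))" by (rule Gn(2)[OF h])
    also have "\<dots> \<le> (sup_norm f - \<delta>) * norm y"
      using \<delta>(2) by (intro cSUP_least \<open>G \<noteq> {}\<close>) (simp add: h_def norm_scaleC mult_right_mono)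
    finally show False using \<delta>(1) y by simp
  qed
qed

section \<open>Complex extreme points\<close>

text \<open>If the disc \<open>x + \<alpha> y\<close> stays in the ball, the maximum principle on the discs
  \<open>t (x + \<alpha> y)\<close> with \<open>t < 1\<close>, in the limit \<open>t \<rightarrow> 1\<close>, finds a point of the circle where a function
  peaking at \<open>x\<close> is as large as at \<open>x\<close>.\<close>

lemma analytic_on_disc:
  fixes f :: "'x::complex_normed_vector \<Rightarrow> complex"
  assumes "complex_differentiable_at f (t *\<^sub>R (x + \<alpha> *\<^sub>C y))"
  shows "(\<lambda>\<alpha>. f (t *\<^sub>R (x + \<alpha> *\<^sub>C y))) field_differentiable (at \<alpha>)"
proof -
  obtain F where F: "(f has_derivative F) (at (t *\<^sub>R (x + \<alpha> *\<^sub>C y)))" "\<And>c v. F (c *\<^sub>C v) = c *\<^sub>C F v"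
    using assms by (auto simp: complex_differentiable_at_def)
  interpret S: bounded_bilinear "(*\<^sub>C) :: complex \<Rightarrow> 'x \<Rightarrow> 'x" by (rule bounded_bilinear_scaleC)
  have "((\<lambda>\<beta>. t *\<^sub>R (x + \<beta> *\<^sub>C y)) has_derivative (\<lambda>\<beta>. t *\<^sub>R (\<beta> *\<^sub>C y))) (at \<alpha>)"
    using has_derivative_add[OF has_derivative_const[of "t *\<^sub>R x"] bounded_linear_imp_has_derivative[OF
        bounded_linear_compose[OF bounded_linear_scaleR_right[of t] S.bounded_linear_left[of y]]]]
    by (simp add: scaleR_add_right)
  from has_derivative_compose[OF this F(1)]
  have "((\<lambda>\<beta>. f (t *\<^sub>R (x + \<beta> *\<^sub>C y))) has_derivative (\<lambda>\<beta>. F (t *\<^sub>R (\<beta> *\<^sub>C y)))) (at \<alpha>)" .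
  moreover have "(\<lambda>\<beta>. F (t *\<^sub>R (\<beta> *\<^sub>C y))) = (*) (F (t *\<^sub>R y))"
  proof
    fix \<beta>
    have "t *\<^sub>R (\<beta> *\<^sub>C y) = \<beta> *\<^sub>C (t *\<^sub>R y)" by (simp add: S.scaleR_right)
    then show "F (t *\<^sub>R (\<beta> *\<^sub>C y)) = F (t *\<^sub>R y) * \<beta>" by (simp add: F(2) scaleC_complex_def mult.commute)
  qed
  ultimately show ?thesis unfolding field_differentiable_def has_field_derivative_def by (intro exI[of _ "F (t *\<^sub>R y)"]) simp
qed

lemma strong_peak_points_complex_extreme:
  "(strong_peak_points k :: 'x::complex_normed_vector set) \<subseteq> complex_extreme_points"
proof
  fix x :: 'x assume "x \<in> strong_peak_points k"
  then obtain f :: "'x \<Rightarrow> complex" where f: "f \<in> A_space k" and peak: "peaks_strongly_at f x"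
    by (auto simp: strong_peak_points_def)
  have x: "x \<in> cball 0 1" "norm (f x) = sup_norm f" using peak unfolding peaks_strongly_at_def by blast+
  have contf: "continuous_on (cball 0 1) f" using f by (simp add: A_space_iff)
  interpret S: bounded_bilinear "(*\<^sub>C) :: complex \<Rightarrow> 'x \<Rightarrow> 'x" by (rule bounded_bilinear_scaleC)
  have "\<exists>\<alpha>. cmod \<alpha> \<le> 1 \<and> x + \<alpha> *\<^sub>C y \<notin> cball 0 1" if "y \<noteq> 0" for y
  proof (rule ccontr)
    assume "\<not> ?thesis"
    then have disc: "\<And>\<alpha>. cmod \<alpha> \<le> 1 \<Longrightarrow> norm (x + \<alpha> *\<^sub>C y) \<le> 1" by auto
    define t where "t n = 1 - 1 / real (Suc (Suc n))" for n
    have t: "0 \<le> t n" "t n < 1" for n by (auto simp: t_def)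
    have tlim: "t \<longlonglongrightarrow> 1"
      unfolding t_def using tendsto_diff[OF tendsto_const[of 1] LIMSEQ_Suc[OF LIMSEQ_Suc[OF lim_1_over_n]]] by simp
    define p where "p n \<alpha> = t n *\<^sub>R (x + \<alpha> *\<^sub>C y)" for n \<alpha>
    have p_ball: "p n \<alpha> \<in> ball 0 1" if "cmod \<alpha> \<le> 1" for n \<alpha>
    proof -
      have "t n * norm (x + \<alpha> *\<^sub>C y) \<le> t n * 1" by (intro mult_left_mono disc that t)
      then show ?thesis using t[of n] by (simp add: p_def)
    qed
    have "\<exists>\<alpha>\<in>sphere 0 1. norm (f (t n *\<^sub>R x)) \<le> norm (f (p n \<alpha>))" for n
    proof -
      have diff: "(\<lambda>\<alpha>. f (p n \<alpha>)) field_differentiable (at \<alpha>)" if "cmod \<alpha> \<le> 1" for \<alpha>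
        unfolding p_def using f p_ball[OF that, of n] by (intro analytic_on_disc) (simp add: A_space_iff p_def)
      have cont: "continuous_on (cball 0 1) (\<lambda>\<alpha>. f (p n \<alpha>))"
        using diff by (intro continuous_at_imp_continuous_on ballI field_differentiable_imp_continuous_at) auto
      have "\<exists>\<alpha>\<in>sphere 0 1. \<forall>\<beta>\<in>sphere 0 1. norm (f (p n \<beta>)) \<le> norm (f (p n \<alpha>))"
        by (rule continuous_attains_sup) (auto intro!: continuous_intros continuous_on_subset[OF cont])
      then obtain \<alpha> where \<alpha>: "\<alpha> \<in> sphere 0 1" "\<And>\<beta>. \<beta> \<in> sphere 0 1 \<Longrightarrow> norm (f (p n \<beta>)) \<le> norm (f (p n \<alpha>))"
        by blast
      have "norm (f (p n 0)) \<le> norm (f (p n \<alpha>))"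
      proof (rule maximum_modulus_frontier[where S = "cball 0 1" and f = "\<lambda>\<alpha>. f (p n \<alpha>)"])
        show "(\<lambda>\<alpha>. f (p n \<alpha>)) holomorphic_on interior (cball 0 1)"
          using diff by (auto simp: holomorphic_on_def intro: field_differentiable_at_within)
      qed (use cont \<alpha> in auto)
      then show ?thesis using \<alpha>(1) by (auto simp: p_def)
    qed
    then obtain a where a: "\<And>n. a n \<in> sphere 0 1" "\<And>n. norm (f (t n *\<^sub>R x)) \<le> norm (f (p n (a n)))"
      by metis
    \<comment> \<open>The maxima are taken on the circle and not on the disc for two reasons: the
      circle is compact, and its points are nonzero, so that \<open>x + \<alpha> *\<^sub>C y\<close>
      differs from \<open>x\<close>.\<close>
    obtain \<alpha> r where \<alpha>: "\<alpha> \<in> sphere 0 1" and r: "strict_mono r" "(a \<circ> r) \<longlonglongrightarrow> \<alpha>"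
      using compact_sphere[of "0::complex" 1] a(1) unfolding compact_def by metis
    have tr: "(\<lambda>n. t (r n)) \<longlonglongrightarrow> 1" using LIMSEQ_subseq_LIMSEQ[OF tlim r(1)] by (simp add: o_def)
    have ar: "(\<lambda>n. a (r n)) \<longlonglongrightarrow> \<alpha>" using r(2) by (simp add: o_def)
    have "(\<lambda>n. p (r n) (a (r n))) \<longlonglongrightarrow> 1 *\<^sub>R (x + \<alpha> *\<^sub>C y)"
      unfolding p_def by (intro tendsto_intros tr S.tendsto ar)
    then have "(\<lambda>n. f (p (r n) (a (r n)))) \<longlonglongrightarrow> f (x + \<alpha> *\<^sub>C y)"
      using disc[of \<alpha>] \<alpha> p_ball a(1)
      by (intro continuous_on_tendsto_compose[OF contf]) (auto simp: less_imp_le)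
    moreover have "(\<lambda>n. t (r n) *\<^sub>R x) \<longlonglongrightarrow> 1 *\<^sub>R x" by (intro tendsto_intros tr)
    then have "(\<lambda>n. f (t (r n) *\<^sub>R x)) \<longlonglongrightarrow> f x"
    proof (intro continuous_on_tendsto_compose[OF contf] always_eventually allI)
      fix n
      have "t (r n) * norm x \<le> 1" using t[of "r n"] x(1) by (intro mult_le_one) auto
      then show "t (r n) *\<^sub>R x \<in> cball 0 1" using t[of "r n"] by simp
    qed (use x in auto)
    ultimately have "norm (f x) \<le> norm (f (x + \<alpha> *\<^sub>C y))"
      using a(2) by (intro LIMSEQ_le[OF tendsto_norm tendsto_norm]) auto
    then have "norm (f (x + \<alpha> *\<^sub>C y)) = sup_norm f"
      using norm_le_sup_norm[OF f, of "x + \<alpha> *\<^sub>C y"] disc[of \<alpha>] \<alpha> x(2) by simp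
    moreover have "x + \<alpha> *\<^sub>C y \<in> cball 0 1" using disc[of \<alpha>] \<alpha> by simp
    ultimately have "x + \<alpha> *\<^sub>C y = x"
      using peak unfolding peaks_strongly_at_def by blast
    then have "norm (\<alpha> *\<^sub>C y) = 0" by simp
    then show False using \<alpha> \<open>y \<noteq> 0\<close> by (simp add: norm_scaleC)
  qed
  then show "x \<in> complex_extreme_points" using x(1) by (simp add: complex_extreme_points_def)
qed

section \<open>Smooth points\<close>

text \<open>Adding a small multiple of a function \<open>v\<close> with \<open>v x = 0\<close> does
  not increase the norm of \<open>g\<close> to first order: near \<open>x\<close> the function
  \<open>v\<close> is small, and away from \<open>x\<close> the gap of \<open>g\<close> absorbs it.
  So \<open>\<psi>\<close> cannot have positive real part at any such \<open>v\<close>.\<close>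

lemma A_space_vanishing_dual:
  assumes g: "g \<in> A_space k" "sup_norm g = 1" and peak: "peaks_strongly_at g x"
    and \<psi>: "\<psi> \<in> dual_ball (A_space k) (\<lambda>f g x. f x + g x) (\<lambda>c f x. c *\<^sub>C f x) sup_norm" and \<psi>g: "Re (\<psi> g) = 1"
    and u: "u \<in> A_space k" "u x = 0"
  shows "\<psi> u = 0"
proof -
  have add: "\<psi> (\<lambda>z. f z + h z) = \<psi> f + \<psi> h" if "f \<in> A_space k" "h \<in> A_space k" for f h
    using \<psi> that unfolding dual_ball_def by blast
  have scale: "\<psi> (\<lambda>z. c *\<^sub>C f z) = c * \<psi> f" if "f \<in> A_space k" for c f
    using \<psi> that unfolding dual_ball_def by blast
  have bound: "cmod (\<psi> f) \<le> sup_norm f" if "f \<in> A_space k" for f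
    using \<psi> that unfolding dual_ball_def by blast
  have x: "x \<in> cball 0 1" using peak unfolding peaks_strongly_at_def by blast
  have gap: "\<exists>\<delta>>0. \<forall>y\<in>cball 0 1 - V. norm (g y) \<le> sup_norm g - \<delta>" if "x \<in> interior V" for V
    using peak that unfolding peaks_strongly_at_def by blast
  have nonpos: "Re (\<psi> v) \<le> 0" if v: "v \<in> A_space k" "v x = 0" for v
  proof (rule field_le_epsilon)
    fix e :: real assume "0 < e"
    have "continuous_on (cball 0 1) v" using v(1) by (simp add: A_space_iff)
    then obtain r where r: "0 < r" "\<And>y. y \<in> cball 0 1 \<Longrightarrow> dist y x < r \<Longrightarrow> dist (v y) (v x) < e"
      using x \<open>0 < e\<close> unfolding continuous_on_iff by blast
    obtain \<delta> where \<delta>: "0 < \<delta>" "\<forall>y\<in>cball 0 1 - ball x r. norm (g y) \<le> sup_norm g - \<delta>"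
      using gap[of "ball x r"] r(1) by (auto simp: interior_open)
    \<comment> \<open>Makes \<open>t * sup_norm v\<close> at most the gap \<open>\<delta>\<close>;
      the summand 1 avoids division by zero.\<close>
    define t where "t = \<delta> / (sup_norm v + 1)"
    have sv: "0 \<le> sup_norm v" by (rule sup_norm_nonneg[OF v(1)])
    have t: "0 < t" using \<delta>(1) sv by (simp add: t_def)
    have "t * sup_norm v \<le> \<delta>" using \<delta>(1) sv by (simp add: t_def field_simps)
    define w where "w z = g z + of_real t *\<^sub>C v z" for z
    have tv: "(\<lambda>z. of_real t *\<^sub>C v z) \<in> A_space k" by (rule A_space_scaleC[OF v(1)])
    have w: "w \<in> A_space k" unfolding w_def[abs_def] by (rule A_space_add[OF g(1) tv])
    have "\<psi> w = \<psi> g + of_real t * \<psi> v"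
      unfolding w_def[abs_def] add[OF g(1) tv] scale[OF v(1)] ..
    then have "1 + t * Re (\<psi> v) = Re (\<psi> w)" using \<psi>g by simp
    also have "\<dots> \<le> sup_norm w" using complex_Re_le_cmod[of "\<psi> w"] bound[OF w] by linarith
    also have "sup_norm w \<le> 1 + t * e"
    proof (rule sup_norm_le)
      fix y assume y: "y \<in> cball (0 :: 'a) 1"
      have "norm (w y) \<le> norm (g y) + t * norm (v y)"
        using norm_triangle_ineq[of "g y" "of_real t *\<^sub>C v y"] t by (simp add: w_def norm_scaleC)
      also have "\<dots> \<le> 1 + t * e"
      proof (cases "y \<in> ball x r")
        case True
        then have "norm (v y) \<le> e" using r(2)[OF y] v(2) by (simp add: dist_commute less_imp_le)
        then show ?thesis using norm_le_sup_norm[OF g(1) y] g(2) t by (intro add_mono mult_left_mono) auto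
      next
        case False
        have "t * norm (v y) \<le> t * sup_norm v" using norm_le_sup_norm[OF v(1) y] t by (intro mult_left_mono) auto
        also have "\<dots> \<le> \<delta>" by fact
        finally have "t * norm (v y) \<le> \<delta>" .
        moreover have "norm (g y) \<le> 1 - \<delta>" using \<delta>(2) y False g(2) by simp
        ultimately have "norm (g y) + t * norm (v y) \<le> 1" by simp
        then show ?thesis using mult_pos_pos[OF t \<open>0 < e\<close>] by linarith
      qed
      finally show "norm (w y) \<le> 1 + t * e" .
    qed
    finally have "t * Re (\<psi> v) \<le> t * e" by simp
    then show "Re (\<psi> v) \<le> 0 + e" using t by simp
  qed
  \<comment> \<open>The functions vanishing at \<open>x\<close> are closed under complex multiples,
    and the factor \<open>cnj (\<psi> u)\<close> turns the value into the square of its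
    modulus.\<close>
  have "Re (\<psi> (\<lambda>z. cnj (\<psi> u) *\<^sub>C u z)) \<le> 0"
    using u by (intro nonpos A_space_scaleC) auto
  also have "\<psi> (\<lambda>z. cnj (\<psi> u) *\<^sub>C u z) = cnj (\<psi> u) * \<psi> u" by (rule scale[OF u(1)])
  finally have "(cmod (\<psi> u))\<^sup>2 \<le> 0" unfolding cmod_power2 by (simp add: power2_eq_square)
  then show ?thesis by simp
qed

text \<open>Each function differs from the constant with its value at \<open>x\<close> by a function
  vanishing at \<open>x\<close>. Hence a functional that norms \<open>g\<close> is determined by its
  restriction \<xi> to the constants, and \<xi> by the smoothness of the codomain at
  \<open>g x\<close>.\<close>

lemma strong_peak_function_smooth:
  fixes g :: "'x::complex_normed_vector \<Rightarrow> 'y::complex_normed_vector"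
  assumes Y: "smooth_space TYPE('y)"
    and g: "g \<in> A_space k" "sup_norm g = 1" and peak: "peaks_strongly_at g x"
  shows "g \<in> A_smooth_points k"
proof -
  let ?dual = "dual_ball (A_space k :: ('x \<Rightarrow> 'y) set) (\<lambda>f g x. f x + g x) (\<lambda>c f x. c *\<^sub>C f x) sup_norm"
  let ?dualY = "dual_ball (UNIV :: 'y set) (+) (*\<^sub>C) norm"
  define const where "const v = (\<lambda>z :: 'x. if z \<in> cball 0 1 then v else 0)" for v :: 'y
  have const: "const v \<in> A_space k" "sup_norm (const v) = norm v" for v
    unfolding const_def by (rule A_space_const sup_norm_const)+
  have x: "x \<in> cball 0 1" "norm (g x) = 1"
    using peak g(2) unfolding peaks_strongly_at_def by auto
  then have "g x \<in> smooth_points UNIV (+) (*\<^sub>C) norm"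
    using Y unfolding smooth_space_def by auto
  then obtain \<phi> where \<phi>: "\<phi> \<in> ?dualY" "1 = Re (\<phi> (g x))"
    and uniq: "\<And>\<xi>. \<xi> \<in> ?dualY - {\<phi>} \<Longrightarrow> Re (\<phi> (g x)) > Re (\<xi> (g x))"
    unfolding smooth_points_def by blast
  have \<phi>_add: "\<phi> (v + w) = \<phi> v + \<phi> w" and \<phi>_scale: "\<phi> (c *\<^sub>C v) = c * \<phi> v" and \<phi>_bound: "cmod (\<phi> v) \<le> norm v" for v w c
    using \<phi>(1) by (simp_all add: dual_ball_def)
  define \<Phi> where "\<Phi> = restrict (\<lambda>h :: 'x \<Rightarrow> 'y. \<phi> (h x)) (A_space k)"
  have "\<Phi> \<in> ?dual"
    unfolding dual_ball_def
  proof (intro CollectI conjI ballI allI)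
    show "\<Phi> \<in> extensional (A_space k)" by (simp add: \<Phi>_def)
    show "\<Phi> (\<lambda>z. u z + v z) = \<Phi> u + \<Phi> v" if "u \<in> A_space k" "v \<in> A_space k" for u v
      using that A_space_add[OF that] by (simp add: \<Phi>_def \<phi>_add)
    show "\<Phi> (\<lambda>z. c *\<^sub>C u z) = c * \<Phi> u" if "u \<in> A_space k" for c u
      using that A_space_scaleC[OF that, of c] by (simp add: \<Phi>_def \<phi>_scale)
    show "cmod (\<Phi> u) \<le> sup_norm u" if "u \<in> A_space k" for u
      using that \<phi>_bound[of "u x"] norm_le_sup_norm[OF that x(1)] by (simp add: \<Phi>_def)
  qed
  moreover have \<Phi>g: "1 = Re (\<Phi> g)" using g(1) \<phi>(2) by (simp add: \<Phi>_def)
  moreover have "Re (\<Psi> g) < Re (\<Phi> g)" if \<Psi>: "\<Psi> \<in> ?dual - {\<Phi>}" for \<Psi>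
  proof (rule ccontr)
    assume not_less: "\<not> Re (\<Psi> g) < Re (\<Phi> g)"
    have dual: "\<Psi> \<in> ?dual" using \<Psi> by simp
    have add: "\<Psi> (\<lambda>z. f z + h z) = \<Psi> f + \<Psi> h" if "f \<in> A_space k" "h \<in> A_space k" for f h
      using dual that unfolding dual_ball_def by blast
    have scale: "\<Psi> (\<lambda>z. c *\<^sub>C f z) = c * \<Psi> f" if "f \<in> A_space k" for c f
      using dual that unfolding dual_ball_def by blast
    have bound: "cmod (\<Psi> f) \<le> sup_norm f" if "f \<in> A_space k" for f
      using dual that unfolding dual_ball_def by blast
    have \<Psi>g: "Re (\<Psi> g) = 1"
      using not_less \<Phi>g bound[OF g(1)] g(2) complex_Re_le_cmod[of "\<Psi> g"] by linarith
    define \<xi> where "\<xi> v = \<Psi> (const v)" for v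
    have eval: "\<Psi> h = \<xi> (h x)" if h: "h \<in> A_space k" for h
    proof -
      define u where "u = (\<lambda>z. h z - const (h x) z)"
      have u: "u \<in> A_space k" unfolding u_def by (rule A_space_diff[OF h const(1)])
      have "u x = 0" using x(1) by (simp add: u_def const_def)
      then have "\<Psi> u = 0" by (rule A_space_vanishing_dual[OF g peak dual \<Psi>g u])
      moreover have "h = (\<lambda>z. u z + const (h x) z)" by (simp add: u_def)
      ultimately show ?thesis using add[OF u const(1)[of "h x"]] by (simp add: \<xi>_def)
    qed
    have "\<xi> \<in> ?dualY"
      unfolding dual_ball_def
    proof (intro CollectI conjI ballI allI)
      fix v w :: 'y and c
      have "const (v + w) = (\<lambda>z. const v z + const w z)" by (auto simp: const_def)
      then show "\<xi> (v + w) = \<xi> v + \<xi> w" using add[OF const(1)[of v] const(1)[of w]] by (simp add: \<xi>_def)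
      have "const (c *\<^sub>C v) = (\<lambda>z. c *\<^sub>C const v z)" by (auto simp: const_def)
      then show "\<xi> (c *\<^sub>C v) = c * \<xi> v" using scale[OF const(1)[of v]] by (simp add: \<xi>_def)
      show "cmod (\<xi> v) \<le> norm v" using bound[OF const(1)[of v]] const(2)[of v] by (simp add: \<xi>_def)
    qed simp
    moreover have "Re (\<xi> (g x)) = 1" using eval[OF g(1)] \<Psi>g by simp
    ultimately have "\<xi> = \<phi>" using uniq[of \<xi>] \<phi>(2) by auto
    \<comment> \<open>Outside the function space the two agree because both are extensional.\<close>
    then have "\<Psi> h = \<Phi> h" for h
      using eval[of h] dual by (cases "h \<in> A_space k") (auto simp: \<Phi>_def dual_ball_def extensional_def)
    then show False using \<Psi> by auto
  qed
  ultimately show ?thesis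
    unfolding A_smooth_points_def smooth_points_def using g by blast
qed

lemma peaks_strongly_at_scaleC:
  assumes g: "g \<in> A_space k" and peak: "peaks_strongly_at g x" and c: "c \<noteq> 0"
  shows "peaks_strongly_at (\<lambda>z. c *\<^sub>C g z) x"
proof (rule peaks_stronglyI)
  have x: "x \<in> cball 0 1" "norm (g x) = sup_norm g"
    and gap: "\<And>V. x \<in> interior V \<Longrightarrow> \<exists>\<delta>>0. \<forall>y\<in>cball 0 1 - V. norm (g y) \<le> sup_norm g - \<delta>"
    using peak unfolding peaks_strongly_at_def by blast+
  show "x \<in> cball 0 1" by (rule x(1))
  show "norm (c *\<^sub>C g x) = sup_norm (\<lambda>z. c *\<^sub>C g z)" by (simp add: norm_scaleC sup_norm_scaleC[OF g] x(2))
  fix r :: real assume "0 < r"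
  then obtain \<delta> where \<delta>: "0 < \<delta>" "\<forall>y\<in>cball 0 1 - ball x r. norm (g y) \<le> sup_norm g - \<delta>"
    using gap[of "ball x r"] by (auto simp: interior_open)
  have "norm (c *\<^sub>C g y) \<le> sup_norm (\<lambda>z. c *\<^sub>C g z) - cmod c * \<delta>" if "y \<in> cball 0 1 - ball x r" for y
  proof -
    have "cmod c * norm (g y) \<le> cmod c * (sup_norm g - \<delta>)"
      using \<delta>(2) that by (intro mult_left_mono) auto
    then show ?thesis by (simp add: norm_scaleC sup_norm_scaleC[OF g] right_diff_distrib)
  qed
  then show "\<exists>\<delta>>0. \<forall>y\<in>cball 0 1 - ball x r. norm (c *\<^sub>C g y) \<le> sup_norm (\<lambda>z. c *\<^sub>C g z) - \<delta>"
    using \<delta>(1) c by (intro exI[of _ "cmod c * \<delta>"]) auto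
qed

lemma smooth_points_dense:
  assumes Y: "smooth_space TYPE('y::complex_banach)"
    and dense: "dense_in (strong_peak_functions k :: ('x::complex_banach \<Rightarrow> 'y) set) (A_space k)"
  shows "dense_in (A_smooth_points k) {f \<in> (A_space k :: ('x \<Rightarrow> 'y) set). sup_norm f = 1}"
  unfolding dense_in_def
proof (intro conjI ballI allI impI)
  show "A_smooth_points k \<subseteq> {f \<in> (A_space k :: ('x \<Rightarrow> 'y) set). sup_norm f = 1}"
    unfolding A_smooth_points_def smooth_points_def by blast
  fix f :: "'x \<Rightarrow> 'y" and \<epsilon> :: real
  assume "f \<in> {f \<in> A_space k. sup_norm f = 1}" and \<epsilon>: "0 < \<epsilon>"
  then have f: "f \<in> A_space k" "sup_norm f = 1" by auto
  \<comment> \<open>The distance to the normalised function will be at most \<open>e + e\<close>,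
    which \<open>\<epsilon> / 3\<close> keeps below \<open>\<epsilon>\<close>; the bound
    \<open>1 / 2\<close> keeps the norm of \<open>g\<close> positive, so that it can be
    normalised.\<close>
  define e where "e = min (\<epsilon> / 3) (1 / 2)"
  have e: "0 < e" "e \<le> \<epsilon> / 3" "e < 1" using \<epsilon> by (auto simp: e_def)
  obtain g where gS: "g \<in> strong_peak_functions k" and fg: "sup_norm (\<lambda>x. f x - g x) < e"
    using dense f(1) e(1) unfolding dense_in_def by blast
  have g: "g \<in> A_space k" using gS by (simp add: strong_peak_functions_def)
  obtain x where peak: "peaks_strongly_at g x" using gS by (auto simp: strong_peak_functions_def)
  define s where "s = sup_norm g"
  have s: "\<bar>1 - s\<bar> \<le> e" "0 < s"
    using sup_norm_triangle[OF f(1) g] sup_norm_triangle[OF g f(1)] sup_norm_minus_commute[of f g] fg f(2) e(3)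
    by (auto simp: s_def)
  define h where "h = (\<lambda>z. of_real (1 / s) *\<^sub>C g z)"
  have h: "h \<in> A_space k" unfolding h_def by (rule A_space_scaleC[OF g])
  have "sup_norm h = 1" unfolding h_def sup_norm_scaleC[OF g] using s(2) by (simp add: s_def norm_divide)
  moreover have "peaks_strongly_at h x"
    unfolding h_def using s(2) by (intro peaks_strongly_at_scaleC[OF g peak]) auto
  ultimately have "h \<in> A_smooth_points k" using strong_peak_function_smooth[OF Y h] by blast
  moreover have "sup_norm (\<lambda>x. f x - h x) \<le> e + e"
  proof (rule sup_norm_le)
    fix z :: 'x assume z: "z \<in> cball 0 1"
    have "g z - h z = complex_of_real (1 - 1 / s) *\<^sub>C g z"
      by (simp only: h_def of_real_diff of_real_1 scaleC_diff_left scaleC_one)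
    then have "norm (g z - h z) = \<bar>1 - 1 / s\<bar> * norm (g z)"
      by (simp only: norm_scaleC norm_of_real)
    also have "\<dots> \<le> \<bar>1 - 1 / s\<bar> * s"
      using norm_le_sup_norm[OF g z] by (intro mult_left_mono) (auto simp: s_def)
    also have "\<dots> = \<bar>(1 - 1 / s) * s\<bar>" using s(2) by (simp add: abs_mult)
    also have "(1 - 1 / s) * s = - (1 - s)" using s(2) by (simp add: field_simps)
    finally have "norm (g z - h z) \<le> e" using s(1) by simp
    moreover have "norm (f z - g z) \<le> e"
      using norm_le_sup_norm[OF A_space_diff[OF f(1) g] z] fg by simp
    ultimately show "norm (f z - h z) \<le> e + e"
      using norm_triangle_ineq[of "f z - g z" "g z - h z"] by simp
  qed
  ultimately show "\<exists>g\<in>A_smooth_points k. sup_norm (\<lambda>x. f x - g x) < \<epsilon>"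
    using e \<epsilon> by (intro bexI[of _ h]) auto
qed

theorem theorem4p3:
  fixes k :: algebra_kind
  assumes "radon_nikodym_property TYPE(real) TYPE('x::complex_banach)"
    and "\<exists>y::'y::complex_banach. y \<noteq> 0"
  shows "dense_in (strong_peak_functions k :: ('x \<Rightarrow> 'y) set) (A_space k)
    \<and> (smooth_space TYPE('y) \<longrightarrow>
         dense_in (A_smooth_points k) {f \<in> (A_space k :: ('x \<Rightarrow> 'y) set). sup_norm f = 1})
    \<and> norming (A_space k :: ('x \<Rightarrow> 'y) set) (strong_peak_points k)
    \<and> smallest_closed_norming (A_space k :: ('x \<Rightarrow> 'y) set) (closure (strong_peak_points k))
    \<and> norming (A_space k :: ('x \<Rightarrow> 'y) set) complex_extreme_points"
proof -
  have dense: "dense_in (strong_peak_functions k :: ('x \<Rightarrow> 'y) set) (A_space k)"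
    by (rule strong_peak_functions_dense[OF assms])
  \<comment> \<open>Stated for all sets between the strong peak points and the ball, so as to cover
    the peak points, their closure and the complex extreme points.\<close>
  have norming: "norming (A_space k :: ('x \<Rightarrow> 'y) set) F"
    if "strong_peak_points k \<subseteq> F" "F \<subseteq> cball 0 1" for F :: "'x set"
    using strong_peak_points_approx[OF dense] that by (intro normingI) blast+
  have "closure (strong_peak_points k) \<subseteq> cball (0 :: 'x) 1"
    by (intro closure_minimal strong_peak_points_subset closed_cball)
  then have "smallest_closed_norming (A_space k :: ('x \<Rightarrow> 'y) set) (closure (strong_peak_points k))"
    unfolding smallest_closed_norming_def
  proof (intro conjI allI impI closed_closure norming closure_subset)
    fix G :: "'x set" assume "closed G" "norming (A_space k :: ('x \<Rightarrow> 'y) set) G"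
    then show "closure (strong_peak_points k) \<subseteq> G"
      using strong_peak_points_minimal[OF assms(2)] by (intro closure_minimal)
  qed
  moreover have "norming (A_space k :: ('x \<Rightarrow> 'y) set) complex_extreme_points"
    using strong_peak_points_complex_extreme[of k]
    by (intro norming) (auto simp: complex_extreme_points_def)
  ultimately show ?thesis
    using dense smooth_points_dense[OF _ dense] norming[OF order_refl strong_peak_points_subset] by blast
qed

end
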